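(* Assume $m=n$ for all $n$. Assume that $\mu_{X_n}$ converges almost surely weakly to a non-random compactly supported probability measure $\mu_X$, that the smallest singular value of $X_n$ converges almost surely to $a:=\inf\operatorname{supp}\mu_X$, that $a>0$, and that $\nu$ has mean zero, variance one and satisfies a log-Sobolev inequality. Let $\widetilde X_n=X_n+P_n$, with $P_n$ built according to either the i.i.d. model or the orthonormalized model. Then, as $n\to\infty$, for each fixed $1\le i\le r$, $$\sigma_{n+1-i}(\widetilde X_n)\xrightarrow{\ \mathrm{a.s.}\ }\begin{cases}\varphi_{\mu_X}^{-1}(-1/\theta_i)&\text{if }\theta_i>\underline\theta,\\ a&\text{otherwise.}\end{cases}$$ Moreover, for each fixed $i>r$, $\sigma_{n+1-i}(\widetilde X_n)\to a$ almost surely.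
   Context: Let $\mathbb K=\mathbb R$ or $\mathbb C$. $X_n$ is an $n\times n$ random matrix with entries in $\mathbb K$. The singular values of an $n\times n$ matrix $M$ are written $\sigma_1(M)\ge\cdots\ge\sigma_n(M)$, and $\mu_{X_n}=\frac1n\sum_{i=1}^n\delta_{\sigma_i(X_n)}$. Perturbation. Fix $r\ge1$ and deterministic $\theta_1\ge\cdots\ge\theta_r>0$, independent of $n$. Let $\nu$ be a probability measure on $\mathbb K$. For every $n$ let $G_u^{(n)}$, $G_v^{(n)}$ be two independent $n\times r$ matrices with i.i.d. entries of law $\nu$; the families $(G_u^{(n)},G_v^{(n)})_n$ and $(X_n)_n$ are independent. Column vectors $u_1,\dots,u_r,v_1,\dots,v_r\in\mathbb K^{n\times1}$ are obtained in one of two ways. i.i.d. model: $u_i$, $v_i$ are the $i$-th columns of $\frac1{\sqrt n}G_u^{(n)}$, $\frac1{\sqrt n}G_v^{(n)}$. Orthonormalized model: the $u_i$'s (resp. $v_i$'s) result from Gram-Schmidt orthonormalization of the columns of $G_u^{(n)}$ (resp. $G_v^{(n)}$), which is well defined with probability tending to one. Set $P_n=\sum_{i=1}^r\theta_iu_iv_i^*$ and $\widetilde X_n=X_n+P_n$. Log-Sobolev inequality: there is a constant $C>0$ such that $\int f^2\log\frac{f^2}{\int f^2d\nu}\,d\nu\le 2C\int|\nabla f|^2d\nu$ for all continuously differentiable $f\in L^2(\nu)$ (with $\mathbb C$ identified with $\mathbb R^2$). $\varphi_{\mu_X}(z)=\int\frac{z}{z^2-t^2}d\mu_X(t)$ for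 $z\in(0,a)$, where it is negative; $\varphi_{\mu_X}^{-1}$ is the functional inverse of $\varphi_{\mu_X}$ on $(0,a)$. With $\varphi_{\mu_X}(a^-)=\lim_{z\uparrow a}\varphi_{\mu_X}(z)$, the threshold is $\underline\theta=(-\varphi_{\mu_X}(a^-))^{-1}$, with the convention $(+\infty)^{-1}=0$. *)

theory Defs
  imports
    "HOL-Probability.Probability"
    "Jordan_Normal_Form.Char_Poly"
    "Jordan_Normal_Form.Schur_Decomposition"
begin

text \<open>
  Matrices over \<open>\<real>\<close> or \<open>\<complex>\<close> are complex matrices with entries in
  \<open>K = \<real>\<close> or \<open>K = UNIV\<close>; likewise a law on \<open>\<real>\<close> is a law on the complex plane carried by
  the real line.
\<close>

subsection \<open>Singular values\<close>

text \<open>Square roots of the eigenvalues of \<open>A A\<^sup>*\<close>, with algebraic multiplicity, in decreasing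
  order.\<close>

definition sing_vals :: "complex mat \<Rightarrow> real list" where
  "sing_vals A = rev (sorted_list_of_multiset
     (image_mset (\<lambda>z. sqrt (Re z)) (proots (char_poly (A * mat_adjoint A)))))"

text \<open>Indexing starts at 1; the value is unspecified beyond the number of rows.\<close>

definition sing_val :: "complex mat \<Rightarrow> nat \<Rightarrow> real" where
  "sing_val A k = sing_vals A ! (k - 1)"

definition sing_val_measure :: "complex mat \<Rightarrow> real measure" where
  "sing_val_measure A = distr (uniform_count_measure {1..dim_row A}) borel (sing_val A)"

subsection \<open>Measures on the line and in Euclidean space\<close>

definition measure_support :: "'a::topological_space measure \<Rightarrow> 'a set" where
  "measure_support \<mu> = {x. \<forall>U. open U \<and> x \<in> U \<longrightarrow> emeasure \<mu> U > 0}"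

text \<open>The entropy on the left is always well defined in \<open>(-\<infinity>, \<infinity>]\<close>, so the inequality has
  content only if the Dirichlet energy is finite, and then it includes finiteness of the entropy.
  The library values \<open>ln 0 = 0\<close> and \<open>x / 0 = 0\<close> give \<open>0 log 0 = 0\<close>.\<close>

definition log_sobolev :: "'a::euclidean_space measure \<Rightarrow> bool" where
  "log_sobolev \<nu> \<longleftrightarrow> (\<exists>C>0. \<forall>(f :: 'a \<Rightarrow> real) g.
     (\<forall>x. GDERIV f x :> g x) \<and> continuous_on UNIV g \<and>
     integrable \<nu> (\<lambda>x. (f x)\<^sup>2) \<and> integrable \<nu> (\<lambda>x. (norm (g x))\<^sup>2) \<longrightarrow>
     integrable \<nu> (\<lambda>x. (f x)\<^sup>2 * ln ((f x)\<^sup>2 / (\<integral>y. (f y)\<^sup>2 \<partial>\<nu>))) \<and>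
     (\<integral>x. (f x)\<^sup>2 * ln ((f x)\<^sup>2 / (\<integral>y. (f y)\<^sup>2 \<partial>\<nu>)) \<partial>\<nu>)
       \<le> 2 * C * (\<integral>x. (norm (g x))\<^sup>2 \<partial>\<nu>))"

text \<open>Over \<open>\<real>\<close> the test functions and gradients live on the line; over \<open>\<complex>\<close> they live on
  the plane, the inner product of \<^typ>\<open>complex\<close> being that of \<open>\<real>\<^sup>2\<close>.\<close>

definition log_sobolev_over :: "complex set \<Rightarrow> complex measure \<Rightarrow> bool" where
  "log_sobolev_over K \<nu> \<longleftrightarrow>
     (if K = \<real> then log_sobolev (distr \<nu> borel Re) else log_sobolev \<nu>)"

definition phi :: "real measure \<Rightarrow> real \<Rightarrow> real" where
  "phi \<mu> z = (\<integral>t. z / (z\<^sup>2 - t\<^sup>2) \<partial>\<mu>)"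

definition phi_inv :: "real measure \<Rightarrow> real \<Rightarrow> real \<Rightarrow> real" where
  "phi_inv \<mu> a = the_inv_into {0<..<a} (phi \<mu>)"

text \<open>The left limit may be \<open>-\<infinity>\<close>; in \<^typ>\<open>ereal\<close> the inverse of \<open>\<infinity>\<close> is 0.\<close>

definition lower_threshold :: "real measure \<Rightarrow> real \<Rightarrow> ereal" where
  "lower_threshold \<mu> a = inverse (- Lim (at_left a) (\<lambda>z. ereal (phi \<mu> z)))"

subsection \<open>The perturbation\<close>

text \<open>\<open>\<Sum>\<^sub>i \<theta>\<^sub>i u\<^sub>i v\<^sub>i\<^sup>*\<close>, where \<open>u\<^sub>i\<close> and \<open>v\<^sub>i\<close> are the columns of index \<open>i - 1\<close> of
  \<open>U\<close> and \<open>V\<close>.\<close>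

definition low_rank :: "nat \<Rightarrow> nat \<Rightarrow> (nat \<Rightarrow> real) \<Rightarrow> complex mat \<Rightarrow> complex mat \<Rightarrow> complex mat" where
  "low_rank n r \<theta> U V = Matrix.mat n n (\<lambda>(k, l).
     \<Sum>i\<in>{1..r}. complex_of_real (\<theta> i) * U $$ (k, i - 1) * cnj (V $$ (l, i - 1)))"

definition iid_columns :: "nat \<Rightarrow> complex mat \<Rightarrow> complex mat \<Rightarrow> bool" where
  "iid_columns n G U \<longleftrightarrow> U = complex_of_real (1 / sqrt (real n)) \<cdot>\<^sub>m G"

definition normalize_cvec :: "complex Matrix.vec \<Rightarrow> complex Matrix.vec" where
  "normalize_cvec w = complex_of_real (1 / sqrt (Re (w \<bullet>c w))) \<cdot>\<^sub>v w"

text \<open>\<open>gram_schmidt\<close> only orthogonalizes, and it returns a zero vector exactly when a column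
  depends linearly on the preceding ones. Orthonormalization is then impossible, and \<open>U\<close> is left
  arbitrary.\<close>

definition gram_schmidt_columns :: "nat \<Rightarrow> complex mat \<Rightarrow> complex mat \<Rightarrow> bool" where
  "gram_schmidt_columns n G U \<longleftrightarrow>
     U \<in> carrier_mat n (dim_col G) \<and>
     (0\<^sub>v n \<notin> set (gram_schmidt n (cols G)) \<longrightarrow>
        U = mat_of_cols n (map normalize_cvec (gram_schmidt n (cols G))))"

subsection \<open>Independence\<close>

text \<open>The events determined by a whole family of complex random variables.\<close>

definition generated_events :: "'w measure \<Rightarrow> 'i set \<Rightarrow> ('i \<Rightarrow> 'w \<Rightarrow> complex) \<Rightarrow> 'w set set" where
  "generated_events M I Y =
     sets (vimage_algebra (space M) (\<lambda>\<omega>. \<lambda>i\<in>I. Y i \<omega>) (PiM I (\<lambda>_. borel)))"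

end

theory Submission
  imports
    Defs
    "HOL-Combinatorics.Permutations"
    "Jordan_Normal_Form.Spectral_Radius"
    "HOL-Real_Asymp.Real_Asymp"
begin

text \<open>
  Since \<open>phi \<mu> z = - z m z\<close> with \<open>m z = \<integral> 1 / (t\<^sup>2 - z\<^sup>2) d\<mu>\<close>, the claim is that each fixed
  \<open>z\<close> below the edge eventually has exactly as many singular values of the perturbed matrix \<open>Y\<close>
  below it as there are \<open>i\<close> with \<open>z m z > 1 / \<theta> i\<close>.  Singular values of \<open>Y\<close> against \<open>z\<close> are read off the
  inertia of the form \<open>(w, v) \<mapsto> 2 Re \<langle>w, Y\<^sup>* v\<rangle> - z |w|\<^sup>2 - z |v|\<^sup>2\<close>.  Completing the square turns it
  into the same form for \<open>X\<close> plus a form in \<open>2 r\<close> variables whose coefficients are bilinear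
  expressions of the columns of \<open>U\<close>, \<open>V\<close> in the resolvent of \<open>X X\<^sup>*\<close> at \<open>z\<^sup>2\<close>;
  counting dimensions then bounds the singular values of \<open>Y\<close>.

  The log-Sobolev inequality is only used for the eighth moment of \<open>\<nu>\<close>.  It gives a fourth
  moment bound for centered quadratic forms in the entries, so by Borel-Cantelli these forms, divided by
  \<open>n\<close>, converge almost surely to normalized traces, hence to integrals against \<open>\<mu>\<close>.  Doing this
  for all rational \<open>z\<close> below the edge suffices.  The bound by the edge from above comes from Weyl's
  inequality for rank \<open>r\<close> perturbations.
\<close>

text \<open>The pair \<open>c1\<close>, \<open>c2\<close> carries the form -2 Re <c1, D c2> with D
  the diagonal matrix of the 1 / theta, which has r squares of each sign. Added to the form of
  \<open>Y\<close> and regrouped, it yields the form of \<open>X\<close>, with n squares of each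
  sign when z is below the edge, plus a form in \<open>c1\<close>, \<open>c2\<close> alone. The
  latter converges to r two-by-two blocks with eigenvalues -z m - 1/theta and -z m + 1/theta; only
  the second can be positive, and it is negative exactly when z m > 1/theta. Comparing signs turns
  the number of these blocks into the number of singular values of \<open>Y\<close> below z. Signs
  are stable under small errors, so entrywise convergence of r by r matrices suffices.
  Orthonormalized columns are not built from independent entries. The limits are therefore proved
  for the raw columns and transferred by bilinearity, Gram-Schmidt being asymptotically a mere
  division by sqrt n. Fourth moments are taken because the normalized forms have variance of order
  1/n, which is not summable, while their fourth moments are of order 1/n^2.\<close>

subsection \<open>Moments from the log-Sobolev inequality\<close>

text \<open>This is ln u <= u - 1 at u = sqrt (m / F). With F = f^2 and m its mean, it bounds the
  entropy below by 2 m - 2 sqrt m L, where L is the mean of |f|.\<close>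

lemma mult_ln_ge_two_sqrt:
  fixes F m :: real
  assumes "m > 0" "F \<ge> 0"
  shows "F * ln (F / m) \<ge> 2 * F - 2 * sqrt m * sqrt F"
proof (cases "F = 0")
  case False
  then have F: "F > 0" using assms by simp
  have "ln (sqrt (m / F)) \<le> sqrt (m / F) - 1"
    using assms F by (intro ln_le_minus_one) simp
  then have "ln (F / m) \<ge> 2 - 2 * sqrt (m / F)"
    using assms F by (simp add: ln_sqrt ln_div)
  then have "F * ln (F / m) \<ge> F * (2 - 2 * sqrt (m / F))"
    using F by (intro mult_left_mono) auto
  also have "F * (2 - 2 * sqrt (m / F)) = 2 * F - 2 * sqrt m * sqrt F"
    using F by (simp add: real_sqrt_divide field_simps)
  finally show ?thesis .
qed simp

text \<open>Integrating the pointwise bound gives m - sqrt m L <= D, and 2 sqrt m L <= m + L^2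
  removes the square root. The gain is that the second moment is controlled by a lower absolute
  moment and the energy.\<close>

lemma entropy_bound_imp_second_moment_bound:
  fixes f :: "'a \<Rightarrow> real"
  assumes "prob_space \<nu>"
    and f2: "integrable \<nu> (\<lambda>x. (f x)\<^sup>2)" and f1: "integrable \<nu> f"
    and ent: "integrable \<nu> (\<lambda>x. (f x)\<^sup>2 * ln ((f x)\<^sup>2 / (\<integral>y. (f y)\<^sup>2 \<partial>\<nu>)))"
      "(\<integral>x. (f x)\<^sup>2 * ln ((f x)\<^sup>2 / (\<integral>y. (f y)\<^sup>2 \<partial>\<nu>)) \<partial>\<nu>) \<le> 2 * D"
  shows "(\<integral>x. (f x)\<^sup>2 \<partial>\<nu>) \<le> (\<integral>x. \<bar>f x\<bar> \<partial>\<nu>)\<^sup>2 + 2 * D"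
proof -
  define m where "m = (\<integral>x. (f x)\<^sup>2 \<partial>\<nu>)"
  define L where "L = (\<integral>x. \<bar>f x\<bar> \<partial>\<nu>)"
  have m0: "m \<ge> 0" unfolding m_def by (rule integral_nonneg_AE) simp
  show ?thesis
  proof (cases "m = 0")
    case True
    \<comment> \<open>The quotient by m = 0 and then \<open>ln 0\<close> are both 0, so the entropy
      hypothesis only says D >= 0.\<close>
    have "(\<integral>x. (f x)\<^sup>2 * ln ((f x)\<^sup>2 / m) \<partial>\<nu>) = 0" using True by simp
    then have "D \<ge> 0" using ent(2) unfolding m_def by simp
    then show ?thesis using True unfolding m_def[symmetric] by simp
  next
    case False
    then have mp: "m > 0" using m0 by simp
    have "2 * m - 2 * sqrt m * L = (\<integral>x. 2 * (f x)\<^sup>2 - 2 * sqrt m * \<bar>f x\<bar> \<partial>\<nu>)"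
      unfolding m_def[symmetric] L_def using f2 f1 by (simp add: m_def)
    also have "\<dots> \<le> (\<integral>x. (f x)\<^sup>2 * ln ((f x)\<^sup>2 / m) \<partial>\<nu>)"
      using f2 f1 ent(1) mult_ln_ge_two_sqrt[OF mp]
      by (intro integral_mono) (auto simp: m_def[symmetric] intro!: order_trans[OF _ mult_ln_ge_two_sqrt[OF mp]])
    also have "\<dots> \<le> 2 * D" using ent(2) by (simp add: m_def)
    finally have "m - sqrt m * L \<le> D" by simp
    moreover have "2 * (sqrt m * L) \<le> m + L\<^sup>2"
      using sum_squares_bound[of "sqrt m" L] mp by simp
    ultimately show ?thesis unfolding m_def[symmetric] L_def[symmetric] by linarith
  qed
qed

text \<open>A smooth truncation of \<open>w ^ (k + 1)\<close> growing only like \<open>w ^ k\<close>, so that its square root is an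
  admissible test function once the \<open>k\<close>-th moment is finite.\<close>

definition damped_power :: "nat \<Rightarrow> real \<Rightarrow> real \<Rightarrow> real" where
  "damped_power k R w = R * w ^ (k + 1) / (R + w)"

lemma damped_power_DERIV:
  assumes "R > 0" "w > 0"
  shows "(damped_power k R has_real_derivative
     R * (real (k + 1) * w ^ k * (R + w) - w ^ (k + 1)) / (R + w)\<^sup>2) (at w)"
  unfolding damped_power_def
  by (rule DERIV_cong[OF DERIV_divide[OF DERIV_cmult[OF DERIV_pow] DERIV_add[OF DERIV_const DERIV_ident]]])
    (use assms in \<open>auto simp: power2_eq_square algebra_simps\<close>)

lemma damped_power_pos: "R > 0 \<Longrightarrow> w > 0 \<Longrightarrow> damped_power k R w > 0"
  by (simp add: damped_power_def add_pos_pos)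

lemma damped_power_le:
  assumes "R > 0" "w > 0" shows "damped_power k R w \<le> w ^ (k + 1)"
    "damped_power k R w \<le> R * w ^ k"
  using assms by (auto simp: damped_power_def field_simps add_pos_pos)

text \<open>The second bound says that the logarithmic derivative is at most (k + 1) / w,
  independently of R. This uniformity is what lets R tend to infinity.\<close>

lemma damped_power_deriv_bound:
  fixes R w :: real and k :: nat
  assumes "R > 0" "w > 0"
  defines "d \<equiv> R * (real (k + 1) * w ^ k * (R + w) - w ^ (k + 1)) / (R + w)\<^sup>2"
  shows "0 \<le> d" "d * w \<le> real (k + 1) * damped_power k R w"
proof -
  have "w ^ (k+1) \<le> real (k + 1) * w ^ k * w" using assms by simp
  also have "\<dots> \<le> real (k + 1) * w ^ k * (R + w)" using assms by (intro mult_left_mono) auto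
  finally show "0 \<le> d" unfolding d_def using assms by simp
  have "d \<le> R * (real (k + 1) * w ^ k * (R + w)) / (R + w)\<^sup>2"
    unfolding d_def using assms by (intro divide_right_mono mult_left_mono) auto
  also have "\<dots> = R * (real (k + 1) * w ^ k) / (R + w)"
    using assms by (simp add: power2_eq_square)
  finally have "d * w \<le> R * (real (k + 1) * w ^ k) / (R + w) * w"
    using assms by (intro mult_right_mono) auto
  then show "d * w \<le> real (k + 1) * damped_power k R w"
    by (simp add: damped_power_def algebra_simps)
qed

lemma GDERIV_inner_self: "GDERIV (\<lambda>y. 1 + y \<bullet> y) x :> 2 *\<^sub>R x"
  unfolding gderiv_def by (auto intro!: derivative_eq_intros simp: inner_commute)

text \<open>The test function is the square root of
  \<open>damped_power k R (1 + x \<bullet> x)\<close>. Its first absolute moment and its energy are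
  bounded through the k-th moment uniformly in R, hence so is its second moment, and Fatou's lemma
  in R gives moment k + 1.\<close>

lemma log_sobolev_moment_step:
  fixes \<nu> :: "'a::euclidean_space measure"
  assumes P: "prob_space \<nu>" and S: "sets \<nu> = sets borel" and lsi: "log_sobolev \<nu>"
    and k: "k \<ge> 1" and int: "integrable \<nu> (\<lambda>x. (1 + x \<bullet> x) ^ k)"
  shows "integrable \<nu> (\<lambda>x. (1 + x \<bullet> x) ^ (k + 1))"
proof -
  interpret prob_space \<nu> by fact
  have [measurable_cong]: "sets \<nu> = sets borel" by fact
  obtain C where C: "C > 0" and lsi: "\<And>(f :: 'a \<Rightarrow> real) g.
     (\<forall>x. GDERIV f x :> g x) \<Longrightarrow> continuous_on UNIV g \<Longrightarrow>
     integrable \<nu> (\<lambda>x. (f x)\<^sup>2) \<Longrightarrow> integrable \<nu> (\<lambda>x. (norm (g x))\<^sup>2) \<Longrightarrow>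
     integrable \<nu> (\<lambda>x. (f x)\<^sup>2 * ln ((f x)\<^sup>2 / (\<integral>y. (f y)\<^sup>2 \<partial>\<nu>))) \<and>
     (\<integral>x. (f x)\<^sup>2 * ln ((f x)\<^sup>2 / (\<integral>y. (f y)\<^sup>2 \<partial>\<nu>)) \<partial>\<nu>)
       \<le> 2 * C * (\<integral>x. (norm (g x))\<^sup>2 \<partial>\<nu>)"
    using lsi unfolding log_sobolev_def by blast
  define w where "w = (\<lambda>x::'a. 1 + x \<bullet> x)"
  have w1: "w x \<ge> 1" for x by (simp add: w_def)
  have w0: "w x > 0" for x using w1[of x] by linarith
  have wm[measurable]: "w \<in> borel_measurable borel" unfolding w_def by simp
  define A where "A = (\<integral>x. w x ^ k \<partial>\<nu>)"
  have int: "integrable \<nu> (\<lambda>x. w x ^ k)" using int by (simp add: w_def)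
  \<comment> \<open>The square of \<open>A\<close> bounds the squared first absolute moment of the
    test function, the other term comes from its energy; R does not occur.\<close>
  define K where "K = A\<^sup>2 + 2 * (C * ((real (k + 1))\<^sup>2 * A))"
  have main: "(\<integral>x. damped_power k R (w x) \<partial>\<nu>) \<le> K"
    and intd: "integrable \<nu> (\<lambda>x. damped_power k R (w x))" if R: "R > 0" for R
  proof -
    define d where "d = (\<lambda>w. R * (real (k + 1) * w ^ k * (R + w) - w ^ (k + 1)) / (R + w)\<^sup>2)"
    define f where "f = (\<lambda>x. sqrt (damped_power k R (w x)))"
    define g where "g = (\<lambda>x. (inverse (f x) / 2 * d (w x)) *\<^sub>R (2 *\<^sub>R x))"
    have dp: "damped_power k R (w x) > 0" for x using damped_power_pos[OF R w0] .
    have fp: "f x > 0" for x using dp by (simp add: f_def)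
    have f2: "(f x)\<^sup>2 = damped_power k R (w x)" for x using dp[of x] by (simp add: f_def)
    have gd: "GDERIV f x :> g x" for x
    proof -
      have "((\<lambda>u. sqrt (damped_power k R u)) has_real_derivative inverse (f x) / 2 * d (w x)) (at (w x))"
        unfolding f_def d_def
        by (rule DERIV_chain2[where f = sqrt, OF DERIV_real_sqrt damped_power_DERIV]) (use dp w0 R in auto)
      from GDERIV_DERIV_compose[OF GDERIV_inner_self this[unfolded w_def]]
      show ?thesis by (simp add: f_def g_def w_def)
    qed
    have contw: "continuous_on UNIV w" unfolding w_def by (intro continuous_intros)
    have Rw: "R + w x \<noteq> 0" for x using R w0[of x] by linarith
    have contf: "continuous_on UNIV f"
      unfolding f_def damped_power_def by (intro continuous_intros contw) (use Rw in auto)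
    have contg: "continuous_on UNIV g"
      unfolding g_def d_def by (intro continuous_intros contw contf) (use fp Rw in \<open>auto simp: less_imp_neq[symmetric]\<close>)
    have [measurable]: "f \<in> borel_measurable borel" "g \<in> borel_measurable borel"
      using contf contg by (auto intro: borel_measurable_continuous_onI)
    have if2: "integrable \<nu> (\<lambda>x. (f x)\<^sup>2)"
    proof (rule Bochner_Integration.integrable_bound)
      show "integrable \<nu> (\<lambda>x. R * w x ^ k)" using int by simp
      show "AE x in \<nu>. norm ((f x)\<^sup>2) \<le> norm (R * w x ^ k)"
        using damped_power_le(2)[OF R w0] dp R w0 f2 by (auto simp: abs_of_pos less_imp_le)
    qed measurable
    then show "integrable \<nu> (\<lambda>x. damped_power k R (w x))" by (simp add: f2)
    have gb: "(norm (g x))\<^sup>2 \<le> (real (k + 1))\<^sup>2 * w x ^ k" for x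
    proof -
      define W where "W = w x" define p where "p = damped_power k R W"
      have W: "W > 0" "W \<ge> 1" using w0 w1 by (auto simp: W_def)
      have p: "p > 0" using dp by (simp add: p_def W_def)
      have pw: "p \<le> W ^ k * W" using damped_power_le(1)[OF R W(1), of k] by (simp add: p_def mult.commute)
      \<comment> \<open>Since w has gradient 2 x, the gradient of sqrt p is p' x / sqrt p. Then
        |x|^2 <= w and p' w <= (k + 1) p leave (k + 1)^2 p / w.\<close>
      have "(norm (g x))\<^sup>2 = (d W)\<^sup>2 * (x \<bullet> x) / p"
        unfolding g_def using f2[of x] fp[of x] p
        by (simp add: power_mult_distrib power2_norm_eq_inner W_def p_def field_simps)
      also have "\<dots> \<le> (d W)\<^sup>2 * W / p"
        using p by (intro divide_right_mono mult_left_mono) (auto simp: W_def w_def)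
      also have "\<dots> = (d W * W)\<^sup>2 / (p * W)" using p W by (simp add: field_simps power2_eq_square)
      also have "\<dots> \<le> (real (k + 1) * p)\<^sup>2 / (p * W)"
        using damped_power_deriv_bound[OF R W(1), of k] p W
        by (intro divide_right_mono power_mono mult_nonneg_nonneg) (auto simp: d_def p_def)
      also have "\<dots> = (real (k + 1))\<^sup>2 * (p / W)" using p W by (simp add: field_simps power2_eq_square)
      also have "\<dots> \<le> (real (k + 1))\<^sup>2 * W ^ k"
        using pw W by (intro mult_left_mono) (auto simp: field_simps)
      finally show ?thesis by (simp add: W_def)
    qed
    have ig: "integrable \<nu> (\<lambda>x. (norm (g x))\<^sup>2)"
    proof (rule Bochner_Integration.integrable_bound)
      show "integrable \<nu> (\<lambda>x. (real (k + 1))\<^sup>2 * w x ^ k)" using int by simp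
      show "AE x in \<nu>. norm ((norm (g x))\<^sup>2) \<le> norm ((real (k + 1))\<^sup>2 * w x ^ k)"
        using gb w0 by (auto intro!: AE_I2 simp: abs_mult abs_of_pos)
    qed measurable
    \<comment> \<open>The square of f is at most w^(k + 1) <= w^(2 k), by k >= 1 and w >= 1.\<close>
    have fw: "\<bar>f x\<bar> \<le> w x ^ k" for x
    proof -
      have "(f x)\<^sup>2 \<le> w x ^ (k + 1)" using damped_power_le(1)[OF R w0] f2 by simp
      also have "\<dots> \<le> w x ^ (k + k)" using w1 k by (intro power_increasing) auto
      also have "\<dots> = (w x ^ k)\<^sup>2" by (simp add: power_add power2_eq_square)
      finally show ?thesis using fp[of x] w0[of x] by (simp add: power2_le_iff_abs_le)
    qed
    have if1: "integrable \<nu> f"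
      by (rule Bochner_Integration.integrable_bound[OF int])
        (use fw w0 in \<open>auto intro!: AE_I2 simp: abs_of_pos less_imp_le\<close>)
    note l = lsi[OF allI[OF gd] contg if2 ig]
    have "(\<integral>x. (f x)\<^sup>2 \<partial>\<nu>) \<le> (\<integral>x. \<bar>f x\<bar> \<partial>\<nu>)\<^sup>2 + 2 * (C * (\<integral>x. (norm (g x))\<^sup>2 \<partial>\<nu>))"
      using l by (intro entropy_bound_imp_second_moment_bound[OF P if2 if1]) (auto simp: mult.assoc)
    also have "\<dots> \<le> A\<^sup>2 + 2 * (C * (\<integral>x. (real (k + 1))\<^sup>2 * w x ^ k \<partial>\<nu>))"
      unfolding A_def
      by (intro add_mono power_mono mult_left_mono integral_mono integral_nonneg_AE)
        (use C if1 int ig fw gb in auto)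
    also have "\<dots> = K" using int by (simp add: K_def A_def)
    finally show "(\<integral>x. damped_power k R (w x) \<partial>\<nu>) \<le> K" by (simp add: f2)
  qed
  have lim: "(\<lambda>n. damped_power k (real (Suc n)) (w x)) \<longlonglongrightarrow> w x ^ (k + 1)" for x
  proof -
    have "(\<lambda>n. w x ^ (k + 1) * (real (Suc n) / (real (Suc n) + w x))) \<longlonglongrightarrow> w x ^ (k + 1) * 1"
      by (intro tendsto_mult tendsto_const) (real_asymp)
    then show ?thesis by (simp add: damped_power_def mult_ac)
  qed
  \<comment> \<open>Fatou's lemma along R = 1, 2, 3, ...\<close>
  have "(\<integral>\<^sup>+x. ennreal (w x ^ (k + 1)) \<partial>\<nu>)
     = (\<integral>\<^sup>+x. liminf (\<lambda>n. ennreal (damped_power k (real (Suc n)) (w x))) \<partial>\<nu>)"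
    by (intro nn_integral_cong) (metis lim lim_imp_Liminf sequentially_bot tendsto_ennrealI trivial_limit_sequentially)
  also have "\<dots> \<le> liminf (\<lambda>n. \<integral>\<^sup>+x. ennreal (damped_power k (real (Suc n)) (w x)) \<partial>\<nu>)"
    unfolding damped_power_def by (intro nn_integral_liminf) measurable
  also have "\<dots> \<le> liminf (\<lambda>n. ennreal K)"
  proof (intro Liminf_mono always_eventually allI)
    fix n
    have "(\<integral>\<^sup>+x. ennreal (damped_power k (real (Suc n)) (w x)) \<partial>\<nu>)
        = ennreal (\<integral>x. damped_power k (real (Suc n)) (w x) \<partial>\<nu>)"
      using damped_power_pos[OF _ w0] by (intro nn_integral_eq_integral intd) (auto intro!: AE_I2 less_imp_le)
    then show "(\<integral>\<^sup>+x. ennreal (damped_power k (real (Suc n)) (w x)) \<partial>\<nu>) \<le> ennreal K"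
      using main[of "real (Suc n)"] by (auto intro: ennreal_leI)
  qed
  also have "\<dots> < \<infinity>" by (simp add: Liminf_const)
  finally have "(\<integral>\<^sup>+x. ennreal (w x ^ (k + 1)) \<partial>\<nu>) < \<infinity>" .
  then show ?thesis
    using w0 by (intro integrableI_bounded) (auto simp: w_def abs_of_pos less_imp_le)
qed

lemma log_sobolev_moments:
  fixes \<nu> :: "'a::euclidean_space measure"
  assumes "prob_space \<nu>" "sets \<nu> = sets borel" "log_sobolev \<nu>" "integrable \<nu> (\<lambda>x. (norm x)\<^sup>2)"
  shows "integrable \<nu> (\<lambda>x. (1 + x \<bullet> x) ^ k)"
proof (induction k rule: nat_less_induct)
  case (1 k)
  interpret prob_space \<nu> by fact
  consider "k = 0" | "k = 1" | "k \<ge> 2" by linarith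
  then show ?case
  proof cases
    case 2 then show ?thesis using assms(4) by (simp add: power2_norm_eq_inner)
  next
    case 3
    then show ?thesis using log_sobolev_moment_step[OF assms(1-3), of "k - 1"] 1 by simp
  qed simp
qed

text \<open>Over the reals the inequality concerns the law of the real part. As the law is carried
  by the line, \<open>cmod\<close> and the real part have the same square almost everywhere.\<close>

lemma log_sobolev_over_moments:
  assumes K: "K = \<real> \<or> K = UNIV" and "prob_space \<nu>" "sets \<nu> = sets borel" "AE z in \<nu>. z \<in> K"
    and "log_sobolev_over K \<nu>" "integrable \<nu> (\<lambda>z. (cmod z)\<^sup>2)"
  shows "integrable \<nu> (\<lambda>z. (1 + (cmod z)\<^sup>2) ^ k)"
proof (cases "K = \<real>")
  case True
  interpret prob_space \<nu> by fact
  have [measurable_cong]: "sets \<nu> = sets borel" by fact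
  have AE: "AE z in \<nu>. (cmod z)\<^sup>2 = (Re z)\<^sup>2"
    using assms(4) by eventually_elim (use True in \<open>auto simp: Reals_def\<close>)
  have ls: "log_sobolev (distr \<nu> borel Re)" using assms(5) True by (simp add: log_sobolev_over_def)
  have "integrable \<nu> (\<lambda>z. (norm (Re z))\<^sup>2)"
    by (rule Bochner_Integration.integrable_bound[OF assms(6)])
      (auto intro!: AE_I2 power_mono abs_Re_le_cmod simp: power2_le_iff_abs_le abs_Re_le_cmod)
  then have "integrable (distr \<nu> borel Re) (\<lambda>x. (norm x)\<^sup>2)"
    by (subst integrable_distr_eq) auto
  from log_sobolev_moments[OF prob_space_distr _ ls this]
  have "integrable (distr \<nu> borel Re) (\<lambda>x. (1 + x \<bullet> x) ^ k)" by simp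
  then have "integrable \<nu> (\<lambda>z. (1 + Re z * Re z) ^ k)"
    by (subst (asm) integrable_distr_eq) auto
  then show ?thesis
    by (rule integrable_cong_AE_imp) (use AE in \<open>auto simp: power2_eq_square\<close>)
next
  case False
  then have "log_sobolev \<nu>" using assms(5) by (simp add: log_sobolev_over_def)
  from log_sobolev_moments[OF assms(2,3) this assms(6), of k]
  show ?thesis by (simp add: power2_norm_eq_inner)
qed

subsection \<open>Fourth moments of centered quadratic forms\<close>

text \<open>The term linear in d is kept exactly because it has mean zero once d is centered. The
  cubic term is split by 4 s t^3 <= 2 s^2 t^2 + 2 t^4, whence the constants 8 and 3.\<close>

lemma norm_add_pow4_le:
  fixes S d :: complex
  shows "cmod (S + d) ^ 4 \<le> cmod S ^ 4 + 4 * (cmod S)\<^sup>2 * Re (cnj S * d) + 8 * (cmod S)\<^sup>2 * (cmod d)\<^sup>2 + 3 * cmod d ^ 4"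
proof -
  define s t p where "s = cmod S" and "t = cmod d" and "p = Re (cnj S * d)"
  have st: "s \<ge> 0" "t \<ge> 0" by (auto simp: s_def t_def)
  have p: "\<bar>p\<bar> \<le> s * t"
    using abs_Re_le_cmod[of "cnj S * d"] by (simp add: p_def s_def t_def norm_mult)
  have "(cmod (S + d))\<^sup>2 = s\<^sup>2 + 2 * p + t\<^sup>2"
    unfolding s_def t_def p_def cmod_power2 by (simp add: power2_eq_square algebra_simps)
  then have "cmod (S + d) ^ 4 = (s\<^sup>2 + 2 * p + t\<^sup>2)\<^sup>2"
    by (metis (no_types) numeral_times_numeral power_mult semiring_norm(11,13) mult_2 numeral_Bit0)
  also have "\<dots> = s^4 + 4 * p\<^sup>2 + t^4 + 4 * s\<^sup>2 * p + 2 * s\<^sup>2 * t\<^sup>2 + 4 * p * t\<^sup>2"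
    by (simp add: power2_eq_square power4_eq_xxxx algebra_simps)
  also have "\<dots> \<le> s^4 + 4 * (s * t)\<^sup>2 + t^4 + 4 * s\<^sup>2 * p + 2 * s\<^sup>2 * t\<^sup>2 + 4 * (s * t) * t\<^sup>2"
    using p st by (intro add_mono mult_left_mono mult_right_mono order_refl) (auto simp: abs_le_square_iff[symmetric])
  also have "\<dots> \<le> s^4 + 4 * s\<^sup>2 * p + 8 * s\<^sup>2 * t\<^sup>2 + 3 * t^4"
  proof -
    have "0 \<le> 2 * (s * t - t\<^sup>2)\<^sup>2" by simp
    then show ?thesis by (simp add: power2_eq_square power4_eq_xxxx algebra_simps)
  qed
  finally show ?thesis by (simp add: s_def t_def p_def)
qed

text \<open>The value of \<open>L\<close> makes the cross term \<open>2 L F \<rho>\<close> on the right equal to the bound that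
  Cauchy-Schwarz gives for the mixed term on the left.\<close>

lemma fourth_moment_increment:
  fixes s Q :: "'a \<Rightarrow> real"
  assumes [measurable]: "s \<in> borel_measurable N" "Q \<in> borel_measurable N"
    and nn: "\<And>x. Q x \<ge> 0" "F \<ge> 0" "\<rho> \<ge> 0" "c \<ge> 0" "\<kappa> \<ge> 1"
    and L: "L = 16 * \<kappa>\<^sup>2 * c"
    and s: "(\<integral>\<^sup>+x. ennreal (s x ^ 4) \<partial>N) \<le> ennreal (L * F\<^sup>2)"
    and Q: "(\<integral>\<^sup>+x. ennreal ((Q x)\<^sup>2) \<partial>N) \<le> ennreal (c * \<rho>\<^sup>2)"
  shows "(\<integral>\<^sup>+x. ennreal (s x ^ 4 + 8 * \<kappa> * ((s x)\<^sup>2 * Q x + (Q x)\<^sup>2)) \<partial>N) \<le> ennreal (L * (F + \<rho>)\<^sup>2)"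
proof -
  have L0: "L \<ge> 0" using nn L by simp
  define X where "X = (\<integral>\<^sup>+x. ennreal ((s x)\<^sup>2 * Q x) \<partial>N)"
  \<comment> \<open>The square root of the product of the two bounds \<open>s\<close> and
    \<open>Q\<close>.\<close>
  define b where "b = 4 * \<kappa> * c * F * \<rho>"
  have b0: "b \<ge> 0" using nn by (simp add: b_def)
  have "X\<^sup>2 = (\<integral>\<^sup>+x. ennreal ((s x)\<^sup>2) * ennreal (Q x) \<partial>N)\<^sup>2"
    unfolding X_def using nn by (simp add: ennreal_mult)
  also have "\<dots> \<le> (\<integral>\<^sup>+x. (ennreal ((s x)\<^sup>2))\<^sup>2 \<partial>N) * (\<integral>\<^sup>+x. (ennreal (Q x))\<^sup>2 \<partial>N)"
    by (rule Cauchy_Schwarz_nn_integral) measurable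
  also have "\<dots> = (\<integral>\<^sup>+x. ennreal (s x ^ 4) \<partial>N) * (\<integral>\<^sup>+x. ennreal ((Q x)\<^sup>2) \<partial>N)"
    using nn by (simp add: ennreal_power flip: power_mult)
  also have "\<dots> \<le> ennreal (L * F\<^sup>2) * ennreal (c * \<rho>\<^sup>2)" by (intro mult_mono s Q) auto
  also have "\<dots> = ennreal (b\<^sup>2)"
    using nn L0 by (subst ennreal_mult[symmetric]) (auto simp: b_def L power2_eq_square algebra_simps)
  also have "\<dots> = (ennreal b)\<^sup>2" using b0 by (simp add: ennreal_power)
  finally have "X\<^sup>2 \<le> (ennreal b)\<^sup>2" .
  then have Xb: "X \<le> ennreal b"
  proof (cases X)
    case (real x)
    then show ?thesis using \<open>X\<^sup>2 \<le> (ennreal b)\<^sup>2\<close> b0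
      by (auto simp: ennreal_power power2_le_iff_abs_le intro!: ennreal_leI)
  next
    case top
    then have "ennreal b * ennreal b = \<top>"
      using \<open>X\<^sup>2 \<le> (ennreal b)\<^sup>2\<close> by (simp add: top_unique power2_eq_square)
    then show ?thesis using ennreal_mult_eq_top_iff[of "ennreal b" "ennreal b"] by simp
  qed
  have "(\<integral>\<^sup>+x. ennreal (s x ^ 4 + 8 * \<kappa> * ((s x)\<^sup>2 * Q x + (Q x)\<^sup>2)) \<partial>N)
    = (\<integral>\<^sup>+x. ennreal (s x ^ 4) + ennreal (8 * \<kappa>) * (ennreal ((s x)\<^sup>2 * Q x) + ennreal ((Q x)\<^sup>2)) \<partial>N)"
    using nn by (intro nn_integral_cong) (simp add: ennreal_plus[symmetric] ennreal_mult[symmetric] del: ennreal_plus)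
  also have "\<dots> = (\<integral>\<^sup>+x. ennreal (s x ^ 4) \<partial>N) + ennreal (8 * \<kappa>) * (X + (\<integral>\<^sup>+x. ennreal ((Q x)\<^sup>2) \<partial>N))"
    unfolding X_def by (simp add: nn_integral_add nn_integral_cmult)
  also have "\<dots> \<le> ennreal (L * F\<^sup>2) + ennreal (8 * \<kappa>) * (ennreal b + ennreal (c * \<rho>\<^sup>2))"
    by (intro add_mono mult_left_mono s Q Xb) auto
  also have "\<dots> = ennreal (L * F\<^sup>2 + 8 * \<kappa> * (b + c * \<rho>\<^sup>2))"
    using nn L0 b0 by (simp add: ennreal_plus[symmetric] ennreal_mult[symmetric] del: ennreal_plus)
  also have "\<dots> \<le> ennreal (L * (F + \<rho>)\<^sup>2)"
  proof (rule ennreal_leI)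
    have "\<kappa> * c * \<rho>\<^sup>2 \<le> \<kappa>\<^sup>2 * c * \<rho>\<^sup>2"
      using nn by (intro mult_right_mono) (auto simp: power2_eq_square)
    moreover have "0 \<le> \<kappa>\<^sup>2 * c * \<rho>\<^sup>2" using nn by simp
    ultimately have "8 * (\<kappa> * c * \<rho>\<^sup>2) \<le> 16 * (\<kappa>\<^sup>2 * c * \<rho>\<^sup>2)" by linarith
    then show "L * F\<^sup>2 + 8 * \<kappa> * (b + c * \<rho>\<^sup>2) \<le> L * (F + \<rho>)\<^sup>2"
      by (simp add: b_def L power2_eq_square algebra_simps)
  qed
  finally show ?thesis .
qed

lemma sum3_square_le:
  fixes a b c :: real
  shows "(a + b + c)\<^sup>2 \<le> 3 * (a\<^sup>2 + b\<^sup>2 + c\<^sup>2)"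
proof -
  have "0 \<le> (a - b)\<^sup>2 + (b - c)\<^sup>2 + (a - c)\<^sup>2" by simp
  then show ?thesis by (simp add: power2_eq_square algebra_simps)
qed


text \<open>The exponent 4, that is eight moments: a quadratic form contains squares of single
  entries, and its fourth power is integrated.\<close>

locale standard_law = prob_space \<nu> for \<nu> :: "complex measure" +
  assumes sets_law[measurable_cong]: "sets \<nu> = sets borel"
    and law_mean: "integrable \<nu> (\<lambda>z. z)" "(\<integral>z. z \<partial>\<nu>) = 0"
    and law_var: "integrable \<nu> (\<lambda>z. (cmod z)\<^sup>2)" "(\<integral>z. (cmod z)\<^sup>2 \<partial>\<nu>) = 1"
    and law_moment: "integrable \<nu> (\<lambda>z. (1 + (cmod z)\<^sup>2) ^ 4)"
begin

text \<open>The factor 9 is that of the bound |d|^4 <= 9 Q^2 W^4 in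
  \<open>one_variable_step\<close>.\<close>

definition \<kappa> :: real where "\<kappa> = 9 * (\<integral>z. (1 + (cmod z)\<^sup>2) ^ 4 \<partial>\<nu>)"

lemma kappa_ge: "\<kappa> \<ge> 9"
proof -
  have "(\<integral>z. 1 \<partial>\<nu>) \<le> (\<integral>z. (1 + (cmod z)\<^sup>2) ^ 4 \<partial>\<nu>)"
    by (intro integral_mono law_moment) auto
  then show ?thesis by (simp add: \<kappa>_def prob_space)
qed

text \<open>One entry z is integrated out, the others being frozen in S, a, b, e. The increment
  combines z, its conjugate and |z|^2 - 1, all of mean zero, so the linear term of
  \<open>norm_add_pow4_le\<close> disappears. Separate coefficients for z and its conjugate serve
  real and complex laws alike.\<close>

lemma one_variable_step:
  fixes S a b e :: complex
  defines "Q \<equiv> (cmod a)\<^sup>2 + (cmod b)\<^sup>2 + (cmod e)\<^sup>2"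
  shows "(\<integral>\<^sup>+z. ennreal (cmod (S + (cnj z * a + b * z + e * complex_of_real ((cmod z)\<^sup>2 - 1))) ^ 4) \<partial>\<nu>)
     \<le> ennreal (cmod S ^ 4 + 8 * \<kappa> * ((cmod S)\<^sup>2 * Q + Q\<^sup>2))"
proof -
  define d where "d = (\<lambda>z. cnj z * a + b * z + e * complex_of_real ((cmod z)\<^sup>2 - 1))"
  define W where "W = (\<lambda>z. 1 + (cmod z)\<^sup>2)"
  have Q0: "Q \<ge> 0" by (simp add: Q_def)
  have [measurable]: "cnj \<in> borel_measurable borel"
    by (intro borel_measurable_continuous_onI continuous_intros)
  have [measurable]: "d \<in> borel_measurable borel" unfolding d_def by measurable
  have [measurable]: "W \<in> borel_measurable borel" unfolding W_def by measurable
  have W1: "W z \<ge> 1" for z by (simp add: W_def)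
  have d2: "(cmod (d z))\<^sup>2 \<le> 3 * Q * (W z)\<^sup>2" for z
  proof -
    have c1: "cmod (d z) \<le> cmod a * cmod z + cmod b * cmod z + cmod e * \<bar>(cmod z)\<^sup>2 - 1\<bar>"
      unfolding d_def by (rule order_trans[OF norm_triangle_ineq] add_mono order_trans[OF norm_triangle_ineq])+
        (auto simp: norm_mult simp del: of_real_diff of_real_power)
    have zW: "cmod z \<le> W z"
    proof -
      have "0 \<le> (cmod z - 1)\<^sup>2" by simp
      then have "2 * cmod z \<le> W z" by (simp add: W_def power2_eq_square algebra_simps)
      then show ?thesis using norm_ge_zero[of z] by linarith
    qed
    have "\<bar>(cmod z)\<^sup>2 - 1\<bar> \<le> W z" unfolding W_def abs_le_iff using zero_le_power2[of "cmod z"] by linarith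
    then have "cmod (d z) \<le> cmod a * W z + cmod b * W z + cmod e * W z"
      using zW by (intro order_trans[OF c1] add_mono mult_left_mono) auto
    then have "(cmod (d z))\<^sup>2 \<le> (cmod a * W z + cmod b * W z + cmod e * W z)\<^sup>2"
      by (intro power_mono) auto
    also have "\<dots> \<le> 3 * ((cmod a * W z)\<^sup>2 + (cmod b * W z)\<^sup>2 + (cmod e * W z)\<^sup>2)"
      by (rule sum3_square_le)
    also have "\<dots> = 3 * Q * (W z)\<^sup>2" by (simp add: Q_def power_mult_distrib algebra_simps)
    finally show ?thesis .
  qed
  have d4: "cmod (d z) ^ 4 \<le> 9 * Q\<^sup>2 * W z ^ 4" for z
  proof -
    have "((cmod (d z))\<^sup>2)\<^sup>2 \<le> (3 * Q * (W z)\<^sup>2)\<^sup>2" using d2 by (intro power_mono) auto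
    then show ?thesis by (simp add: power_mult_distrib flip: power_mult)
  qed
  have W24: "(W z)\<^sup>2 \<le> W z ^ 4" for z using W1 by (intro power_increasing) auto
  have iW: "integrable \<nu> (\<lambda>z. W z ^ 4)" using law_moment by (simp add: W_def)
  have icnj: "integrable \<nu> cnj" "(\<integral>z. cnj z \<partial>\<nu>) = 0"
    using law_mean by (auto simp: integral_cnj[symmetric])
  have icm: "integrable \<nu> (\<lambda>z. complex_of_real ((cmod z)\<^sup>2 - 1))"
    "(\<integral>z. complex_of_real ((cmod z)\<^sup>2 - 1) \<partial>\<nu>) = 0"
  proof -
    have i: "integrable \<nu> (\<lambda>z. (cmod z)\<^sup>2 - 1)" using law_var by simp
    then show "integrable \<nu> (\<lambda>z. complex_of_real ((cmod z)\<^sup>2 - 1))" by (rule integrable_of_real)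
    have "(\<integral>z. (cmod z)\<^sup>2 - 1 \<partial>\<nu>) = 0" using law_var by (simp add: prob_space)
    then show "(\<integral>z. complex_of_real ((cmod z)\<^sup>2 - 1) \<partial>\<nu>) = 0"
      by (simp only: integral_complex_of_real) simp
  qed
  have id: "integrable \<nu> d" unfolding d_def using icnj icm law_mean
    by (intro Bochner_Integration.integrable_add) auto
  have dint: "(\<integral>z. d z \<partial>\<nu>) = 0"
    unfolding d_def using icnj icm law_mean
    by (subst Bochner_Integration.integral_add | simp del: of_real_diff of_real_power)+
  \<comment> \<open>A pointwise majorant with an explicit integral; the term with
    \<open>Re (cnj S * d z)\<close> may be negative, but its integral vanishes.\<close>
  define g where "g = (\<lambda>z. cmod S ^ 4 + 4 * (cmod S)\<^sup>2 * Re (cnj S * d z) + (24 * (cmod S)\<^sup>2 * Q + 27 * Q\<^sup>2) * W z ^ 4)"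
  have ig: "integrable \<nu> g"
    unfolding g_def using id iW
    by (intro Bochner_Integration.integrable_add integrable_mult_right integrable_Re) auto
  have le: "cmod (S + d z) ^ 4 \<le> g z" for z
  proof -
    have "(cmod (d z))\<^sup>2 \<le> 3 * Q * W z ^ 4"
      using d2[of z] W24[of z] Q0 by (meson mult_left_mono order_trans mult_nonneg_nonneg zero_le_numeral)
    then have "8 * (cmod S)\<^sup>2 * (cmod (d z))\<^sup>2 \<le> 8 * (cmod S)\<^sup>2 * (3 * Q * W z ^ 4)"
      by (intro mult_left_mono) auto
    then show ?thesis using norm_add_pow4_le[of S "d z"] d4[of z] by (simp add: g_def algebra_simps)
  qed
  have "(\<integral>\<^sup>+z. ennreal (cmod (S + d z) ^ 4) \<partial>\<nu>) \<le> (\<integral>\<^sup>+z. ennreal (g z) \<partial>\<nu>)"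
    using le by (intro nn_integral_mono ennreal_leI)
  also have "\<dots> = ennreal (\<integral>z. g z \<partial>\<nu>)"
    by (intro nn_integral_eq_integral ig AE_I2 order_trans[OF _ le]) auto
  also have "(\<integral>z. g z \<partial>\<nu>) = cmod S ^ 4 + (24 * (cmod S)\<^sup>2 * Q + 27 * Q\<^sup>2) * (\<kappa> / 9)"
  proof -
    have "(\<integral>z. Re (cnj S * d z) \<partial>\<nu>) = Re (\<integral>z. cnj S * d z \<partial>\<nu>)" using id by (intro integral_Re) auto
    also have "\<dots> = 0" using id dint by simp
    finally show ?thesis
      unfolding g_def using id iW
      by (subst Bochner_Integration.integral_add | simp add: prob_space W_def \<kappa>_def)+
  qed
  also have "\<dots> \<le> cmod S ^ 4 + 8 * \<kappa> * ((cmod S)\<^sup>2 * Q + Q\<^sup>2)"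
  proof -
    have "0 \<le> (cmod S)\<^sup>2 * Q * \<kappa>" "0 \<le> Q\<^sup>2 * \<kappa>" using Q0 kappa_ge by auto
    then show ?thesis by (simp add: algebra_simps)
  qed
  finally show ?thesis by (auto simp: d_def intro: ennreal_leI)
qed

sublocale product_sigma_finite "\<lambda>_. \<nu>" by standard

text \<open>Entries are added one at a time by \<open>one_variable_step\<close>, with only the
  coefficient of z nonzero; 16 \<kappa>^2 is the constant of \<open>fourth_moment_increment\<close>
  for c = 1.\<close>

lemma linear_form_fourth_moment:
  assumes "finite I"
  shows "(\<integral>\<^sup>+y. ennreal (cmod (\<Sum>j\<in>I. c j * y j) ^ 4) \<partial>PiM I (\<lambda>_. \<nu>)) \<le> ennreal (16 * \<kappa>\<^sup>2 * (\<Sum>j\<in>I. (cmod (c j))\<^sup>2)\<^sup>2)"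
  using assms
proof (induction I rule: finite_induct)
  case (insert k I)
  have [measurable]: "k \<in> insert k I" by simp
  have fin: "finite I" by fact
  have "(\<integral>\<^sup>+y. ennreal (cmod (\<Sum>j\<in>insert k I. c j * y j) ^ 4) \<partial>PiM (insert k I) (\<lambda>_. \<nu>))
    = (\<integral>\<^sup>+y. \<integral>\<^sup>+z. ennreal (cmod (\<Sum>j\<in>insert k I. c j * (y(k := z)) j) ^ 4) \<partial>\<nu> \<partial>PiM I (\<lambda>_. \<nu>))"
    using insert.hyps by (intro product_nn_integral_insert) (auto intro!: measurable_compose[OF measurable_component_singleton])
  also have "\<dots> = (\<integral>\<^sup>+y. \<integral>\<^sup>+z. ennreal (cmod ((\<Sum>j\<in>I. c j * y j) + (cnj z * 0 + c k * z + 0 * complex_of_real ((cmod z)\<^sup>2 - 1))) ^ 4) \<partial>\<nu> \<partial>PiM I (\<lambda>_. \<nu>))"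
  proof (intro nn_integral_cong)
    fix y z
    have "(\<Sum>j\<in>I. c j * (y(k := z)) j) = (\<Sum>j\<in>I. c j * y j)"
      using insert.hyps by (intro sum.cong) auto
    then show "ennreal (cmod (\<Sum>j\<in>insert k I. c j * (y(k := z)) j) ^ 4) = ennreal (cmod ((\<Sum>j\<in>I. c j * y j) + (cnj z * 0 + c k * z + 0 * complex_of_real ((cmod z)\<^sup>2 - 1))) ^ 4)"
      using insert.hyps by (simp add: add.commute)
  qed
  also have "\<dots> \<le> (\<integral>\<^sup>+y. ennreal (cmod (\<Sum>j\<in>I. c j * y j) ^ 4 + 8 * \<kappa> * ((cmod (\<Sum>j\<in>I. c j * y j))\<^sup>2 * (cmod (c k))\<^sup>2 + ((cmod (c k))\<^sup>2)\<^sup>2)) \<partial>PiM I (\<lambda>_. \<nu>))"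
    by (intro nn_integral_mono order_trans[OF one_variable_step]) auto
  also have "\<dots> \<le> ennreal (16 * \<kappa>\<^sup>2 * 1 * ((\<Sum>j\<in>I. (cmod (c j))\<^sup>2) + (cmod (c k))\<^sup>2)\<^sup>2)"
  proof (rule fourth_moment_increment[where c = 1])
    interpret P: prob_space "PiM I (\<lambda>_. \<nu>)" by (intro prob_space_PiM prob_space_axioms)
    show "(\<integral>\<^sup>+x. ennreal (((cmod (c k))\<^sup>2)\<^sup>2) \<partial>PiM I (\<lambda>_. \<nu>)) \<le> ennreal (1 * ((cmod (c k))\<^sup>2)\<^sup>2)"
      by (simp add: P.emeasure_space_1)
  qed (use insert.IH kappa_ge in \<open>auto intro!: sum_nonneg\<close>)
  finally show ?case using insert.hyps by (simp add: add.commute)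
qed simp

text \<open>For independent entries of mean zero and variance one, the subtracted diagonal sum is
  the expectation of the quadratic form.\<close>

definition centered_form :: "'i set \<Rightarrow> ('i \<Rightarrow> 'i \<Rightarrow> complex) \<Rightarrow> ('i \<Rightarrow> complex) \<Rightarrow> complex" where
  "centered_form I D y = (\<Sum>i\<in>I. \<Sum>j\<in>I. D i j * cnj (y i) * y j) - (\<Sum>i\<in>I. D i i)"

lemma measurable_cnj[measurable]: "cnj \<in> borel_measurable borel"
  by (intro borel_measurable_continuous_onI continuous_intros)

lemma measurable_component_law:
  "i \<in> I \<Longrightarrow> (\<lambda>y. y i) \<in> borel_measurable (PiM I (\<lambda>_. \<nu>))"
  using measurable_component_singleton[of i I "\<lambda>_. \<nu>"] by (simp add: measurable_cong_sets[OF refl sets_law])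

lemma centered_form_measurable:
  "centered_form I D \<in> borel_measurable (PiM I (\<lambda>_. \<nu>))"
  unfolding centered_form_def
  by (intro borel_measurable_diff borel_measurable_sum borel_measurable_times borel_measurable_const
      measurable_compose[OF measurable_component_law measurable_cnj] measurable_component_law) auto

lemma centered_form_insert:
  assumes "finite I" "k \<notin> I"
  shows "centered_form (insert k I) D (y(k := z)) = centered_form I D y +
     (cnj z * (\<Sum>j\<in>I. D k j * y j) + (\<Sum>i\<in>I. D i k * cnj (y i)) * z + D k k * complex_of_real ((cmod z)\<^sup>2 - 1))"
proof -
  define y' where "y' = y(k := z)"
  have y': "y' k = z" "\<And>i. i \<in> I \<Longrightarrow> y' i = y i" using assms by (auto simp: y'_def)
  have "(\<Sum>i\<in>I. \<Sum>j\<in>insert k I. D i j * cnj (y' i) * y' j)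
     = (\<Sum>i\<in>I. D i k * cnj (y i) * z + (\<Sum>j\<in>I. D i j * cnj (y i) * y j))"
    using assms by (intro sum.cong refl) (simp add: y')
  then have 1: "(\<Sum>i\<in>I. \<Sum>j\<in>insert k I. D i j * cnj (y' i) * y' j)
     = (\<Sum>i\<in>I. D i k * cnj (y i)) * z + (\<Sum>i\<in>I. \<Sum>j\<in>I. D i j * cnj (y i) * y j)"
    by (simp add: sum.distrib sum_distrib_right)
  have "(\<Sum>j\<in>I. D k j * cnj z * y' j) = cnj z * (\<Sum>j\<in>I. D k j * y j)"
    by (simp add: sum_distrib_left y' mult_ac)
  then have 2: "(\<Sum>j\<in>insert k I. D k j * cnj (y' k) * y' j) = D k k * (cnj z * z) + cnj z * (\<Sum>j\<in>I. D k j * y j)"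
    using assms by (simp add: y' mult_ac)
  have 3: "complex_of_real ((cmod z)\<^sup>2 - 1) = cnj z * z - 1"
    by (simp add: complex_norm_square mult.commute del: of_real_power)
  show ?thesis
    unfolding centered_form_def y'_def[symmetric] 3 using assms 1 2 by (simp add: algebra_simps)
qed

text \<open>A new entry k brings in two linear forms a, b in the old entries, whose fourth moments
  are known, and the diagonal coefficient e. The sum of squared coefficients grows by exactly A + B
  + |e|^2, so \<open>fourth_moment_increment\<close> closes the induction. The constant is 768 = 16
  * 48, where 48 = 3 * 16 stems from the three summands of Q.\<close>

theorem centered_form_fourth_moment:
  assumes "finite I"
  shows "(\<integral>\<^sup>+y. ennreal (cmod (centered_form I D y) ^ 4) \<partial>PiM I (\<lambda>_. \<nu>))
     \<le> ennreal (768 * \<kappa> ^ 4 * (\<Sum>i\<in>I. \<Sum>j\<in>I. (cmod (D i j))\<^sup>2)\<^sup>2)"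
  using assms
proof (induction I rule: finite_induct)
  case empty then show ?case by (simp add: centered_form_def)
next
  case (insert k I)
  have fin: "finite I" by fact
  note [measurable] = centered_form_measurable
  define a where "a = (\<lambda>y. \<Sum>j\<in>I. D k j * y j)"
  define b where "b = (\<lambda>y. \<Sum>i\<in>I. D i k * cnj (y i))"
  define e where "e = D k k"
  define A where "A = (\<Sum>j\<in>I. (cmod (D k j))\<^sup>2)"
  define B where "B = (\<Sum>i\<in>I. (cmod (D i k))\<^sup>2)"
  have AB: "A \<ge> 0" "B \<ge> 0" by (auto simp: A_def B_def intro: sum_nonneg)
  define Q where "Q = (\<lambda>y. (cmod (a y))\<^sup>2 + (cmod (b y))\<^sup>2 + (cmod e)\<^sup>2)"
  have am[measurable]: "a \<in> borel_measurable (PiM I (\<lambda>_. \<nu>))" unfolding a_def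
    by (intro borel_measurable_sum borel_measurable_times borel_measurable_const measurable_component_law)
  have bm[measurable]: "b \<in> borel_measurable (PiM I (\<lambda>_. \<nu>))" unfolding b_def
    by (intro borel_measurable_sum borel_measurable_times borel_measurable_const
         measurable_compose[OF measurable_component_law measurable_cnj])
  interpret P: prob_space "PiM I (\<lambda>_. \<nu>)" by (intro prob_space_PiM prob_space_axioms)
  have a4: "(\<integral>\<^sup>+y. ennreal (cmod (a y) ^ 4) \<partial>PiM I (\<lambda>_. \<nu>)) \<le> ennreal (16 * \<kappa>\<^sup>2 * A\<^sup>2)"
    unfolding a_def A_def by (rule linear_form_fourth_moment[OF fin])
  \<comment> \<open>b is antilinear in the entries; conjugation makes it a linear form of the same
    modulus.\<close>
  have "cmod (b y) = cmod (\<Sum>i\<in>I. cnj (D i k) * y i)" for y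
    unfolding b_def by (subst complex_mod_cnj[symmetric]) simp
  then have b4: "(\<integral>\<^sup>+y. ennreal (cmod (b y) ^ 4) \<partial>PiM I (\<lambda>_. \<nu>)) \<le> ennreal (16 * \<kappa>\<^sup>2 * B\<^sup>2)"
    using linear_form_fourth_moment[OF fin, of "\<lambda>i. cnj (D i k)"] by (simp add: B_def)
  \<comment> \<open>Puts the deterministic term |e|^4 under the same constant as the two random
    ones.\<close>
  have k1: "1 \<le> 16 * \<kappa>\<^sup>2" using kappa_ge power_mono[of 9 \<kappa> 2] by simp
  have Q2: "(\<integral>\<^sup>+y. ennreal ((Q y)\<^sup>2) \<partial>PiM I (\<lambda>_. \<nu>)) \<le> ennreal (48 * \<kappa>\<^sup>2 * (A + B + (cmod e)\<^sup>2)\<^sup>2)"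
  proof -
    have "(Q y)\<^sup>2 \<le> 3 * (cmod (a y) ^ 4 + cmod (b y) ^ 4 + cmod e ^ 4)" for y
      using sum3_square_le[of "(cmod (a y))\<^sup>2" "(cmod (b y))\<^sup>2" "(cmod e)\<^sup>2"]
      by (simp add: Q_def flip: power_mult)
    then have "(\<integral>\<^sup>+y. ennreal ((Q y)\<^sup>2) \<partial>PiM I (\<lambda>_. \<nu>))
      \<le> (\<integral>\<^sup>+y. ennreal (3 * (cmod (a y) ^ 4 + cmod (b y) ^ 4 + cmod e ^ 4)) \<partial>PiM I (\<lambda>_. \<nu>))"
      by (intro nn_integral_mono ennreal_leI)
    also have "\<dots> = (\<integral>\<^sup>+y. ennreal 3 * (ennreal (cmod (a y) ^ 4) + ennreal (cmod (b y) ^ 4) + ennreal (cmod e ^ 4)) \<partial>PiM I (\<lambda>_. \<nu>))"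
      by (intro nn_integral_cong) (simp add: ennreal_mult)
    also have "\<dots> = ennreal 3 * ((\<integral>\<^sup>+y. ennreal (cmod (a y) ^ 4) \<partial>PiM I (\<lambda>_. \<nu>)) + (\<integral>\<^sup>+y. ennreal (cmod (b y) ^ 4) \<partial>PiM I (\<lambda>_. \<nu>)) + ennreal (cmod e ^ 4))"
      by (simp add: nn_integral_cmult nn_integral_add P.emeasure_space_1)
    also have "\<dots> \<le> ennreal 3 * (ennreal (16 * \<kappa>\<^sup>2 * A\<^sup>2) + ennreal (16 * \<kappa>\<^sup>2 * B\<^sup>2) + ennreal (cmod e ^ 4))"
      by (intro mult_left_mono add_mono a4 b4) auto
    also have "\<dots> = ennreal (3 * (16 * \<kappa>\<^sup>2 * A\<^sup>2 + 16 * \<kappa>\<^sup>2 * B\<^sup>2 + cmod e ^ 4))"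
      by (simp add: ennreal_plus[symmetric] ennreal_mult[symmetric] del: ennreal_plus ennreal_numeral)
    also have "\<dots> \<le> ennreal (48 * \<kappa>\<^sup>2 * (A + B + (cmod e)\<^sup>2)\<^sup>2)"
    proof (rule ennreal_leI)
      have "1 * cmod e ^ 4 \<le> 16 * \<kappa>\<^sup>2 * cmod e ^ 4" by (intro mult_right_mono k1) auto
      then have "3 * (16 * \<kappa>\<^sup>2 * A\<^sup>2 + 16 * \<kappa>\<^sup>2 * B\<^sup>2 + cmod e ^ 4) \<le> 48 * \<kappa>\<^sup>2 * (A\<^sup>2 + B\<^sup>2 + cmod e ^ 4)"
        by (simp add: algebra_simps)
      also have "\<dots> \<le> 48 * \<kappa>\<^sup>2 * (A + B + (cmod e)\<^sup>2)\<^sup>2"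
      proof (intro mult_left_mono)
        have "0 \<le> A * B + A * (cmod e)\<^sup>2 + B * (cmod e)\<^sup>2" using AB by simp
        then show "A\<^sup>2 + B\<^sup>2 + cmod e ^ 4 \<le> (A + B + (cmod e)\<^sup>2)\<^sup>2"
          by (simp add: power2_eq_square power4_eq_xxxx algebra_simps)
      qed simp
      finally show "3 * (16 * \<kappa>\<^sup>2 * A\<^sup>2 + 16 * \<kappa>\<^sup>2 * B\<^sup>2 + cmod e ^ 4) \<le> 48 * \<kappa>\<^sup>2 * (A + B + (cmod e)\<^sup>2)\<^sup>2" .
    qed
    finally show ?thesis .
  qed
  have "(\<integral>\<^sup>+y. ennreal (cmod (centered_form (insert k I) D y) ^ 4) \<partial>PiM (insert k I) (\<lambda>_. \<nu>))
    = (\<integral>\<^sup>+y. \<integral>\<^sup>+z. ennreal (cmod (centered_form (insert k I) D (y(k := z))) ^ 4) \<partial>\<nu> \<partial>PiM I (\<lambda>_. \<nu>))"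
    using insert.hyps by (intro product_nn_integral_insert) measurable
  also have "\<dots> = (\<integral>\<^sup>+y. \<integral>\<^sup>+z. ennreal (cmod (centered_form I D y + (cnj z * a y + b y * z + e * complex_of_real ((cmod z)\<^sup>2 - 1))) ^ 4) \<partial>\<nu> \<partial>PiM I (\<lambda>_. \<nu>))"
    unfolding a_def b_def e_def
    by (intro nn_integral_cong) (subst centered_form_insert[OF insert.hyps], rule refl)
  also have "\<dots> \<le> (\<integral>\<^sup>+y. ennreal (cmod (centered_form I D y) ^ 4 + 8 * \<kappa> * ((cmod (centered_form I D y))\<^sup>2 * Q y + (Q y)\<^sup>2)) \<partial>PiM I (\<lambda>_. \<nu>))"
    unfolding Q_def by (intro nn_integral_mono one_variable_step)
  also have "\<dots> \<le> ennreal (768 * \<kappa> ^ 4 * ((\<Sum>i\<in>I. \<Sum>j\<in>I. (cmod (D i j))\<^sup>2) + (A + B + (cmod e)\<^sup>2))\<^sup>2)"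
  proof (rule fourth_moment_increment[OF _ _ _ _ _ _ _ _ insert.IH Q2])
    show "Q \<in> borel_measurable (PiM I (\<lambda>_. \<nu>))" unfolding Q_def by measurable
    show "768 * \<kappa> ^ 4 = 16 * \<kappa>\<^sup>2 * (48 * \<kappa>\<^sup>2)" by (simp add: power2_eq_square power4_eq_xxxx)
  qed (use kappa_ge AB in \<open>auto intro!: sum_nonneg simp: Q_def\<close>)
  also have "(\<Sum>i\<in>I. \<Sum>j\<in>I. (cmod (D i j))\<^sup>2) + (A + B + (cmod e)\<^sup>2) = (\<Sum>i\<in>insert k I. \<Sum>j\<in>insert k I. (cmod (D i j))\<^sup>2)"
    using insert.hyps by (simp add: A_def B_def e_def sum.distrib)
  finally show ?case .
qed

end

section \<open>Almost sure convergence of centered forms\<close>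

definition frob_on :: "'i set \<Rightarrow> ('i \<Rightarrow> 'i \<Rightarrow> complex) \<Rightarrow> real" where
  "frob_on I D = (\<Sum>i\<in>I. \<Sum>j\<in>I. (cmod (D i j))\<^sup>2)"

context standard_law
begin

text \<open>The joint law is a product, so the coefficients, which depend on \<open>Z\<close>, can
  be frozen while \<open>Y\<close> is integrated; Markov's inequality for the fourth power follows.
  The size of the coefficients is part of the event, because it is controlled only along typical
  outcomes and not in mean.\<close>

lemma centered_form_tail_bound:
  fixes D :: "'x \<Rightarrow> 'i \<Rightarrow> 'i \<Rightarrow> complex"
  assumes fin: "finite I" and D[measurable]: "\<And>i j. i \<in> I \<Longrightarrow> j \<in> I \<Longrightarrow> (\<lambda>x. D x i j) \<in> borel_measurable N"
    and M: "prob_space M" and Y[measurable]: "Y \<in> measurable M (PiM I (\<lambda>_. \<nu>))" and Z[measurable]: "Z \<in> measurable M N"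
    and joint: "distr M (PiM I (\<lambda>_. \<nu>) \<Otimes>\<^sub>M N) (\<lambda>\<omega>. (Y \<omega>, Z \<omega>)) = PiM I (\<lambda>_. \<nu>) \<Otimes>\<^sub>M distr M N Z"
    and b: "b \<ge> 0" and e: "e > 0"
  shows "{\<omega>\<in>space M. frob_on I (D (Z \<omega>)) \<le> b \<and> e \<le> cmod (centered_form I (D (Z \<omega>)) (Y \<omega>))} \<in> sets M"
    "emeasure M {\<omega>\<in>space M. frob_on I (D (Z \<omega>)) \<le> b \<and> e \<le> cmod (centered_form I (D (Z \<omega>)) (Y \<omega>))}
       \<le> ennreal (768 * \<kappa> ^ 4 * b\<^sup>2 / e ^ 4)"
proof -
  interpret M: prob_space M by fact
  interpret Q: prob_space "distr M N Z" by (rule M.prob_space_distr) (rule Z)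
  interpret P: prob_space "PiM I (\<lambda>_. \<nu>)" by (intro prob_space_PiM prob_space_axioms)
  interpret PQ: pair_sigma_finite "PiM I (\<lambda>_. \<nu>)" "distr M N Z" ..
  let ?P = "PiM I (\<lambda>_. \<nu>)"
  define F where "F = (\<lambda>p :: ('i \<Rightarrow> complex) \<times> 'x. centered_form I (D (snd p)) (fst p))"
  define H where "H = (\<lambda>x. frob_on I (D x))"
  have Hm[measurable]: "H \<in> borel_measurable N" unfolding H_def frob_on_def
    by (intro borel_measurable_sum borel_measurable_power measurable_compose[OF D borel_measurable_norm])
  have comp: "(\<lambda>p :: ('i \<Rightarrow> complex) \<times> 'x. fst p i) \<in> borel_measurable (?P \<Otimes>\<^sub>M N)" if "i \<in> I" for i
    by (rule measurable_compose[OF measurable_fst measurable_component_law[OF that]])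
  have Dc: "(\<lambda>p :: ('i \<Rightarrow> complex) \<times> 'x. D (snd p) i j) \<in> borel_measurable (?P \<Otimes>\<^sub>M N)" if "i \<in> I" "j \<in> I" for i j
    by (rule measurable_compose[OF measurable_snd D[OF that]])
  have Fm[measurable]: "F \<in> borel_measurable (?P \<Otimes>\<^sub>M N)"
    unfolding F_def centered_form_def
    by (intro borel_measurable_diff borel_measurable_sum borel_measurable_times Dc
        measurable_compose[OF comp measurable_cnj] comp)
  \<comment> \<open>The cutoff on \<open>H\<close> bounds the inner integral by a constant, whatever
    the law of \<open>Z\<close>.\<close>
  define h where "h = (\<lambda>p. ennreal (if H (snd p) \<le> b then cmod (F p) ^ 4 else 0))"
  have hm[measurable]: "h \<in> borel_measurable (?P \<Otimes>\<^sub>M N)" unfolding h_def by measurable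
  have hm'[measurable]: "h \<in> borel_measurable (?P \<Otimes>\<^sub>M distr M N Z)"
    using hm by (subst measurable_cong_sets[OF sets_pair_measure_cong[OF refl sets_distr] refl])
  have YZ[measurable]: "(\<lambda>\<omega>. (Y \<omega>, Z \<omega>)) \<in> measurable M (?P \<Otimes>\<^sub>M N)" by measurable
  have "(\<integral>\<^sup>+\<omega>. h (Y \<omega>, Z \<omega>) \<partial>M) = (\<integral>\<^sup>+p. h p \<partial>distr M (?P \<Otimes>\<^sub>M N) (\<lambda>\<omega>. (Y \<omega>, Z \<omega>)))"
    by (rule nn_integral_distr[symmetric]) measurable
  also have "\<dots> = (\<integral>\<^sup>+p. h p \<partial>(?P \<Otimes>\<^sub>M distr M N Z))" unfolding joint ..
  also have "\<dots> = (\<integral>\<^sup>+x. (\<integral>\<^sup>+y. h (y, x) \<partial>?P) \<partial>distr M N Z)"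
    by (rule PQ.nn_integral_snd[symmetric]) (rule hm')
  also have "\<dots> \<le> (\<integral>\<^sup>+x. ennreal (768 * \<kappa> ^ 4 * b\<^sup>2) \<partial>distr M N Z)"
  proof (rule nn_integral_mono)
    fix x
    show "(\<integral>\<^sup>+y. h (y, x) \<partial>?P) \<le> ennreal (768 * \<kappa> ^ 4 * b\<^sup>2)"
    proof (cases "H x \<le> b")
      case True
      have H0: "0 \<le> H x" by (auto simp: H_def frob_on_def intro!: sum_nonneg)
      have "(\<integral>\<^sup>+y. h (y, x) \<partial>?P) = (\<integral>\<^sup>+y. ennreal (cmod (centered_form I (D x) y) ^ 4) \<partial>?P)"
        using True by (simp add: h_def F_def)
      also have "\<dots> \<le> ennreal (768 * \<kappa> ^ 4 * (H x)\<^sup>2)"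
        unfolding H_def frob_on_def by (rule centered_form_fourth_moment[OF fin])
      also have "\<dots> \<le> ennreal (768 * \<kappa> ^ 4 * b\<^sup>2)"
        using True H0 by (intro ennreal_leI mult_left_mono power_mono) auto
      finally show ?thesis .
    qed (simp add: h_def)
  qed
  also have "\<dots> = ennreal (768 * \<kappa> ^ 4 * b\<^sup>2)" using Q.emeasure_space_1 by (simp add: space_distr)
  finally have int: "(\<integral>\<^sup>+\<omega>. h (Y \<omega>, Z \<omega>) \<partial>M) \<le> ennreal (768 * \<kappa> ^ 4 * b\<^sup>2)" .
  define A where "A = {\<omega>\<in>space M. frob_on I (D (Z \<omega>)) \<le> b \<and> e \<le> cmod (centered_form I (D (Z \<omega>)) (Y \<omega>))}"
  have A: "A = {\<omega>\<in>space M. H (Z \<omega>) \<le> b \<and> e \<le> cmod (F (Y \<omega>, Z \<omega>))}" by (simp add: A_def H_def F_def)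
  have "A \<in> sets M" unfolding A by measurable
  then show "{\<omega>\<in>space M. frob_on I (D (Z \<omega>)) \<le> b \<and> e \<le> cmod (centered_form I (D (Z \<omega>)) (Y \<omega>))} \<in> sets M"
    by (simp add: A_def)
  have "emeasure M A \<le> emeasure M {\<omega>\<in>space M. 1 \<le> ennreal (1 / e ^ 4) * h (Y \<omega>, Z \<omega>)}"
  proof (rule emeasure_mono)
    show "A \<subseteq> {\<omega>\<in>space M. 1 \<le> ennreal (1 / e ^ 4) * h (Y \<omega>, Z \<omega>)}"
    proof
      fix \<omega> assume w: "\<omega> \<in> A"
      then have "e ^ 4 \<le> cmod (F (Y \<omega>, Z \<omega>)) ^ 4" using e unfolding A by (intro power_mono) auto
      then have "1 \<le> 1 / e ^ 4 * cmod (F (Y \<omega>, Z \<omega>)) ^ 4" using e by (simp add: field_simps)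
      moreover have "ennreal (1 / e ^ 4) * h (Y \<omega>, Z \<omega>) = ennreal (1 / e ^ 4 * cmod (F (Y \<omega>, Z \<omega>)) ^ 4)"
        using w e by (simp add: h_def A ennreal_mult[symmetric] del: times_divide_eq_left)
      ultimately show "\<omega> \<in> {\<omega>\<in>space M. 1 \<le> ennreal (1 / e ^ 4) * h (Y \<omega>, Z \<omega>)}"
        using w by (simp add: A ennreal_ge_1)
    qed
  qed measurable
  also have "\<dots> \<le> ennreal (1 / e ^ 4) * (\<integral>\<^sup>+\<omega>. h (Y \<omega>, Z \<omega>) * indicator (space M) \<omega> \<partial>M)"
    by (rule nn_integral_Markov_inequality) measurable
  also have "(\<integral>\<^sup>+\<omega>. h (Y \<omega>, Z \<omega>) * indicator (space M) \<omega> \<partial>M) = (\<integral>\<^sup>+\<omega>. h (Y \<omega>, Z \<omega>) \<partial>M)"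
    by (intro nn_integral_cong) (auto simp: indicator_def)
  also have "ennreal (1 / e ^ 4) * \<dots> \<le> ennreal (1 / e ^ 4) * ennreal (768 * \<kappa> ^ 4 * b\<^sup>2)"
    by (intro mult_left_mono int) auto
  also have "\<dots> = ennreal (768 * \<kappa> ^ 4 * b\<^sup>2 / e ^ 4)" using e by (simp add: ennreal_mult[symmetric])
  finally show "emeasure M {\<omega>\<in>space M. frob_on I (D (Z \<omega>)) \<le> b \<and> e \<le> cmod (centered_form I (D (Z \<omega>)) (Y \<omega>))}
       \<le> ennreal (768 * \<kappa> ^ 4 * b\<^sup>2 / e ^ 4)" by (simp add: A_def)
qed

text \<open>With b = B n and e proportional to n the tail bound is of order n^2 / n^4, which is
  summable, so Borel-Cantelli applies. The bound B may depend on the outcome, hence all natural B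
  are treated on one event of full measure.\<close>

lemma centered_form_AE:
  fixes D :: "nat \<Rightarrow> 'x \<Rightarrow> 'i \<Rightarrow> 'i \<Rightarrow> complex"
  assumes fin: "\<And>n. finite (I n)"
    and D: "\<And>n i j. i \<in> I n \<Longrightarrow> j \<in> I n \<Longrightarrow> (\<lambda>x. D n x i j) \<in> borel_measurable (N n)"
    and M: "prob_space M" and Y: "\<And>n. Y n \<in> measurable M (PiM (I n) (\<lambda>_. \<nu>))" and Z: "\<And>n. Z n \<in> measurable M (N n)"
    and joint: "\<And>n. n \<ge> 1 \<Longrightarrow> distr M (PiM (I n) (\<lambda>_. \<nu>) \<Otimes>\<^sub>M N n) (\<lambda>\<omega>. (Y n \<omega>, Z n \<omega>)) = PiM (I n) (\<lambda>_. \<nu>) \<Otimes>\<^sub>M distr M (N n) (Z n)"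
  shows "AE \<omega> in M. \<forall>B::nat. (\<forall>\<^sub>F n in sequentially. frob_on (I n) (D n (Z n \<omega>)) \<le> real B * real n) \<longrightarrow>
     (\<lambda>n. centered_form (I n) (D n (Z n \<omega>)) (Y n \<omega>) / of_nat n) \<longlonglongrightarrow> 0"
proof -
  interpret M: prob_space M by fact
  have "AE \<omega> in M. \<forall>\<^sub>F n in sequentially. frob_on (I n) (D n (Z n \<omega>)) \<le> real B * real n \<longrightarrow>
      cmod (centered_form (I n) (D n (Z n \<omega>)) (Y n \<omega>)) < e * real n" (is "?AE B e") if e: "e > 0" for B :: nat and e :: real
  proof -
    \<comment> \<open>\<open>joint\<close> is available only for n >= 1, and the level e * n must be
      positive; the empty set stands in at n = 0.\<close>
    define A where "A = (\<lambda>n. if n = 0 then {} else {\<omega>\<in>space M. frob_on (I n) (D n (Z n \<omega>)) \<le> real B * real n \<and> e * real n \<le> cmod (centered_form (I n) (D n (Z n \<omega>)) (Y n \<omega>))})"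
    define c where "c = 768 * \<kappa> ^ 4 * (real B)\<^sup>2 / e ^ 4"
    have Am: "A n \<in> sets M" for n
      using centered_form_tail_bound(1)[OF fin[of n] D[of _ n] M Y[of n] Z[of n] joint[of n], where b = "real B * real n" and e = "e * real n"] e by (cases "n = 0") (auto simp: A_def)
    have Ab: "measure M (A n) \<le> c * (1 / real n ^ 2)" for n
    proof (cases "n = 0")
      case False
      then have "emeasure M (A n) \<le> ennreal (768 * \<kappa> ^ 4 * (real B * real n)\<^sup>2 / (e * real n) ^ 4)"
        using centered_form_tail_bound(2)[OF fin[of n] D[of _ n] M Y[of n] Z[of n] joint[of n], where b = "real B * real n" and e = "e * real n"] e by (cases "n = 0") (auto simp: A_def)
      also have "768 * \<kappa> ^ 4 * (real B * real n)\<^sup>2 / (e * real n) ^ 4 = c * (1 / real n ^ 2)"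
        using False e by (simp add: c_def power_mult_distrib divide_simps power2_eq_square power4_eq_xxxx)
      finally show ?thesis unfolding M.emeasure_eq_measure by (subst (asm) ennreal_le_iff) (auto simp: c_def)
    qed (simp add: A_def)
    have "summable (\<lambda>n. c * (1 / real n ^ 2))"
      by (intro summable_mult) (use inverse_power_summable[of 2, where ?'a = real] in \<open>simp add: inverse_eq_divide\<close>)
    then have "summable (\<lambda>n. measure M (A n))"
      by (rule summable_comparison_test[rotated]) (use Ab in auto)
    then have "AE \<omega> in M. \<forall>\<^sub>F n in sequentially. \<omega> \<in> space M - A n"
      by (intro borel_cantelli_AE1 Am) (simp add: M.emeasure_eq_measure)
    then show ?thesis
    proof (eventually_elim)
      case (elim \<omega>)
      then show ?case using eventually_gt_at_top[of 0] by eventually_elim (auto simp: A_def not_le)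
    qed
  qed
  note event = this
  have "AE \<omega> in M. \<forall>B::nat. \<forall>k::nat. \<forall>\<^sub>F n in sequentially. frob_on (I n) (D n (Z n \<omega>)) \<le> real B * real n \<longrightarrow>
      cmod (centered_form (I n) (D n (Z n \<omega>)) (Y n \<omega>)) < (1 / real (Suc k)) * real n"
    unfolding AE_all_countable by (intro allI event) simp
  then show ?thesis
  proof (eventually_elim, intro allI impI)
    fix \<omega> B assume all: "\<forall>B::nat. \<forall>k::nat. \<forall>\<^sub>F n in sequentially. frob_on (I n) (D n (Z n \<omega>)) \<le> real B * real n \<longrightarrow>
      cmod (centered_form (I n) (D n (Z n \<omega>)) (Y n \<omega>)) < (1 / real (Suc k)) * real n"
      and B: "\<forall>\<^sub>F n in sequentially. frob_on (I n) (D n (Z n \<omega>)) \<le> real B * real n"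
    show "(\<lambda>n. centered_form (I n) (D n (Z n \<omega>)) (Y n \<omega>) / of_nat n) \<longlonglongrightarrow> 0"
      unfolding tendsto_iff
    proof (intro allI impI)
      fix e :: real assume "e > 0"
      then obtain k where k: "1 / real (Suc k) < e" using nat_approx_posE by blast
      show "\<forall>\<^sub>F n in sequentially. dist (centered_form (I n) (D n (Z n \<omega>)) (Y n \<omega>) / of_nat n) 0 < e"
        using all[rule_format, of B k] B eventually_gt_at_top[of 0]
      proof eventually_elim
        case (elim n)
        then have "cmod (centered_form (I n) (D n (Z n \<omega>)) (Y n \<omega>)) < e * real n"
          using k by (auto intro: less_trans[OF _ mult_strict_right_mono[OF k]])
        then show ?case using elim(3) by (simp add: norm_divide field_simps)
      qed
    qed
  qed
qed

end

subsection \<open>Complex inner products and adjoints\<close>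

lemma mat_adjoint_dim[simp]: "dim_row (mat_adjoint A) = dim_col A" "dim_col (mat_adjoint A) = dim_row A"
  by (auto simp: mat_adjoint_def)

lemma mat_adjoint_carrier[simp, intro]: "A \<in> carrier_mat n m \<Longrightarrow> mat_adjoint A \<in> carrier_mat m n"
  by (auto intro: carrier_matI)

lemma mat_adjoint_index[simp]:
  fixes A :: "complex mat"
  shows "i < dim_col A \<Longrightarrow> j < dim_row A \<Longrightarrow> mat_adjoint A $$ (i, j) = cnj (A $$ (j, i))"
  by (simp add: mat_adjoint_def mat_of_rows_index)

lemma mat_adjoint_adjoint[simp]: "mat_adjoint (mat_adjoint A) = (A :: complex mat)"
  by (rule eq_matI) auto

lemma mat_adjoint_mult:
  fixes A B :: "complex mat"
  assumes "A \<in> carrier_mat n m" "B \<in> carrier_mat m l"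
  shows "mat_adjoint (A * B) = mat_adjoint B * mat_adjoint A"
proof (rule eq_matI)
  fix i j assume "i < dim_row (mat_adjoint B * mat_adjoint A)" "j < dim_col (mat_adjoint B * mat_adjoint A)"
  then have ij: "i < l" "j < n" using assms by auto
  show "mat_adjoint (A * B) $$ (i, j) = (mat_adjoint B * mat_adjoint A) $$ (i, j)"
    using assms ij by (auto simp: scalar_prod_def intro!: sum.cong)
qed (use assms in auto)

lemma mat_adjoint_add:
  fixes A B :: "complex mat"
  assumes "A \<in> carrier_mat n m" "B \<in> carrier_mat n m"
  shows "mat_adjoint (A + B) = mat_adjoint A + mat_adjoint B"
  by (rule eq_matI) (use assms in auto)

lemma cscalar_prod_mult_mat_vec:
  fixes A :: "complex mat"
  assumes "A \<in> carrier_mat n m" "v \<in> carrier_vec m" "w \<in> carrier_vec n"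
  shows "(A *\<^sub>v v) \<bullet>c w = v \<bullet>c (mat_adjoint A *\<^sub>v w)"
proof -
  have "(A *\<^sub>v v) \<bullet>c w = (\<Sum>i<n. \<Sum>j<m. A $$ (i, j) * v $ j * cnj (w $ i))"
    using assms by (simp add: scalar_prod_def sum_distrib_right atLeast0LessThan)
  also have "\<dots> = (\<Sum>j<m. \<Sum>i<n. A $$ (i, j) * v $ j * cnj (w $ i))" by (rule sum.swap)
  also have "\<dots> = v \<bullet>c (mat_adjoint A *\<^sub>v w)"
    using assms by (auto simp: scalar_prod_def sum_distrib_left atLeast0LessThan intro!: sum.cong)
  finally show ?thesis .
qed

text \<open>The real inner product underlying the Hermitian one: it is symmetric, so squares are
  completed as over the reals.\<close>

definition rip :: "complex Matrix.vec \<Rightarrow> complex Matrix.vec \<Rightarrow> real" where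
  "rip v w = Re (v \<bullet>c w)"

lemma rip_sum: "w \<in> carrier_vec n \<Longrightarrow> rip v w = (\<Sum>i<n. Re (v $ i * cnj (w $ i)))"
  by (simp add: rip_def scalar_prod_def atLeast0LessThan)

lemma rip_comm: "v \<in> carrier_vec n \<Longrightarrow> w \<in> carrier_vec n \<Longrightarrow> rip v w = rip w v"
  by (simp add: rip_sum mult.commute)

lemma rip_add:
  "v \<in> carrier_vec n \<Longrightarrow> v' \<in> carrier_vec n \<Longrightarrow> w \<in> carrier_vec n \<Longrightarrow> rip (v + v') w = rip v w + rip v' w"
  "v \<in> carrier_vec n \<Longrightarrow> v' \<in> carrier_vec n \<Longrightarrow> w \<in> carrier_vec n \<Longrightarrow> rip w (v + v') = rip w v + rip w v'"
  by (auto simp: rip_sum[where n=n] sum.distrib algebra_simps)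

lemma rip_minus:
  "v \<in> carrier_vec n \<Longrightarrow> v' \<in> carrier_vec n \<Longrightarrow> w \<in> carrier_vec n \<Longrightarrow> rip (v - v') w = rip v w - rip v' w"
  "v \<in> carrier_vec n \<Longrightarrow> v' \<in> carrier_vec n \<Longrightarrow> w \<in> carrier_vec n \<Longrightarrow> rip w (v - v') = rip w v - rip w v'"
  by (auto simp: rip_sum[where n=n] sum_subtractf algebra_simps)

lemma rip_smult:
  "v \<in> carrier_vec n \<Longrightarrow> w \<in> carrier_vec n \<Longrightarrow> rip (complex_of_real s \<cdot>\<^sub>v v) w = s * rip v w"
  "v \<in> carrier_vec n \<Longrightarrow> w \<in> carrier_vec n \<Longrightarrow> rip w (complex_of_real s \<cdot>\<^sub>v v) = s * rip w v"
  by (auto simp: rip_sum[where n=n] sum_distrib_left algebra_simps intro!: sum.cong)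

lemma rip_uminus:
  assumes "v \<in> carrier_vec n" "w \<in> carrier_vec n"
  shows "rip (- v) w = - rip v w" "rip w (- v) = - rip w v"
proof -
  have "- v = complex_of_real (- 1) \<cdot>\<^sub>v v" by auto
  then show "rip (- v) w = - rip v w" "rip w (- v) = - rip w v"
    using rip_smult[OF assms, of "- 1"] by auto
qed

lemma rip_adjoint:
  assumes "A \<in> carrier_mat n m" "v \<in> carrier_vec m" "w \<in> carrier_vec n"
  shows "rip (A *\<^sub>v v) w = rip v (mat_adjoint A *\<^sub>v w)"
  using cscalar_prod_mult_mat_vec[OF assms] by (simp add: rip_def)

lemma rip_self: "v \<in> carrier_vec n \<Longrightarrow> rip v v = (\<Sum>i<n. (cmod (v $ i))\<^sup>2)"
  by (simp add: rip_sum complex_mult_cnj cmod_power2)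

lemma rip_self_nonneg[simp]: "rip v v \<ge> 0"
proof -
  have "rip v v = (\<Sum>i<dim_vec v. (cmod (v $ i))\<^sup>2)" by (rule rip_self) (rule carrier_vec_dim_vec)
  then show ?thesis by (simp add: sum_nonneg)
qed

lemma rip_self_eq_0:
  assumes "v \<in> carrier_vec n"
  shows "rip v v = 0 \<longleftrightarrow> v = 0\<^sub>v n"
proof -
  have "rip v v = 0 \<longleftrightarrow> (\<forall>i<n. v $ i = 0)"
    unfolding rip_self[OF assms] by (subst sum_nonneg_eq_0_iff) auto
  also have "\<dots> \<longleftrightarrow> v = 0\<^sub>v n" using assms by (auto intro!: eq_vecI)
  finally show ?thesis .
qed

lemma cscalar_prod_self:
  assumes "v \<in> carrier_vec n"
  shows "v \<bullet>c v = complex_of_real (rip v v)"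
  unfolding rip_self[OF assms] using assms
  by (simp add: scalar_prod_def atLeast0LessThan complex_norm_square[symmetric])

lemma cscalar_prod_smult:
  fixes v w :: "complex Matrix.vec"
  assumes "v \<in> carrier_vec n" "w \<in> carrier_vec n"
  shows "(a \<cdot>\<^sub>v v) \<bullet>c (b \<cdot>\<^sub>v w) = a * cnj b * (v \<bullet>c w)"
  using assms by (simp add: scalar_prod_def sum_distrib_left mult_ac)

text \<open>Stack the rows of both matrices and pad with zero rows to a square matrix. As a + b < m,
  at least one row is zero, so the determinant vanishes and a kernel vector exists. All dimension
  counts below rest on this.\<close>

lemma exists_common_kernel_vec:
  fixes K1 K2 :: "complex mat"
  assumes K: "K1 \<in> carrier_mat a m" "K2 \<in> carrier_mat b m" and ab: "a + b < m"
  shows "\<exists>t\<in>carrier_vec m. t \<noteq> 0\<^sub>v m \<and> K1 *\<^sub>v t = 0\<^sub>v a \<and> K2 *\<^sub>v t = 0\<^sub>v b"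
proof -
  define S where "S = Matrix.mat m m (\<lambda>(i, j). if i < a then K1 $$ (i, j) else if i < a + b then K2 $$ (i - a, j) else 0)"
  have S: "S \<in> carrier_mat m m" by (simp add: S_def)
  have "transpose_mat S *\<^sub>v unit_vec m (m - 1) = 0\<^sub>v m"
    using ab by (intro eq_vecI) (auto simp: S_def)
  then have "det (transpose_mat S) = 0"
    using S ab by (subst det_0_iff_vec_prod_zero[of _ m]) (auto intro!: exI[of _ "unit_vec m (m - 1)"])
  then have "det S = 0" using det_transpose[OF S] by simp
  then obtain t where t: "t \<in> carrier_vec m" "t \<noteq> 0\<^sub>v m" "S *\<^sub>v t = 0\<^sub>v m"
    using det_0_iff_vec_prod_zero[OF S] by blast
  have row: "(\<Sum>j<m. S $$ (i, j) * t $ j) = 0" if "i < m" for i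
  proof -
    have "(S *\<^sub>v t) $ i = 0" using t that by simp
    then show ?thesis using S t(1) that by (simp add: scalar_prod_def atLeast0LessThan)
  qed
  have "K1 *\<^sub>v t = 0\<^sub>v a"
  proof (rule eq_vecI)
    fix i assume "i < dim_vec (0\<^sub>v a :: complex Matrix.vec)"
    then have i: "i < a" by simp
    then show "(K1 *\<^sub>v t) $ i = 0\<^sub>v a $ i"
      using row[of i] K t(1) ab by (simp add: scalar_prod_def S_def atLeast0LessThan)
  qed (use K in auto)
  moreover have "K2 *\<^sub>v t = 0\<^sub>v b"
  proof (rule eq_vecI)
    fix i assume "i < dim_vec (0\<^sub>v b :: complex Matrix.vec)"
    then have i: "i < b" by simp
    then show "(K2 *\<^sub>v t) $ i = 0\<^sub>v b $ i"
      using row[of "a + i"] K t(1) ab by (simp add: scalar_prod_def S_def atLeast0LessThan)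
  qed (use K in auto)
  ultimately show ?thesis using t by blast
qed

subsection \<open>Unitary diagonalization of Hermitian matrices\<close>

text \<open>Gram-Schmidt does not change the first vector of the basis obtained by completing v, and
  normalization only rescales it.\<close>

lemma exists_unitary_with_first_col:
  fixes v :: "complex Matrix.vec"
  assumes v: "v \<in> carrier_vec n" "v \<noteq> 0\<^sub>v n"
  shows "\<exists>W\<in>carrier_mat n n. mat_adjoint W * W = 1\<^sub>m n \<and> (\<exists>c. col W 0 = c \<cdot>\<^sub>v v)"
proof -
  interpret cof_vec_space n "TYPE(complex)" .
  define ws where "ws = gram_schmidt n (basis_completion v)"
  note bc = basis_completion[OF v]
  note gs = gram_schmidt_result[OF bc(2,4,5) ws_def]
  have n0: "n > 0" using v by (cases n) auto
  have len: "length ws = n" using gs(4) bc(6) by simp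
  have "hd ws = v"
  proof -
    obtain b bs where b: "basis_completion v = b # bs" using bc(6) n0 by (cases "basis_completion v") auto
    then have "b = v" using bc(7) by simp
    then show ?thesis unfolding ws_def b using gram_schmidt_hd[OF v(1)] by simp
  qed
  then have ws0: "ws ! 0 = v" using len n0 hd_conv_nth[of ws] by auto
  have wsc: "ws ! i \<in> carrier_vec n" if "i < n" for i using gs(3) len that by auto
  define W where "W = mat_of_cols n (map normalize_cvec ws)"
  have W: "W \<in> carrier_mat n n" using len by (simp add: W_def mat_of_cols_def carrier_matI)
  have colW: "col W i = normalize_cvec (ws ! i)" if "i < n" for i
    unfolding W_def using that len wsc by (subst col_mat_of_cols) (auto simp: normalize_cvec_def)
  have "mat_adjoint W * W = 1\<^sub>m n"
  proof (rule eq_matI)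
    fix i j assume "i < dim_row (1\<^sub>m n :: complex mat)" "j < dim_col (1\<^sub>m n :: complex mat)"
    then have ij: "i < n" "j < n" by auto
    have "(mat_adjoint W * W) $$ (i, j) = col W j \<bullet>c col W i"
      using ij W by (simp add: scalar_prod_def mult.commute)
    also have "\<dots> = complex_of_real (1 / sqrt (Re (ws ! j \<bullet>c ws ! j))) * complex_of_real (1 / sqrt (Re (ws ! i \<bullet>c ws ! i))) * (ws ! j \<bullet>c ws ! i)"
      unfolding colW[OF ij(1)] colW[OF ij(2)] normalize_cvec_def
      by (subst cscalar_prod_smult[OF wsc[OF ij(2)] wsc[OF ij(1)]]) simp
    also have "\<dots> = (if i = j then 1 else 0)"
    proof (cases "i = j")
      case True
      have "ws ! i \<bullet>c ws ! i \<noteq> 0" using corthogonalD[OF gs(2), of i i] ij len by simp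
      then have "rip (ws ! i) (ws ! i) > 0"
        using cscalar_prod_self[OF wsc[OF ij(1)]] rip_self_nonneg[of "ws ! i"] by (auto simp: less_le)
      then have "1 / sqrt (rip (ws ! i) (ws ! i)) * (1 / sqrt (rip (ws ! i) (ws ! i))) * rip (ws ! i) (ws ! i) = 1"
        by simp
      then show ?thesis
        unfolding True[symmetric] cscalar_prod_self[OF wsc[OF ij(1)]] Re_complex_of_real
        by (simp only: of_real_mult[symmetric] of_real_1 simp_thms if_True)
    next
      case False
      then show ?thesis using corthogonalD[OF gs(2), of j i] ij len by simp
    qed
    finally show "(mat_adjoint W * W) $$ (i, j) = 1\<^sub>m n $$ (i, j)" using ij by simp
  qed (use W in auto)
  moreover have "col W 0 = complex_of_real (1 / sqrt (Re (v \<bullet>c v))) \<cdot>\<^sub>v v"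
    using colW[OF n0] ws0 by (simp add: normalize_cvec_def)
  ultimately show ?thesis using W by (intro bexI[of _ W] conjI exI)
qed

definition diagonal :: "nat \<Rightarrow> (nat \<Rightarrow> complex) \<Rightarrow> complex mat" where
  "diagonal n d = Matrix.mat n n (\<lambda>(i, j). if i = j then d i else 0)"

lemma diagonal_carrier[simp, intro]: "diagonal n d \<in> carrier_mat n n"
  by (simp add: diagonal_def)

lemma diagonal_index[simp]: "i < n \<Longrightarrow> j < n \<Longrightarrow> diagonal n d $$ (i, j) = (if i = j then d i else 0)"
  by (simp add: diagonal_def)

lemma diagonal_dim[simp]: "dim_row (diagonal n d) = n" "dim_col (diagonal n d) = n"
  by (auto simp: diagonal_def)

lemma diagonal_mult_vec: "v \<in> carrier_vec n \<Longrightarrow> diagonal n d *\<^sub>v v = Matrix.vec n (\<lambda>i. d i * v $ i)"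
  by (rule eq_vecI) (auto simp: scalar_prod_def if_distrib[where f="\<lambda>x. x * _"] cong: if_cong)

lemma mult_diagonal:
  assumes "A \<in> carrier_mat m n"
  shows "A * diagonal n d = Matrix.mat m n (\<lambda>(i, j). A $$ (i, j) * d j)"
  using assms by (intro eq_matI) (auto simp: scalar_prod_def if_distrib[where f="\<lambda>x. _ * x"] cong: if_cong)

lemma adjoint_diagonal: "mat_adjoint (diagonal n d) = diagonal n (\<lambda>i. cnj (d i))"
  by (rule eq_matI) auto

text \<open>Deflation: with an eigenvector as first column, the conjugated matrix has zeros below
  its corner, by symmetry also to the right of it, and a smaller Hermitian block remains. The
  diagonal is left complex; \<open>singular_basis\<close> finds it real and nonnegative in the case
  at hand.\<close>

theorem hermitian_diagonalization:
  fixes A :: "complex mat"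
  assumes "A \<in> carrier_mat n n" "mat_adjoint A = A"
  shows "\<exists>U d. U \<in> carrier_mat n n \<and> mat_adjoint U * U = 1\<^sub>m n \<and> A * U = U * diagonal n d"
  using assms
proof (induction n arbitrary: A)
  case 0
  then show ?case by (intro exI[of _ "1\<^sub>m 0"] exI conjI) (auto intro!: eq_matI)
next
  case (Suc n)
  note A = Suc.prems(1)
  obtain e where "eigenvalue A e" using spectrum_non_empty[OF A] by (auto simp: spectrum_def)
  then obtain v where v: "v \<in> carrier_vec (Suc n)" "v \<noteq> 0\<^sub>v (Suc n)" "A *\<^sub>v v = e \<cdot>\<^sub>v v"
    using A by (auto simp: eigenvalue_def eigenvector_def)
  obtain W c where W: "W \<in> carrier_mat (Suc n) (Suc n)" "mat_adjoint W * W = 1\<^sub>m (Suc n)" "col W 0 = c \<cdot>\<^sub>v v"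
    using exists_unitary_with_first_col[OF v(1,2)] by blast
  have W': "W * mat_adjoint W = 1\<^sub>m (Suc n)"
    using mat_mult_left_right_inverse[OF mat_adjoint_carrier[OF W(1)] W(1) W(2)] .
  define B where "B = mat_adjoint W * A * W"
  have B: "B \<in> carrier_mat (Suc n) (Suc n)"
    unfolding B_def using W(1) A by (meson mult_carrier_mat mat_adjoint_carrier)
  have Bh: "mat_adjoint B = B"
  proof -
    have "mat_adjoint B = mat_adjoint W * mat_adjoint (mat_adjoint W * A)"
      unfolding B_def by (rule mat_adjoint_mult[of _ "Suc n" "Suc n"]) (use W A in auto)
    also have "mat_adjoint (mat_adjoint W * A) = A * W"
      using mat_adjoint_mult[of "mat_adjoint W" "Suc n" "Suc n" A "Suc n"] W A Suc.prems(2) by simp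
    also have "mat_adjoint W * (A * W) = B" using W A by (simp add: B_def assoc_mult_mat[of _ "Suc n" "Suc n" _ "Suc n" _ "Suc n"])
    finally show ?thesis .
  qed
  have col0: "B $$ (i, 0) = (if i = 0 then e else 0)" if i: "i < Suc n" for i
  proof -
    have "col (A * W) 0 = A *\<^sub>v col W 0" using W A by (intro col_mult2[of _ "Suc n" "Suc n" _ "Suc n"]) auto
    also have "\<dots> = e \<cdot>\<^sub>v col W 0"
      using A v W(3) by (simp add: mult_mat_vec smult_smult_assoc mult.commute)
    finally have AW: "col (A * W) 0 = e \<cdot>\<^sub>v col W 0" .
    have "B $$ (i, 0) = (mat_adjoint W * (A * W)) $$ (i, 0)"
      using W A by (simp add: B_def assoc_mult_mat[of _ "Suc n" "Suc n" _ "Suc n" _ "Suc n"])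
    also have "\<dots> = row (mat_adjoint W) i \<bullet> (e \<cdot>\<^sub>v col W 0)"
      using W A i AW by (subst index_mult_mat) (auto)
    also have "\<dots> = e * (row (mat_adjoint W) i \<bullet> col W 0)"
      by (rule scalar_prod_smult_distrib[of _ "Suc n"]) (use W(1) i in \<open>auto intro!: carrier_vecI\<close>)
    also have "row (mat_adjoint W) i \<bullet> col W 0 = (mat_adjoint W * W) $$ (i, 0)"
      using W(1) i by (subst index_mult_mat) auto
    finally show ?thesis using W i by simp
  qed
  have row0: "B $$ (0, i) = (if i = 0 then e else 0)" if i: "i < Suc n" for i
  proof -
    have "B $$ (0, i) = mat_adjoint B $$ (0, i)" using Bh by simp
    also have "\<dots> = cnj (B $$ (i, 0))" using B i by simp
    finally have c: "B $$ (0, i) = cnj (B $$ (i, 0))" .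
    show ?thesis
    proof (cases "i = 0")
      case False
      then show ?thesis using c col0[OF i] by simp
    qed (use col0[OF i] in simp)
  qed
  define B3 where "B3 = Matrix.mat n n (\<lambda>(i, j). B $$ (Suc i, Suc j))"
  have B3: "B3 \<in> carrier_mat n n" by (simp add: B3_def)
  have "mat_adjoint B3 = B3"
  proof (rule eq_matI)
    fix i j assume "i < dim_row B3" "j < dim_col B3"
    then have ij: "i < n" "j < n" using B3 by auto
    have "B $$ (Suc i, Suc j) = mat_adjoint B $$ (Suc i, Suc j)" using Bh by simp
    then show "mat_adjoint B3 $$ (i, j) = B3 $$ (i, j)" using ij B by (simp add: B3_def)
  qed (use B3 in auto)
  from Suc.IH[OF B3 this] obtain U3 d3 where U3: "U3 \<in> carrier_mat n n" "mat_adjoint U3 * U3 = 1\<^sub>m n"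
    "B3 * U3 = U3 * diagonal n d3" by blast
  define E where "E = Matrix.mat 1 1 (\<lambda>_. e)"
  have E: "E \<in> carrier_mat 1 1" by (simp add: E_def)
  have Bb: "B = four_block_mat E (0\<^sub>m 1 n) (0\<^sub>m n 1) B3"
    by (rule eq_matI) (use B col0 row0 in \<open>auto simp: E_def B3_def\<close>)
  define V where "V = four_block_mat (1\<^sub>m 1) (0\<^sub>m 1 n) (0\<^sub>m n 1) U3"
  have V: "V \<in> carrier_mat (Suc n) (Suc n)" using U3 unfolding V_def by auto
  define d where "d = (\<lambda>i. case i of 0 \<Rightarrow> e | Suc i \<Rightarrow> d3 i)"
  have Db: "diagonal (Suc n) d = four_block_mat E (0\<^sub>m 1 n) (0\<^sub>m n 1) (diagonal n d3)"
    by (rule eq_matI) (auto simp: E_def d_def split: nat.split)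
  have Vb: "mat_adjoint V = four_block_mat (1\<^sub>m 1) (0\<^sub>m 1 n) (0\<^sub>m n 1) (mat_adjoint U3)"
    by (rule eq_matI) (use U3 V in \<open>auto simp: V_def\<close>)
  have VV: "mat_adjoint V * V = 1\<^sub>m (Suc n)"
    unfolding Vb unfolding V_def
    by (subst mult_four_block_mat[of _ 1 1 _ n _ n _ _ 1 _ n]) (use U3 in auto)
  have BV: "B * V = V * diagonal (Suc n) d"
    unfolding Bb Db unfolding V_def
    by (subst (1 2) mult_four_block_mat[of _ 1 1 _ n _ n _ _ 1 _ n]) (use U3 E B3 in auto)
  note am = assoc_mult_mat[of _ "Suc n" "Suc n" _ "Suc n" _ "Suc n"]
  have D: "diagonal (Suc n) d \<in> carrier_mat (Suc n) (Suc n)" by simp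
  note c[simp] = V D B A W(1) mult_carrier_mat[of _ "Suc n" "Suc n" _ "Suc n"] mat_adjoint_carrier[of _ "Suc n" "Suc n"]
    right_mult_one_mat[of _ "Suc n" "Suc n"] left_mult_one_mat[of _ "Suc n" "Suc n"]
  have "mat_adjoint (W * V) * (W * V) = mat_adjoint V * (mat_adjoint W * W) * V"
    by (simp add: mat_adjoint_mult[of _ "Suc n" "Suc n" _ "Suc n"] am)
  also have "\<dots> = 1\<^sub>m (Suc n)" using W VV by simp
  finally have 1: "mat_adjoint (W * V) * (W * V) = 1\<^sub>m (Suc n)" .
  have "A * (W * V) = W * mat_adjoint W * (A * (W * V))" using W' by simp
  also have "\<dots> = W * (B * V)" by (simp add: B_def am)
  also have "\<dots> = (W * V) * diagonal (Suc n) d" unfolding BV by (simp add: am)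
  finally show ?case using 1 by (intro exI[of _ "W * V"] exI[of _ d]) simp
qed

subsection \<open>Singular values\<close>

lemma mult_mat_vec_in_carrier_iff[simp]: "A *\<^sub>v v \<in> carrier_vec n \<longleftrightarrow> dim_row A = n"
  unfolding carrier_vec_def mem_Collect_eq dim_mult_mat_vec ..

lemma mult_mat_in_carrier_iff[simp]: "A * B \<in> carrier_mat n m \<longleftrightarrow> dim_row A = n \<and> dim_col B = m"
  unfolding carrier_mat_def mem_Collect_eq index_mult_mat ..

lemma proots_prod_list_linear:
  "proots (\<Prod>a\<leftarrow>as. [:- a, 1:]) = mset (as :: complex list)"
proof (induction as)
  case (Cons a as)
  have "(\<Prod>a\<leftarrow>as. [:- a, 1:]) \<noteq> 0" by (auto simp: prod_list_zero_iff)
  then have "proots ([:- a, 1:] * (\<Prod>a\<leftarrow>as. [:- a, 1:])) = proots [:- a, 1:] + mset as"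
    using Cons by (subst proots_mult) auto
  then show ?case by (simp only: list.map prod_list.Cons mset.simps) simp
qed simp

lemma sum_orthonormal_columns:
  assumes "U \<in> carrier_mat n n" "mat_adjoint U * U = 1\<^sub>m n" "i < n" "j < n"
  shows "(\<Sum>k<n. cnj (U $$ (k, i)) * U $$ (k, j)) = (if i = j then 1 else (0 :: complex))"
proof -
  have "(mat_adjoint U * U) $$ (i, j) = (\<Sum>k<n. cnj (U $$ (k, i)) * U $$ (k, j))"
    using assms(1,3,4) by (simp add: scalar_prod_def atLeast0LessThan)
  then show ?thesis using assms by simp
qed

text \<open>Connects the definition by roots of the characteristic polynomial with orthonormal
  eigenvectors. Similarity identifies the multiset of roots with the diagonal, and a permutation of
  the columns puts the eigenvectors in the order of \<open>sing_vals\<close>.\<close>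

theorem singular_basis:
  assumes X: "X \<in> carrier_mat n n"
  shows "\<exists>U\<in>carrier_mat n n. mat_adjoint U * U = 1\<^sub>m n \<and> U * mat_adjoint U = 1\<^sub>m n \<and>
     X * mat_adjoint X * U = U * diagonal n (\<lambda>i. complex_of_real ((sing_val X (Suc i))\<^sup>2)) \<and>
     (\<forall>i j. i \<le> j \<and> j < n \<longrightarrow> sing_val X (Suc j) \<le> sing_val X (Suc i)) \<and>
     (\<forall>i<n. sing_val X (Suc i) \<ge> 0)"
proof -
  define A where "A = X * mat_adjoint X"
  have A: "A \<in> carrier_mat n n" unfolding A_def using X by auto
  have "mat_adjoint A = A"
    unfolding A_def using X by (simp add: mat_adjoint_mult[of _ n n _ n])
  from hermitian_diagonalization[OF A this] obtain U0 d where
    U0: "U0 \<in> carrier_mat n n" "mat_adjoint U0 * U0 = 1\<^sub>m n" and AU: "A * U0 = U0 * diagonal n d" by blast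
  have U0': "U0 * mat_adjoint U0 = 1\<^sub>m n"
    using mat_mult_left_right_inverse[OF mat_adjoint_carrier[OF U0(1)] U0(1) U0(2)] .
  define s where "s = (\<lambda>i. sqrt (Re (d i)))"
  have col: "A *\<^sub>v col U0 i = d i \<cdot>\<^sub>v col U0 i" if i: "i < n" for i
  proof -
    have "A *\<^sub>v col U0 i = col (A * U0) i" using A U0 i by (subst col_mult2[of _ n n _ n]) auto
    also have "\<dots> = d i \<cdot>\<^sub>v col U0 i"
      unfolding AU mult_diagonal[OF U0(1)] using U0 i by (intro eq_vecI) auto
    finally show ?thesis .
  qed
  have d: "d i = complex_of_real ((s i)\<^sup>2)" "s i \<ge> 0" if i: "i < n" for i
  proof -
    define q where "q = col U0 i"
    have q: "q \<in> carrier_vec n" using U0 i by (auto simp: q_def intro: carrier_vecI)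
    have "q \<bullet>c q = 1" using sum_orthonormal_columns[OF U0 i i] U0(1) i
      by (simp add: q_def scalar_prod_def atLeast0LessThan mult.commute)
    \<comment> \<open>The eigenvalue is its own Rayleigh quotient, here the squared norm of
      \<open>mat_adjoint X *\<^sub>v q\<close>; hence it is real and nonnegative.\<close>
    have "(A *\<^sub>v q) \<bullet>c q = d i"
      unfolding q_def col[OF i] using cscalar_prod_smult[OF q q, of "d i" 1] \<open>q \<bullet>c q = 1\<close> by (simp add: q_def)
    moreover have "A *\<^sub>v q = X *\<^sub>v (mat_adjoint X *\<^sub>v q)"
      unfolding A_def using X q by (intro assoc_mult_mat_vec[of _ n n _ n]) auto
    moreover have "(X *\<^sub>v (mat_adjoint X *\<^sub>v q)) \<bullet>c q = (mat_adjoint X *\<^sub>v q) \<bullet>c (mat_adjoint X *\<^sub>v q)"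
      using X q by (intro cscalar_prod_mult_mat_vec[of _ n n]) auto
    moreover have "\<dots> = complex_of_real (rip (mat_adjoint X *\<^sub>v q) (mat_adjoint X *\<^sub>v q))"
      by (rule cscalar_prod_self[of _ n]) (use X q in auto)
    ultimately have *: "d i = complex_of_real (rip (mat_adjoint X *\<^sub>v q) (mat_adjoint X *\<^sub>v q))" by simp
    then show "d i = complex_of_real ((s i)\<^sup>2)" "s i \<ge> 0" by (simp_all add: s_def)
  qed
  have "similar_mat_wit A (diagonal n d) U0 (mat_adjoint U0)"
    unfolding similar_mat_wit_def Let_def
  proof (intro conjI)
    have "A = A * (U0 * mat_adjoint U0)" using U0' A by simp
    also have "\<dots> = A * U0 * mat_adjoint U0" using A U0 by (simp add: assoc_mult_mat[of _ n n _ n _ n])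
    finally show "A = U0 * diagonal n d * mat_adjoint U0" unfolding AU .
    show "{A, diagonal n d, U0, mat_adjoint U0} \<subseteq> carrier_mat (dim_row A) (dim_row A)" using A U0 by auto
  qed (use A U0 U0' in auto)
  then have sim: "similar_mat A (diagonal n d)" unfolding similar_mat_def by blast
  have "char_poly A = (\<Prod>a\<leftarrow>diag_mat (diagonal n d). [:- a, 1:])"
    unfolding char_poly_similar[OF sim]
    by (rule char_poly_upper_triangular[of _ n]) (auto simp: upper_triangular_def)
  then have "proots (char_poly A) = mset (diag_mat (diagonal n d))"
    by (simp only: proots_prod_list_linear)
  also have "diag_mat (diagonal n d) = map d [0..<n]" by (auto simp: diag_mat_def)
  finally have "image_mset (\<lambda>z. sqrt (Re z)) (proots (char_poly A)) = mset (map s [0..<n])"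
    by (simp add: s_def image_mset.compositionality comp_def)
  then have sv: "sing_vals X = rev (sorted_list_of_multiset (mset (map s [0..<n])))"
    by (simp only: sing_vals_def A_def)
  then have m: "mset (sing_vals X) = mset (map s [0..<n])" by (simp del: mset_map)
  then have len: "length (sing_vals X) = n" using mset_eq_length[OF m] by simp
  from m obtain p where p: "p permutes {..<length (map s [0..<n])}" "permute_list p (map s [0..<n]) = sing_vals X"
    by (rule mset_eq_permutation)
  have pn: "p permutes {..<n}" using p(1) by simp
  have plt: "p i < n" if "i < n" for i using permutes_in_image[OF pn, of i] that by simp
  have svs: "sing_val X (Suc i) = s (p i)" if i: "i < n" for i
    using permute_list_nth[OF p(1), of i] p(2) plt[OF i] i by (simp add: sing_val_def)
  define U where "U = Matrix.mat n n (\<lambda>(i, j). U0 $$ (i, p j))"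
  have U: "U \<in> carrier_mat n n" by (simp add: U_def)
  have inj: "p i = p j \<longleftrightarrow> i = j" for i j using permutes_inj[OF pn] by (auto dest: injD)
  have UU: "mat_adjoint U * U = 1\<^sub>m n"
  proof (rule eq_matI)
    fix i j assume "i < dim_row (1\<^sub>m n :: complex mat)" "j < dim_col (1\<^sub>m n :: complex mat)"
    then have ij: "i < n" "j < n" by auto
    have "(mat_adjoint U * U) $$ (i, j) = (\<Sum>k<n. cnj (U0 $$ (k, p i)) * U0 $$ (k, p j))"
      using ij by (simp add: U_def scalar_prod_def atLeast0LessThan)
    also have "\<dots> = 1\<^sub>m n $$ (i, j)" using sum_orthonormal_columns[OF U0 plt[OF ij(1)] plt[OF ij(2)]] ij inj by simp
    finally show "(mat_adjoint U * U) $$ (i, j) = 1\<^sub>m n $$ (i, j)" .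
  qed (use U in auto)
  moreover have "U * mat_adjoint U = 1\<^sub>m n"
    using mat_mult_left_right_inverse[OF mat_adjoint_carrier[OF U] U UU] .
  moreover have "A * U = U * diagonal n (\<lambda>i. complex_of_real ((sing_val X (Suc i))\<^sup>2))"
  proof (rule eq_matI)
    fix i j assume "i < dim_row (U * diagonal n (\<lambda>i. complex_of_real ((sing_val X (Suc i))\<^sup>2)))"
      "j < dim_col (U * diagonal n (\<lambda>i. complex_of_real ((sing_val X (Suc i))\<^sup>2)))"
    then have ij: "i < n" "j < n" using U by auto
    have "(A * U) $$ (i, j) = (A * U0) $$ (i, p j)"
      using A U0 ij plt[OF ij(2)] by (simp add: U_def scalar_prod_def)
    also have "\<dots> = U0 $$ (i, p j) * d (p j)"
      unfolding AU mult_diagonal[OF U0(1)] using ij plt by simp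
    also have "\<dots> = (U * diagonal n (\<lambda>i. complex_of_real ((sing_val X (Suc i))\<^sup>2))) $$ (i, j)"
      unfolding mult_diagonal[OF U] using ij plt d[OF plt[OF ij(2)]] svs[OF ij(2)] by (simp add: U_def)
    finally show "(A * U) $$ (i, j) = (U * diagonal n (\<lambda>i. complex_of_real ((sing_val X (Suc i))\<^sup>2))) $$ (i, j)" .
  qed (use A U in auto)
  moreover have "sing_val X (Suc j) \<le> sing_val X (Suc i)" if "i \<le> j" "j < n" for i j
  proof -
    have "sorted_wrt (\<ge>) (sing_vals X)" unfolding sv sorted_wrt_rev by (simp add: sorted_sorted_list_of_multiset)
    then show ?thesis using that len by (cases "i = j") (auto simp: sing_val_def sorted_wrt_iff_nth_less)
  qed
  moreover have "sing_val X (Suc i) \<ge> 0" if "i < n" for i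
    using svs[OF that] d(2)[OF plt[OF that]] by simp
  ultimately show ?thesis using U unfolding A_def by blast
qed

lemma sing_val_antimono:
  assumes "X \<in> carrier_mat n n" "1 \<le> i" "i \<le> j" "j \<le> n"
  shows "sing_val X j \<le> sing_val X i"
proof -
  obtain i' j' where "i = Suc i'" "j = Suc j'" using assms by (metis Suc_le_D One_nat_def order_trans)
  then show ?thesis using singular_basis[OF assms(1)] assms(3,4) by auto
qed

lemma sing_val_nonneg:
  assumes "X \<in> carrier_mat n n" "1 \<le> i" "i \<le> n"
  shows "sing_val X i \<ge> 0"
proof -
  obtain i' where "i = Suc i'" using assms by (metis Suc_le_D One_nat_def)
  then show ?thesis using singular_basis[OF assms(1)] assms(3) by auto
qed

lemma singular_basis_expansion:
  assumes X: "X \<in> carrier_mat n n" and U: "U \<in> carrier_mat n n" "U * mat_adjoint U = 1\<^sub>m n"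
    "X * mat_adjoint X * U = U * diagonal n (\<lambda>i. complex_of_real (l i))"
    and v: "v \<in> carrier_vec n"
  shows "rip v v = (\<Sum>i<n. (cmod ((mat_adjoint U *\<^sub>v v) $ i))\<^sup>2)"
    "rip (mat_adjoint X *\<^sub>v v) (mat_adjoint X *\<^sub>v v) = (\<Sum>i<n. l i * (cmod ((mat_adjoint U *\<^sub>v v) $ i))\<^sup>2)"
proof -
  define y where "y = mat_adjoint U *\<^sub>v v"
  have y: "y \<in> carrier_vec n" using U v by (simp add: y_def)
  have vy: "v = U *\<^sub>v y"
    unfolding y_def using U v by (subst assoc_mult_mat_vec[symmetric, of _ n n _ n]) auto
  have "rip v v = rip (U *\<^sub>v y) v" using vy by simp
  also have "\<dots> = rip y y" unfolding y_def using U v by (intro rip_adjoint[of _ n n]) auto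
  finally show "rip v v = (\<Sum>i<n. (cmod ((mat_adjoint U *\<^sub>v v) $ i))\<^sup>2)"
    using rip_self[OF y] unfolding y_def by simp
  have "rip (mat_adjoint X *\<^sub>v v) (mat_adjoint X *\<^sub>v v) = rip (X *\<^sub>v (mat_adjoint X *\<^sub>v v)) v"
    using X v by (subst rip_adjoint[of X n n]) auto
  also have "X *\<^sub>v (mat_adjoint X *\<^sub>v v) = (X * mat_adjoint X * U) *\<^sub>v y"
    using X U(1) v y vy by (simp add: assoc_mult_mat_vec[of _ n n _ n])
  also have "\<dots> = U *\<^sub>v (diagonal n (\<lambda>i. complex_of_real (l i)) *\<^sub>v y)"
    unfolding U(3) using U(1) y by (intro assoc_mult_mat_vec[of _ n n _ n]) auto
  also have "rip \<dots> v = rip (diagonal n (\<lambda>i. complex_of_real (l i)) *\<^sub>v y) y"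
    unfolding y_def using U v by (intro rip_adjoint[of _ n n]) auto
  also have "\<dots> = (\<Sum>i<n. l i * (cmod (y $ i))\<^sup>2)"
    unfolding rip_sum[OF y] diagonal_mult_vec[OF y]
    by (intro sum.cong) (auto simp: cmod_def power2_eq_square algebra_simps)
  finally show "rip (mat_adjoint X *\<^sub>v v) (mat_adjoint X *\<^sub>v v) = (\<Sum>i<n. l i * (cmod ((mat_adjoint U *\<^sub>v v) $ i))\<^sup>2)"
    by (simp add: y_def)
qed

subsection \<open>Schur complement of a low-rank perturbation\<close>

text \<open>The easy half of the Courant-Fischer principle in both directions, with one basis for
  all m: spans of leading vectors give lower bounds, spans of trailing ones upper bounds.\<close>

lemma singular_vector_bounds:
  assumes X: "X \<in> carrier_mat n n"
  obtains U where "U \<in> carrier_mat n n" "mat_adjoint U * U = 1\<^sub>m n"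
    "\<And>v m. v \<in> carrier_vec n \<Longrightarrow> 1 \<le> m \<Longrightarrow> m \<le> n \<Longrightarrow> (\<And>i. m \<le> i \<Longrightarrow> i < n \<Longrightarrow> (mat_adjoint U *\<^sub>v v) $ i = 0) \<Longrightarrow>
       (sing_val X m)\<^sup>2 * rip v v \<le> rip (mat_adjoint X *\<^sub>v v) (mat_adjoint X *\<^sub>v v)"
    "\<And>v m. v \<in> carrier_vec n \<Longrightarrow> m < n \<Longrightarrow> (\<And>i. i < m \<Longrightarrow> (mat_adjoint U *\<^sub>v v) $ i = 0) \<Longrightarrow>
       rip (mat_adjoint X *\<^sub>v v) (mat_adjoint X *\<^sub>v v) \<le> (sing_val X (Suc m))\<^sup>2 * rip v v"
proof -
  from singular_basis[OF X] obtain U where U: "U \<in> carrier_mat n n" "mat_adjoint U * U = 1\<^sub>m n" "U * mat_adjoint U = 1\<^sub>m n"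
     "X * mat_adjoint X * U = U * diagonal n (\<lambda>i. complex_of_real ((sing_val X (Suc i))\<^sup>2))" by blast
  note ex = singular_basis_expansion[OF X U(1,3,4)]
  show ?thesis
  proof (rule that[OF U(1,2)])
    fix v m assume v: "v \<in> carrier_vec n" and m: "1 \<le> m" "m \<le> n"
      and 0: "\<And>i. m \<le> i \<Longrightarrow> i < n \<Longrightarrow> (mat_adjoint U *\<^sub>v v) $ i = 0"
    show "(sing_val X m)\<^sup>2 * rip v v \<le> rip (mat_adjoint X *\<^sub>v v) (mat_adjoint X *\<^sub>v v)"
      unfolding ex(2)[OF v] ex(1)[OF v] sum_distrib_left
    proof (rule sum_mono)
      fix i assume "i \<in> {..<n}"
      then have i: "i < n" by simp
      show "(sing_val X m)\<^sup>2 * (cmod ((mat_adjoint U *\<^sub>v v) $ i))\<^sup>2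
        \<le> (sing_val X (Suc i))\<^sup>2 * (cmod ((mat_adjoint U *\<^sub>v v) $ i))\<^sup>2"
      proof (cases "m \<le> i")
        case False
        then have "sing_val X m \<le> sing_val X (Suc i)" using m i by (intro sing_val_antimono[OF X]) auto
        then show ?thesis using sing_val_nonneg[OF X m] by (intro mult_right_mono power_mono) auto
      qed (use 0[OF _ i] in simp)
    qed
  next
    fix v m assume v: "v \<in> carrier_vec n" and m: "m < n"
      and 0: "\<And>i. i < m \<Longrightarrow> (mat_adjoint U *\<^sub>v v) $ i = 0"
    show "rip (mat_adjoint X *\<^sub>v v) (mat_adjoint X *\<^sub>v v) \<le> (sing_val X (Suc m))\<^sup>2 * rip v v"
      unfolding ex(2)[OF v] ex(1)[OF v] sum_distrib_left
    proof (rule sum_mono)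
      fix i assume "i \<in> {..<n}"
      then have i: "i < n" by simp
      show "(sing_val X (Suc i))\<^sup>2 * (cmod ((mat_adjoint U *\<^sub>v v) $ i))\<^sup>2
         \<le> (sing_val X (Suc m))\<^sup>2 * (cmod ((mat_adjoint U *\<^sub>v v) $ i))\<^sup>2"
      proof (cases "i < m")
        case False
        then have "sing_val X (Suc i) \<le> sing_val X (Suc m)" using m i by (intro sing_val_antimono[OF X]) auto
        then show ?thesis using sing_val_nonneg[OF X, of "Suc i"] i by (intro mult_right_mono power_mono) auto
      qed (use 0 in simp)
    qed
  qed
qed

text \<open>The vectors sought later lie in kernels of long composites; this predicate assembles
  linearity by introduction rules, without writing down the matrix of the composite.\<close>

definition linear_vec_map :: "nat \<Rightarrow> nat \<Rightarrow> (complex Matrix.vec \<Rightarrow> complex Matrix.vec) \<Rightarrow> bool" where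
  "linear_vec_map m a L \<longleftrightarrow> (\<exists>M\<in>carrier_mat a m. \<forall>t\<in>carrier_vec m. L t = M *\<^sub>v t)"

lemma linear_vec_map_mat: "A \<in> carrier_mat a m \<Longrightarrow> linear_vec_map m a (\<lambda>t. A *\<^sub>v t)"
  unfolding linear_vec_map_def by blast

lemma linear_vec_map_comp:
  assumes "A \<in> carrier_mat b a" "linear_vec_map m a L"
  shows "linear_vec_map m b (\<lambda>t. A *\<^sub>v L t)"
proof -
  obtain M where M: "M \<in> carrier_mat a m" "\<And>t. t \<in> carrier_vec m \<Longrightarrow> L t = M *\<^sub>v t"
    using assms(2) unfolding linear_vec_map_def by blast
  show ?thesis unfolding linear_vec_map_def
  proof (intro bexI[of _ "A * M"] ballI)
    fix t :: "complex Matrix.vec" assume t: "t \<in> carrier_vec m"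
    show "A *\<^sub>v L t = (A * M) *\<^sub>v t"
      unfolding M(2)[OF t] by (rule assoc_mult_mat_vec[OF assms(1) M(1) t, symmetric])
  qed (use assms(1) M(1) in auto)
qed

lemma linear_vec_map_add:
  assumes "linear_vec_map m a L" "linear_vec_map m a L'"
  shows "linear_vec_map m a (\<lambda>t. L t + L' t)"
proof -
  obtain M M' where M: "M \<in> carrier_mat a m" "\<And>t. t \<in> carrier_vec m \<Longrightarrow> L t = M *\<^sub>v t"
    "M' \<in> carrier_mat a m" "\<And>t. t \<in> carrier_vec m \<Longrightarrow> L' t = M' *\<^sub>v t"
    using assms unfolding linear_vec_map_def by blast
  show ?thesis unfolding linear_vec_map_def
  proof (intro bexI[of _ "M + M'"] ballI)
    fix t :: "complex Matrix.vec" assume t: "t \<in> carrier_vec m"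
    show "L t + L' t = (M + M') *\<^sub>v t"
      unfolding M(2)[OF t] M(4)[OF t] by (rule add_mult_distrib_mat_vec[OF M(1,3) t, symmetric])
  qed (use M in auto)
qed

lemma linear_vec_map_smult:
  assumes "linear_vec_map m a L"
  shows "linear_vec_map m a (\<lambda>t. c \<cdot>\<^sub>v L t)"
proof -
  obtain M where M: "M \<in> carrier_mat a m" "\<And>t. t \<in> carrier_vec m \<Longrightarrow> L t = M *\<^sub>v t"
    using assms unfolding linear_vec_map_def by blast
  show ?thesis unfolding linear_vec_map_def
  proof (intro bexI[of _ "c \<cdot>\<^sub>m M"] ballI)
    fix t :: "complex Matrix.vec" assume t: "t \<in> carrier_vec m"
    show "c \<cdot>\<^sub>v L t = (c \<cdot>\<^sub>m M) *\<^sub>v t"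
      unfolding M(2)[OF t] using M(1) t by (intro eq_vecI) auto
  qed (use M in auto)
qed

lemma linear_vec_map_minus:
  assumes "linear_vec_map m a L" "linear_vec_map m a L'"
  shows "linear_vec_map m a (\<lambda>t. L t - L' t)"
proof -
  obtain M M' where M: "M \<in> carrier_mat a m" "\<And>t. t \<in> carrier_vec m \<Longrightarrow> L t = M *\<^sub>v t"
    "M' \<in> carrier_mat a m" "\<And>t. t \<in> carrier_vec m \<Longrightarrow> L' t = M' *\<^sub>v t"
    using assms unfolding linear_vec_map_def by blast
  show ?thesis unfolding linear_vec_map_def
  proof (intro bexI[of _ "M - M'"] ballI)
    fix t :: "complex Matrix.vec" assume t: "t \<in> carrier_vec m"
    show "L t - L' t = (M - M') *\<^sub>v t"
      unfolding M(2)[OF t] M(4)[OF t] by (rule minus_mult_distrib_mat_vec[OF M(1,3) t, symmetric])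
  qed (use M in auto)
qed

lemma linear_vec_map_uminus:
  assumes "linear_vec_map m a L"
  shows "linear_vec_map m a (\<lambda>t. - L t)"
proof -
  have "(- 1) \<cdot>\<^sub>v x = - x" for x :: "complex Matrix.vec" by auto
  then show ?thesis using linear_vec_map_smult[OF assms, of "- 1"] by simp
qed

lemmas linear_vec_map_intros = linear_vec_map_uminus linear_vec_map_minus linear_vec_map_smult
  linear_vec_map_add linear_vec_map_comp linear_vec_map_mat

lemma linear_vec_map_common_kernel:
  assumes "linear_vec_map m a L" "linear_vec_map m b L'" "a + b < m"
  obtains t where "t \<in> carrier_vec m" "t \<noteq> 0\<^sub>v m" "L t = 0\<^sub>v a" "L' t = 0\<^sub>v b"
proof -
  obtain M M' where M: "M \<in> carrier_mat a m" "\<And>t. t \<in> carrier_vec m \<Longrightarrow> L t = M *\<^sub>v t"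
    "M' \<in> carrier_mat b m" "\<And>t. t \<in> carrier_vec m \<Longrightarrow> L' t = M' *\<^sub>v t"
    using assms unfolding linear_vec_map_def by blast
  from exists_common_kernel_vec[OF M(1,3) assms(3)] obtain t where "t \<in> carrier_vec m" "t \<noteq> 0\<^sub>v m"
    "M *\<^sub>v t = 0\<^sub>v a" "M' *\<^sub>v t = 0\<^sub>v b" by blast
  then show ?thesis using that[of t] M(2,4)[of t] by simp
qed

lemma smult_mult_mat_vec:
  assumes "v \<in> carrier_vec n"
  shows "(c \<cdot>\<^sub>m 1\<^sub>m n) *\<^sub>v v = c \<cdot>\<^sub>v (v :: complex Matrix.vec)"
  using assms by (intro eq_vecI) auto

lemma mult_uminus_mat_vec:
  fixes A :: "complex mat"
  assumes "v \<in> carrier_vec (dim_col A)"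
  shows "A *\<^sub>v (- v) = - (A *\<^sub>v v)"
  using assms by (intro eq_vecI) auto

text \<open>The form of the Hermitian dilation of \<open>X\<close>, with \<open>X\<close> and its
  adjoint as off-diagonal blocks, shifted by z. The unshifted matrix has plus and minus the singular
  values as eigenvalues.\<close>

definition block_form :: "real \<Rightarrow> complex mat \<Rightarrow> complex Matrix.vec \<Rightarrow> complex Matrix.vec \<Rightarrow> real" where
  "block_form z X w v = 2 * rip w (mat_adjoint X *\<^sub>v v) - z * rip w w - z * rip v v"

text \<open>Completing the square in w. With \<open>block_form_eq\<close> it identifies the maximum
  over w, whose sign compares |X^* v| with z |v|.\<close>

lemma block_form_le:
  assumes "X \<in> carrier_mat n n" "w \<in> carrier_vec n" "v \<in> carrier_vec n" "z > 0"
  shows "block_form z X w v \<le> (rip (mat_adjoint X *\<^sub>v v) (mat_adjoint X *\<^sub>v v) - z\<^sup>2 * rip v v) / z"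
proof -
  define y where "y = mat_adjoint X *\<^sub>v v"
  have y: "y \<in> carrier_vec n" using assms(1) by (simp add: y_def)
  have zw: "complex_of_real z \<cdot>\<^sub>v w \<in> carrier_vec n" using assms by simp
  have "0 \<le> rip (y - complex_of_real z \<cdot>\<^sub>v w) (y - complex_of_real z \<cdot>\<^sub>v w)" by simp
  also have "\<dots> = rip y y - 2 * z * rip w y + z\<^sup>2 * rip w w"
    using y zw assms(2) rip_comm[OF y assms(2)]
    by (simp add: rip_minus[of _ n] rip_smult[of _ n] power2_eq_square algebra_simps)
  finally have "z * (2 * rip w y - z * rip w w) \<le> rip y y" by (simp add: power2_eq_square algebra_simps)
  then show ?thesis using assms(4) unfolding block_form_def y_def[symmetric]
    by (simp add: field_simps power2_eq_square)
qed

lemma block_form_eq: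
  assumes "X \<in> carrier_mat n n" "v \<in> carrier_vec n" "z > 0"
  shows "block_form z X (complex_of_real (1 / z) \<cdot>\<^sub>v (mat_adjoint X *\<^sub>v v)) v
    = (rip (mat_adjoint X *\<^sub>v v) (mat_adjoint X *\<^sub>v v) - z\<^sup>2 * rip v v) / z"
proof -
  define y where "y = mat_adjoint X *\<^sub>v v"
  have y: "y \<in> carrier_vec n" using assms(1) by (simp add: y_def)
  show ?thesis using assms(3) unfolding block_form_def y_def[symmetric]
    by (simp add: rip_smult[of _ n] y field_simps power2_eq_square del: of_real_divide)
qed

lemma adjoint_perturbation_mult:
  fixes X U V :: "complex mat" and th :: "nat \<Rightarrow> real"
  assumes X: "X \<in> carrier_mat n n" and U: "U \<in> carrier_mat n r" and V: "V \<in> carrier_mat n r" and v: "v \<in> carrier_vec n"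
  defines "Th \<equiv> diagonal r (\<lambda>i. complex_of_real (th i))"
  shows "mat_adjoint (X + U * Th * mat_adjoint V) *\<^sub>v v = mat_adjoint X *\<^sub>v v + V *\<^sub>v (Th *\<^sub>v (mat_adjoint U *\<^sub>v v))"
proof -
  have T: "Th \<in> carrier_mat r r" "mat_adjoint Th = Th" by (auto simp: Th_def adjoint_diagonal)
  note c = X U V T(1) mat_adjoint_carrier[OF U] mat_adjoint_carrier[OF V]
  have "mat_adjoint (U * Th * mat_adjoint V) = mat_adjoint (mat_adjoint V) * mat_adjoint (U * Th)"
    by (rule mat_adjoint_mult) (use c in \<open>auto intro: mult_carrier_mat\<close>)
  also have "mat_adjoint (U * Th) = Th * mat_adjoint U"
    using mat_adjoint_mult[OF U T(1)] T(2) by simp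
  finally have e: "mat_adjoint (U * Th * mat_adjoint V) = V * (Th * mat_adjoint U)" by simp
  have "mat_adjoint (X + U * Th * mat_adjoint V) = mat_adjoint X + V * (Th * mat_adjoint U)"
    unfolding e[symmetric] by (rule mat_adjoint_add) (use c in \<open>auto intro: mult_carrier_mat\<close>)
  also have "\<dots> *\<^sub>v v = mat_adjoint X *\<^sub>v v + (V * (Th * mat_adjoint U)) *\<^sub>v v"
    by (rule add_mult_distrib_mat_vec[of _ n n]) (use c v in \<open>auto intro: mult_carrier_mat\<close>)
  also have "(V * (Th * mat_adjoint U)) *\<^sub>v v = V *\<^sub>v ((Th * mat_adjoint U) *\<^sub>v v)"
    by (rule assoc_mult_mat_vec[of _ n r _ n]) (use c v in \<open>auto intro: mult_carrier_mat\<close>)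
  also have "(Th * mat_adjoint U) *\<^sub>v v = Th *\<^sub>v (mat_adjoint U *\<^sub>v v)"
    by (rule assoc_mult_mat_vec[of _ r r _ n]) (use c v in auto)
  finally show ?thesis .
qed

text \<open>One matrix at one level z, without randomness. \<open>R\<close> is the resolvent of
  \<open>X * mat_adjoint X\<close> at z^2, and \<open>th\<close> counts from 0 where the \<theta> of
  the theorem counts from 1.\<close>

locale perturbed_matrix =
  fixes n r :: nat and X U V R Y :: "complex mat" and th :: "nat \<Rightarrow> real" and z :: real
  assumes X[simp]: "X \<in> carrier_mat n n" and U[simp]: "U \<in> carrier_mat n r" and V[simp]: "V \<in> carrier_mat n r"
    and R[simp]: "R \<in> carrier_mat n n" and th: "\<And>i. i < r \<Longrightarrow> th i > 0" and z: "z > 0"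
    and Rinv: "(X * mat_adjoint X - complex_of_real (z\<^sup>2) \<cdot>\<^sub>m 1\<^sub>m n) * R = 1\<^sub>m n"
    and Rherm: "mat_adjoint R = R"
    and Y_def: "Y = X + U * diagonal r (\<lambda>i. complex_of_real (th i)) * mat_adjoint V"
begin

abbreviation "Th \<equiv> diagonal r (\<lambda>i. complex_of_real (th i))"
abbreviation "Ti \<equiv> diagonal r (\<lambda>i. 1 / complex_of_real (th i))"

lemma dims[simp]: "dim_row X = n" "dim_col X = n" "dim_row U = n" "dim_col U = r" "dim_row V = n" "dim_col V = r"
  "dim_row R = n" "dim_col R = n"
  using carrier_matD[OF X] carrier_matD[OF U] carrier_matD[OF V] carrier_matD[OF R] by auto

lemma Y[simp]: "Y \<in> carrier_mat n n" "dim_row Y = n" "dim_col Y = n" unfolding Y_def by auto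

lemma Y_adjoint_mult:
  assumes v: "v \<in> carrier_vec n"
  shows "mat_adjoint Y *\<^sub>v v = mat_adjoint X *\<^sub>v v + V *\<^sub>v (Th *\<^sub>v (mat_adjoint U *\<^sub>v v))"
  unfolding Y_def by (rule adjoint_perturbation_mult[OF X U V v])

text \<open>\<open>(w0, v0)\<close> is the critical point of the form of \<open>X\<close> with the linear terms \<open>V c1\<close> and \<open>U c2\<close>
  added (see \<open>w0_eq\<close> and \<open>v0_eq\<close>); \<open>schur_form\<close> is the critical value.\<close>

definition v0 where "v0 c1 c2 = - (R *\<^sub>v (X *\<^sub>v (V *\<^sub>v c1) + complex_of_real z \<cdot>\<^sub>v (U *\<^sub>v c2)))"
definition w0 where "w0 c1 c2 = complex_of_real (1 / z) \<cdot>\<^sub>v (mat_adjoint X *\<^sub>v v0 c1 c2 + V *\<^sub>v c1)"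

definition schur_form :: "complex Matrix.vec \<Rightarrow> complex Matrix.vec \<Rightarrow> real" where
  "schur_form c1 c2 = rip (V *\<^sub>v c1) (w0 c1 c2) + rip (U *\<^sub>v c2) (v0 c1 c2) - 2 * rip c1 (Ti *\<^sub>v c2)"

lemma v0_carrier[simp]: "v0 c1 c2 \<in> carrier_vec n"
  by (simp add: v0_def)

lemma w0_carrier[simp]: "w0 c1 c2 \<in> carrier_vec n"
  by (simp add: w0_def)

lemma w0_eq: "complex_of_real z \<cdot>\<^sub>v w0 c1 c2 = mat_adjoint X *\<^sub>v v0 c1 c2 + V *\<^sub>v c1"
  using z by (simp add: w0_def smult_smult_assoc)

text \<open>Eliminating \<open>w0\<close> from the two critical point equations leaves X X^* - z^2
  applied to \<open>v0\<close> equal to -(X V c1 + z U c2), which is how \<open>v0\<close> was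
  chosen.\<close>

lemma v0_eq: "complex_of_real z \<cdot>\<^sub>v v0 c1 c2 = X *\<^sub>v w0 c1 c2 + U *\<^sub>v c2"
proof -
  define g where "g = U *\<^sub>v c2"
  define f where "f = V *\<^sub>v c1"
  have fg[simp]: "f \<in> carrier_vec n" "g \<in> carrier_vec n" by (auto simp: f_def g_def)
  define b where "b = X *\<^sub>v f + complex_of_real z \<cdot>\<^sub>v g"
  have b[simp]: "b \<in> carrier_vec n" by (simp add: b_def)
  have "(X * mat_adjoint X - complex_of_real (z\<^sup>2) \<cdot>\<^sub>m 1\<^sub>m n) *\<^sub>v (R *\<^sub>v b) = b"
    using Rinv by (subst assoc_mult_mat_vec[symmetric, of _ n n _ n]) auto
  then have e: "X *\<^sub>v (mat_adjoint X *\<^sub>v (R *\<^sub>v b)) - complex_of_real (z\<^sup>2) \<cdot>\<^sub>v (R *\<^sub>v b) = b"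
    by (simp add: minus_mult_distrib_mat_vec[of _ n n] assoc_mult_mat_vec[of _ n n _ n] smult_mult_mat_vec)
  define y where "y = R *\<^sub>v b"
  have y: "y \<in> carrier_vec n" by (simp add: y_def)
  have dm[simp]: "dim_vec f = n" "dim_vec g = n" "dim_vec y = n" by (auto simp: f_def g_def y_def)
  have v0': "v0 c1 c2 = - y" by (simp add: v0_def b_def f_def g_def y_def)
  have Xw: "X *\<^sub>v w0 c1 c2 = complex_of_real (1 / z) \<cdot>\<^sub>v (- (X *\<^sub>v (mat_adjoint X *\<^sub>v y)) + X *\<^sub>v f)"
    unfolding w0_def v0' f_def[symmetric] using y
    by (simp add: mult_mat_vec[of _ n n] mult_add_distrib_mat_vec[of _ n n] mult_uminus_mat_vec del: of_real_divide)
  show ?thesis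
  proof (rule eq_vecI)
    fix i assume "i < dim_vec (X *\<^sub>v w0 c1 c2 + U *\<^sub>v c2)"
    then have i: "i < n" by simp
    define p q where "p = (X *\<^sub>v (mat_adjoint X *\<^sub>v y)) $ i" and "q = (X *\<^sub>v f) $ i"
    have "p - complex_of_real (z\<^sup>2) * y $ i = q + complex_of_real z * g $ i"
      using arg_cong[OF e, of "\<lambda>x. x $ i"] i fg y by (simp add: b_def y_def p_def q_def del: index_mult_mat_vec)
    moreover have "(X *\<^sub>v w0 c1 c2 + U *\<^sub>v c2) $ i = complex_of_real (1 / z) * (- p + q) + g $ i"
      unfolding Xw g_def[symmetric] using i fg y by (simp add: p_def q_def del: index_mult_mat_vec)
    moreover have "(complex_of_real z \<cdot>\<^sub>v v0 c1 c2) $ i = - complex_of_real z * y $ i"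
      unfolding v0' using i y by simp
    ultimately show "(complex_of_real z \<cdot>\<^sub>v v0 c1 c2) $ i = (X *\<^sub>v w0 c1 c2 + U *\<^sub>v c2) $ i"
      using z by (simp add: field_simps power2_eq_square)
  qed (simp add: v0' w0_def)
qed

text \<open>Stated for all \<open>w\<close>, \<open>v\<close>, \<open>c1\<close>, \<open>c2\<close>: the correction on the left vanishes when \<open>c1\<close>, \<open>c2\<close> are the
  weighted coordinates of \<open>v\<close>, \<open>w\<close> along \<open>U\<close>, \<open>V\<close> and has a sign when the deviations are opposite.\<close>

lemma form_identity:
  assumes w: "w \<in> carrier_vec n" and v: "v \<in> carrier_vec n" and c1: "c1 \<in> carrier_vec r" and c2: "c2 \<in> carrier_vec r"
  shows "block_form z Y w v - 2 * rip (c1 - Th *\<^sub>v (mat_adjoint U *\<^sub>v v)) (Ti *\<^sub>v (c2 - Th *\<^sub>v (mat_adjoint V *\<^sub>v w)))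
     = block_form z X (w - w0 c1 c2) (v - v0 c1 c2) + schur_form c1 c2"
proof -
  define a b where "a = mat_adjoint U *\<^sub>v v" and "b = mat_adjoint V *\<^sub>v w"
  define f g where "f = V *\<^sub>v c1" and "g = U *\<^sub>v c2"
  define p q where "p = w0 c1 c2" and "q = v0 c1 c2"
  have car[simp]: "a \<in> carrier_vec r" "b \<in> carrier_vec r" "f \<in> carrier_vec n" "g \<in> carrier_vec n"
    "p \<in> carrier_vec n" "q \<in> carrier_vec n" by (auto simp: a_def b_def f_def g_def p_def q_def)
  note [simp] = w v c1 c2
  have TiTh: "Ti *\<^sub>v (Th *\<^sub>v x) = x" if "x \<in> carrier_vec r" for x
    using that th by (intro eq_vecI) (auto simp: diagonal_mult_vec less_imp_neq[OF th, symmetric])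
  have Tsym: "rip (Th *\<^sub>v x) y = rip x (Th *\<^sub>v y)" if "x \<in> carrier_vec r" "y \<in> carrier_vec r" for x y
    using that by (subst rip_adjoint[of _ r r]) (auto simp: adjoint_diagonal)
  have ThTi: "Th *\<^sub>v (Ti *\<^sub>v x) = x" if "x \<in> carrier_vec r" for x
    using that th by (intro eq_vecI) (auto simp: diagonal_mult_vec less_imp_neq[OF th, symmetric])
  have Ti_sub: "Ti *\<^sub>v (c2 - Th *\<^sub>v b) = Ti *\<^sub>v c2 - b"
    by (subst mult_minus_distrib_mat_vec[of _ r r]) (auto simp: TiTh)
  \<comment> \<open>The term \<open>rip a (Th *\<^sub>v b)\<close> is also what the perturbation
    adds to the form of \<open>Y\<close> in \<open>L2\<close>. The two cancel, and terms linear in w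
    and v remain.\<close>
  have L1: "rip (c1 - Th *\<^sub>v a) (Ti *\<^sub>v (c2 - Th *\<^sub>v b))
     = rip c1 (Ti *\<^sub>v c2) - rip c1 b - rip a c2 + rip a (Th *\<^sub>v b)"
    unfolding Ti_sub by (simp add: rip_minus[of _ r] Tsym ThTi)
  have L2: "rip w (mat_adjoint Y *\<^sub>v v) = rip w (mat_adjoint X *\<^sub>v v) + rip a (Th *\<^sub>v b)"
  proof -
    have "rip w (V *\<^sub>v (Th *\<^sub>v a)) = rip (V *\<^sub>v (Th *\<^sub>v a)) w" by (rule rip_comm[of _ n]) auto
    also have "\<dots> = rip (Th *\<^sub>v a) b" unfolding b_def by (rule rip_adjoint[of _ n r]) auto
    also have "\<dots> = rip a (Th *\<^sub>v b)" by (simp add: Tsym)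
    finally show ?thesis unfolding Y_adjoint_mult[OF v] a_def[symmetric] by (simp add: rip_add[of _ n])
  qed
  have L3: "rip c1 b = rip f w" "rip a c2 = rip g v"
  proof -
    show "rip c1 b = rip f w" unfolding f_def b_def by (rule rip_adjoint[of _ n r, symmetric]) auto
    have "rip c2 a = rip g v" unfolding g_def a_def by (rule rip_adjoint[of _ n r, symmetric]) auto
    then show "rip a c2 = rip g v" using rip_comm[of a r c2] by simp
  qed
  have pe: "z * rip p x = rip (mat_adjoint X *\<^sub>v q) x + rip f x" if "x \<in> carrier_vec n" for x
  proof -
    have "z * rip p x = rip (complex_of_real z \<cdot>\<^sub>v p) x" using that by (simp add: rip_smult[of _ n])
    also have "\<dots> = rip (mat_adjoint X *\<^sub>v q) x + rip f x"
      unfolding p_def w0_eq q_def f_def using that by (simp add: rip_add[of _ n])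
    finally show ?thesis .
  qed
  have qe: "z * rip q x = rip (X *\<^sub>v p) x + rip g x" if "x \<in> carrier_vec n" for x
  proof -
    have "z * rip q x = rip (complex_of_real z \<cdot>\<^sub>v q) x" using that by (simp add: rip_smult[of _ n])
    also have "\<dots> = rip (X *\<^sub>v p) x + rip g x"
      unfolding p_def v0_eq q_def g_def using that by (simp add: rip_add[of _ n])
    finally show ?thesis .
  qed
  have adj: "rip x (mat_adjoint X *\<^sub>v y) = rip (X *\<^sub>v x) y" if "x \<in> carrier_vec n" "y \<in> carrier_vec n" for x y
    using that by (subst rip_adjoint[of _ n n]) auto
  \<comment> \<open>Expansion around (p, q); the critical point equations \<open>pe\<close> and
    \<open>qe\<close> convert its mixed terms into those linear terms.\<close>
  have bl: "block_form z X (w - p) (v - q) = block_form z X w v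
     - 2 * rip (X *\<^sub>v w) q - 2 * rip (X *\<^sub>v p) v + 2 * rip (X *\<^sub>v p) q
     + 2 * (z * rip p w) - z * rip p p + 2 * (z * rip q v) - z * rip q q"
    unfolding block_form_def
    using rip_comm[of w n p] rip_comm[of v n q]
    by (simp add: rip_minus[of _ n] mult_minus_distrib_mat_vec[of _ n n] adj algebra_simps)
  have c: "rip (mat_adjoint X *\<^sub>v q) w = rip (X *\<^sub>v w) q" "rip (mat_adjoint X *\<^sub>v q) p = rip (X *\<^sub>v p) q"
    using rip_comm[of "mat_adjoint X *\<^sub>v q" n w] rip_comm[of "mat_adjoint X *\<^sub>v q" n p] by (auto simp: adj)
  have S: "schur_form c1 c2 = rip f p + rip g q - 2 * rip c1 (Ti *\<^sub>v c2)"
    by (simp add: schur_form_def f_def g_def p_def q_def)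
  have "block_form z Y w v = block_form z X w v + 2 * rip a (Th *\<^sub>v b)"
    unfolding block_form_def L2 by simp
  then show ?thesis
    unfolding a_def[symmetric] b_def[symmetric] L1 p_def[symmetric] q_def[symmetric] bl S
    using pe[of w] pe[of p] qe[of v] qe[of q] by (simp add: c L3)
qed

end

section \<open>Singular values of the perturbed matrix from signs of the Schur form\<close>

lemma mult_mat_zero_vec: "A \<in> carrier_mat a b \<Longrightarrow> A *\<^sub>v 0\<^sub>v b = (0\<^sub>v a :: complex Matrix.vec)"
  by (intro eq_vecI) auto

context perturbed_matrix
begin

lemma w0_dim[simp]: "dim_vec (w0 c1 c2) = n"
  by (simp add: w0_def)

lemma rip_Ti_nonneg:
  assumes g: "g \<in> carrier_vec r"
  shows "rip g (Ti *\<^sub>v g) \<ge> 0"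
proof -
  have "rip g (Ti *\<^sub>v g) = (\<Sum>i<r. Re (g $ i * cnj (1 / complex_of_real (th i) * g $ i)))"
    using g by (subst rip_sum[of _ r]) (auto simp: diagonal_mult_vec)
  also have "\<dots> = (\<Sum>i<r. ((cmod (g $ i))\<^sup>2 / th i))"
  proof (rule sum.cong[OF refl])
    fix i
    have "g $ i * cnj (1 / complex_of_real (th i) * g $ i) = (g $ i * cnj (g $ i)) / complex_of_real (th i)" by simp
    also have "\<dots> = complex_of_real ((cmod (g $ i))\<^sup>2 / th i)"
      by (simp only: complex_norm_square[symmetric] of_real_divide of_real_power)
    finally show "Re (g $ i * cnj (1 / complex_of_real (th i) * g $ i)) = ((cmod (g $ i))\<^sup>2 / th i)" by (simp only: Re_complex_of_real)
  qed
  also have "\<dots> \<ge> 0" using th by (intro sum_nonneg divide_nonneg_nonneg) (auto simp: less_imp_le)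
  finally show ?thesis .
qed

text \<open>If the bound failed, then among the pairs \<open>(c1, c2)\<close>, a space of dimension \<open>r + k\<close>, the \<open>r\<close>
  conditions that the deviations be opposite and the \<open>k - 1\<close> conditions that \<open>v\<close> avoid the smallest
  singular vectors of \<open>Y\<close> would leave a nonzero solution, at which the form of \<open>Y\<close> is nonnegative.\<close>

lemma sing_val_le_of_negative:
  assumes k: "1 \<le> k" "k \<le> r" "k \<le> n"
    and neg: "\<And>c1 c2. c1 \<in> carrier_vec r \<Longrightarrow> c2 \<in> carrier_vec r \<Longrightarrow> (\<And>i. k \<le> i \<Longrightarrow> i < r \<Longrightarrow> c1 $ i = c2 $ i) \<Longrightarrow>
       \<not> (c1 = 0\<^sub>v r \<and> c2 = 0\<^sub>v r) \<Longrightarrow> schur_form c1 c2 < 0"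
  shows "sing_val Y (n + 1 - k) \<le> z"
proof (rule ccontr)
  assume "\<not> sing_val Y (n + 1 - k) \<le> z"
  then have sz: "sing_val Y (n + 1 - k) > z" by simp
  from singular_vector_bounds[OF Y(1)] obtain W where W: "W \<in> carrier_mat n n"
    and low: "\<And>v m. v \<in> carrier_vec n \<Longrightarrow> 1 \<le> m \<Longrightarrow> m \<le> n \<Longrightarrow> (\<And>i. m \<le> i \<Longrightarrow> i < n \<Longrightarrow> (mat_adjoint W *\<^sub>v v) $ i = 0) \<Longrightarrow>
       (sing_val Y m)\<^sup>2 * rip v v \<le> rip (mat_adjoint Y *\<^sub>v v) (mat_adjoint Y *\<^sub>v v)" by metis
  \<comment> \<open>Coordinates for the pairs that agree from index k on: the first r entries of t
    are \<open>c1\<close>, and the last k replace the first k entries in \<open>c2\<close>.\<close>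
  define P1 where "P1 = Matrix.mat r (r + k) (\<lambda>(i, j). if j = i then 1 else (0::complex))"
  define P2 where "P2 = Matrix.mat r (r + k) (\<lambda>(i, j). if j = (if i < k then r + i else i) then 1 else (0::complex))"
  have P[simp]: "P1 \<in> carrier_mat r (r + k)" "P2 \<in> carrier_mat r (r + k)" by (auto simp: P1_def P2_def)
  have P1t: "(P1 *\<^sub>v t) $ i = t $ i" if "t \<in> carrier_vec (r + k)" "i < r" for t i
    using that by (simp add: P1_def scalar_prod_def if_distrib[where f="\<lambda>x. x * _"] cong: if_cong)
  have P2t: "(P2 *\<^sub>v t) $ i = t $ (if i < k then r + i else i)" if "t \<in> carrier_vec (r + k)" "i < r" for t i
    using that by (simp add: P2_def scalar_prod_def if_distrib[where f="\<lambda>x. x * _"] cong: if_cong)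
  define vt where "vt = (\<lambda>t. v0 (P1 *\<^sub>v t) (P2 *\<^sub>v t))"
  \<comment> \<open>The best w for \<open>Y\<close> at the given v, so that
    \<open>block_form_eq\<close> evaluates the form of \<open>Y\<close>.\<close>
  define wt where "wt = (\<lambda>t. complex_of_real (1 / z) \<cdot>\<^sub>v (mat_adjoint Y *\<^sub>v vt t))"
  \<comment> \<open>Its kernel consists of the t with opposite deviations, which makes the pairing
    in \<open>form_identity\<close> nonpositive.\<close>
  define L where "L = (\<lambda>t. (P1 *\<^sub>v t - Th *\<^sub>v (mat_adjoint U *\<^sub>v vt t)) + (P2 *\<^sub>v t - Th *\<^sub>v (mat_adjoint V *\<^sub>v wt t)))"
  \<comment> \<open>The conjugated singular vectors of \<open>Y\<close> for its k - 1 smallest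
    singular values, as rows.\<close>
  define B where "B = Matrix.mat (k - 1) n (\<lambda>(i, j). mat_adjoint W $$ (n + 1 - k + i, j))"
  have lin: "linear_vec_map (r + k) n vt"
    unfolding vt_def v0_def
    by (rule linear_vec_map_intros linear_vec_map_comp[of _ _ n] linear_vec_map_comp[of _ _ r] X U V R P)+
  have lin2: "linear_vec_map (r + k) n wt"
    unfolding wt_def by (rule linear_vec_map_smult linear_vec_map_comp[of _ _ n] mat_adjoint_carrier Y lin)+
  have linL: "linear_vec_map (r + k) r L"
    unfolding L_def by (intro linear_vec_map_add linear_vec_map_minus linear_vec_map_mat P
        linear_vec_map_comp[OF diagonal_carrier] linear_vec_map_comp[OF mat_adjoint_carrier[OF U]]
        linear_vec_map_comp[OF mat_adjoint_carrier[OF V]] lin lin2)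
  have linB: "linear_vec_map (r + k) (k - 1) (\<lambda>t. B *\<^sub>v vt t)"
    by (intro linear_vec_map_comp[of _ _ n] lin) (simp add: B_def)
  obtain t where t: "t \<in> carrier_vec (r + k)" "t \<noteq> 0\<^sub>v (r + k)" "L t = 0\<^sub>v r" "B *\<^sub>v vt t = 0\<^sub>v (k - 1)"
    using linear_vec_map_common_kernel[OF linL linB] k by auto
  define c1 c2 where "c1 = P1 *\<^sub>v t" and "c2 = P2 *\<^sub>v t"
  define v w where "v = vt t" and "w = wt t"
  have car[simp]: "c1 \<in> carrier_vec r" "c2 \<in> carrier_vec r" "v \<in> carrier_vec n" "w \<in> carrier_vec n"
    by (auto simp: c1_def c2_def v_def w_def vt_def wt_def P1_def P2_def)
  have vv0: "v = v0 c1 c2" by (simp add: v_def vt_def c1_def c2_def)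
  define a b where "a = Th *\<^sub>v (mat_adjoint U *\<^sub>v v)" and "b = Th *\<^sub>v (mat_adjoint V *\<^sub>v w)"
  have ab[simp]: "a \<in> carrier_vec r" "b \<in> carrier_vec r" by (auto simp: a_def b_def)
  have abd[simp]: "dim_vec a = r" "dim_vec b = r" "dim_vec c1 = r" "dim_vec c2 = r"
    using car ab by (auto simp del: car ab)
  have nz: "\<not> (c1 = 0\<^sub>v r \<and> c2 = 0\<^sub>v r)"
  proof
    assume c0: "c1 = 0\<^sub>v r \<and> c2 = 0\<^sub>v r"
    have "t $ i = 0" if i: "i < r + k" for i
    proof (cases "i < r")
      case True
      then show ?thesis using P1t[OF t(1) True] c0 by (simp add: c1_def)
    next
      case False
      then have "i - r < r" "i - r < k" using i k by auto
      then show ?thesis using P2t[OF t(1), of "i - r"] c0 False by (simp add: c2_def)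
    qed
    then have "t = 0\<^sub>v (r + k)" using t(1) by (intro eq_vecI) auto
    then show False using t(2) by simp
  qed
  have F: "schur_form c1 c2 < 0"
    by (rule neg[OF car(1,2) _ nz]) (use P1t[OF t(1)] P2t[OF t(1)] in \<open>simp add: c1_def c2_def\<close>)
  have ga: "c2 - b = - (c1 - a)"
  proof (rule eq_vecI)
    fix i assume "i < dim_vec (- (c1 - a))"
    then have i: "i < r" by simp
    have "(c1 - a) + (c2 - b) = 0\<^sub>v r" using t(3) by (simp add: L_def c1_def c2_def a_def b_def v_def w_def)
    then have "((c1 - a) + (c2 - b)) $ i = 0\<^sub>v r $ i" by (rule arg_cong)
    then have "(c1 $ i - a $ i) + (c2 $ i - b $ i) = 0" using i by simp
    then have "c2 $ i - b $ i = - (c1 $ i - a $ i)" by (metis add.commute add_eq_0_iff)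
    then show "(c2 - b) $ i = (- (c1 - a)) $ i" using i by simp
  qed simp
  have "rip (c1 - a) (Ti *\<^sub>v (c2 - b)) = - rip (c1 - a) (Ti *\<^sub>v (c1 - a))"
    unfolding ga by (subst mult_uminus_mat_vec) (auto simp: rip_uminus[of _ r])
  then have le0: "rip (c1 - a) (Ti *\<^sub>v (c2 - b)) \<le> 0" using rip_Ti_nonneg[of "c1 - a"] by simp
  have "0 \<le> block_form z Y w v"
  proof -
    have "(sing_val Y (n + 1 - k))\<^sup>2 * rip v v \<le> rip (mat_adjoint Y *\<^sub>v v) (mat_adjoint Y *\<^sub>v v)"
    proof (rule low[OF car(3)])
      fix i assume i: "n + 1 - k \<le> i" "i < n"
      define j where "j = i - (n + 1 - k)"
      have j: "j < k - 1" "i = n + 1 - k + j" using i k by (auto simp: j_def)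
      have "Matrix.row B j = Matrix.row (mat_adjoint W) i"
        using j i carrier_matD[OF W] by (intro eq_vecI) (auto simp: B_def)
      then have "(B *\<^sub>v v) $ j = (mat_adjoint W *\<^sub>v v) $ i"
        using j i carrier_matD[OF W] by (simp add: B_def)
      then show "(mat_adjoint W *\<^sub>v v) $ i = 0" using t(4) j by (simp add: v_def)
    qed (use k in auto)
    moreover have "z\<^sup>2 * rip v v \<le> (sing_val Y (n + 1 - k))\<^sup>2 * rip v v"
      using sz z by (intro mult_right_mono power_mono) auto
    ultimately show ?thesis unfolding w_def wt_def v_def[symmetric]
      using block_form_eq[OF Y(1) car(3) z] z by simp
  qed
  \<comment> \<open>As v = v0, only -z |w - w0|^2 is left.\<close>
  moreover have "block_form z X (w - w0 c1 c2) (v - v0 c1 c2) \<le> 0"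
  proof -
    have "mat_adjoint X *\<^sub>v (v - v0 c1 c2) = 0\<^sub>v n" "v - v0 c1 c2 = 0\<^sub>v n"
      using carrier_vecD[OF car(3)] unfolding vv0[symmetric] by (auto intro!: eq_vecI simp: scalar_prod_def)
    moreover have "rip x (0\<^sub>v n) = 0" for x by (simp add: rip_sum[of _ n])
    ultimately show ?thesis unfolding block_form_def using z by simp
  qed
  ultimately show False
    using form_identity[OF car(4,3,1,2)] F le0 unfolding a_def[symmetric] b_def[symmetric] by simp
qed

text \<open>Mirror image of \<open>sing_val_le_of_negative\<close>. If the bound failed, let v range
  over the span of the last k + 1 singular vectors of \<open>Y\<close>, where the form of
  \<open>Y\<close> is nonpositive for every w, and c over the last r - k coordinates: r + 1
  parameters. The r conditions that the deviations at (c, -c) be equal leave a nonzero solution.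
  There the form of \<open>X\<close>, at its best w, and \<open>schur_form\<close> are both
  nonnegative, and equality forces the solution to vanish.\<close>

lemma sing_val_gt_of_positive:
  assumes k: "k \<le> r" "k + 1 \<le> n"
    and X_gt: "\<And>x. x \<in> carrier_vec n \<Longrightarrow> x \<noteq> 0\<^sub>v n \<Longrightarrow> z\<^sup>2 * rip x x < rip (mat_adjoint X *\<^sub>v x) (mat_adjoint X *\<^sub>v x)"
    and pos: "\<And>c. c \<in> carrier_vec r \<Longrightarrow> (\<And>i. i < k \<Longrightarrow> c $ i = 0) \<Longrightarrow> c \<noteq> 0\<^sub>v r \<Longrightarrow> schur_form c (- c) > 0"
  shows "sing_val Y (n - k) > z"
proof (rule ccontr)
  assume "\<not> sing_val Y (n - k) > z"
  then have sz: "sing_val Y (n - k) \<le> z" by simp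
  from singular_vector_bounds[OF Y(1)] obtain W where W: "W \<in> carrier_mat n n" "mat_adjoint W * W = 1\<^sub>m n"
    and up: "\<And>v m. v \<in> carrier_vec n \<Longrightarrow> m < n \<Longrightarrow> (\<And>i. i < m \<Longrightarrow> (mat_adjoint W *\<^sub>v v) $ i = 0) \<Longrightarrow>
       rip (mat_adjoint Y *\<^sub>v v) (mat_adjoint Y *\<^sub>v v) \<le> (sing_val Y (Suc m))\<^sup>2 * rip v v" by metis
  define m where "m = n - (k + 1)"
  have m: "m < n" "m + (k + 1) = n" "Suc m = n - k" using k by (auto simp: m_def)
  \<comment> \<open>The first k + 1 entries of t are the coordinates of v along the last k + 1
    singular vectors.\<close>
  define E where "E = Matrix.mat n (r + 1) (\<lambda>(i, j). if i = m + j \<and> j < k + 1 then 1 else (0::complex))"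
  \<comment> \<open>The other r - k entries of t fill the positions from k on in c, hence the shift
    by one.\<close>
  define P where "P = Matrix.mat r (r + 1) (\<lambda>(i, j). if j = i + 1 \<and> k \<le> i then 1 else (0::complex))"
  have EP[simp]: "E \<in> carrier_mat n (r + 1)" "P \<in> carrier_mat r (r + 1)" by (auto simp: E_def P_def)
  have Et: "(E *\<^sub>v t) $ i = (if m \<le> i then t $ (i - m) else 0)" if t: "t \<in> carrier_vec (r + 1)" "i < n" for t i
  proof -
    have "(E *\<^sub>v t) $ i = (\<Sum>j = 0..<r + 1. (if i = m + j \<and> j < k + 1 then 1 else 0) * t $ j)"
      using t by (simp add: E_def scalar_prod_def)
    also have "\<dots> = (\<Sum>j = 0..<r + 1. if j = i - m then (if m \<le> i then t $ j else 0) else 0)"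
      using t(2) m by (intro sum.cong) auto
    also have "\<dots> = (if m \<le> i then t $ (i - m) else 0)" using t(2) m k by (subst sum.delta) auto
    finally show ?thesis .
  qed
  have Pt: "(P *\<^sub>v t) $ i = (if k \<le> i then t $ (i + 1) else 0)" if t: "t \<in> carrier_vec (r + 1)" "i < r" for t i
  proof -
    have "(P *\<^sub>v t) $ i = (\<Sum>j = 0..<r + 1. (if j = i + 1 \<and> k \<le> i then 1 else 0) * t $ j)"
      using t by (simp add: P_def scalar_prod_def)
    also have "\<dots> = (\<Sum>j = 0..<r + 1. if j = i + 1 then (if k \<le> i then t $ j else 0) else 0)"
      by (intro sum.cong) auto
    also have "\<dots> = (if k \<le> i then t $ (i + 1) else 0)" using t(2) by (subst sum.delta) auto
    finally show ?thesis .
  qed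
  define vt where "vt = (\<lambda>t. W *\<^sub>v (E *\<^sub>v t))"
  define xt where "xt = (\<lambda>t. vt t - v0 (P *\<^sub>v t) (- (P *\<^sub>v t)))"
  \<comment> \<open>Relative to the critical point, this w is the maximizer for \<open>X\<close>
    rather than for \<open>Y\<close>.\<close>
  define wt where "wt = (\<lambda>t. w0 (P *\<^sub>v t) (- (P *\<^sub>v t)) + complex_of_real (1 / z) \<cdot>\<^sub>v (mat_adjoint X *\<^sub>v xt t))"
  define L where "L = (\<lambda>t. (P *\<^sub>v t - Th *\<^sub>v (mat_adjoint U *\<^sub>v vt t)) - (- (P *\<^sub>v t) - Th *\<^sub>v (mat_adjoint V *\<^sub>v wt t)))"
  have linv: "linear_vec_map (r + 1) n vt"
    unfolding vt_def by (intro linear_vec_map_comp[OF W(1)] linear_vec_map_mat EP)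
  note li = linear_vec_map_add linear_vec_map_minus linear_vec_map_uminus linear_vec_map_smult
    linear_vec_map_comp[OF X] linear_vec_map_comp[OF R] linear_vec_map_comp[OF U] linear_vec_map_comp[OF V]
    linear_vec_map_comp[OF diagonal_carrier] linear_vec_map_comp[OF mat_adjoint_carrier[OF U]]
    linear_vec_map_comp[OF mat_adjoint_carrier[OF V]] linear_vec_map_comp[OF mat_adjoint_carrier[OF X]]
    linear_vec_map_mat EP linv
  have lin0: "linear_vec_map (r + 1) n (\<lambda>t. v0 (P *\<^sub>v t) (- (P *\<^sub>v t)))"
    unfolding v0_def by (intro li)
  have linx: "linear_vec_map (r + 1) n xt" unfolding xt_def by (intro li lin0)
  have linw: "linear_vec_map (r + 1) n wt"
    unfolding wt_def w0_def by (intro li lin0 linx)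
  have linL: "linear_vec_map (r + 1) r L" unfolding L_def by (intro li linw)
  \<comment> \<open>A condition with no rows: only the r equations \<open>L t = 0\<close> constrain
    the r + 1 parameters.\<close>
  have lin00: "linear_vec_map (r + 1) 0 (\<lambda>t. 0\<^sub>m 0 (r + 1) *\<^sub>v t)" by (intro linear_vec_map_mat) simp
  obtain t where t: "t \<in> carrier_vec (r + 1)" "t \<noteq> 0\<^sub>v (r + 1)" "L t = 0\<^sub>v r"
    using linear_vec_map_common_kernel[OF linL lin00] by auto
  define c where "c = P *\<^sub>v t"
  define v w x where "v = vt t" and "w = wt t" and "x = xt t"
  have car[simp]: "c \<in> carrier_vec r" "- c \<in> carrier_vec r" "v \<in> carrier_vec n" "x \<in> carrier_vec n" "w \<in> carrier_vec n"
    using W(1) by (auto simp: c_def v_def w_def x_def vt_def wt_def xt_def P_def)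
  have x: "x = v - v0 c (- c)" by (simp add: x_def xt_def v_def c_def)
  have w: "w = w0 c (- c) + complex_of_real (1 / z) \<cdot>\<^sub>v (mat_adjoint X *\<^sub>v x)" by (simp add: w_def wt_def x_def c_def)
  have ww: "w - w0 c (- c) = complex_of_real (1 / z) \<cdot>\<^sub>v (mat_adjoint X *\<^sub>v x)"
    unfolding w by (intro eq_vecI) (auto simp del: of_real_divide index_mult_mat_vec)
  define a b where "a = Th *\<^sub>v (mat_adjoint U *\<^sub>v v)" and "b = Th *\<^sub>v (mat_adjoint V *\<^sub>v w)"
  have ab[simp]: "a \<in> carrier_vec r" "b \<in> carrier_vec r" by (auto simp: a_def b_def)
  have abd[simp]: "dim_vec a = r" "dim_vec b = r" "dim_vec c = r"
    using car ab by (auto simp del: car ab)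
  have ga: "- c - b = c - a"
  proof (rule eq_vecI)
    fix i assume "i < dim_vec (c - a)"
    then have i: "i < r" by simp
    have "(c - a) - (- c - b) = 0\<^sub>v r" using t(3) by (simp add: L_def c_def a_def b_def v_def w_def)
    then have "((c - a) - (- c - b)) $ i = 0\<^sub>v r $ i" by (rule arg_cong)
    then have "(c $ i - a $ i) - (- c $ i - b $ i) = 0" using i by simp
    then have "- c $ i - b $ i = c $ i - a $ i" by (metis right_minus_eq)
    then show "(- c - b) $ i = (c - a) $ i" using i by simp
  qed simp
  have ge0: "rip (c - a) (Ti *\<^sub>v (- c - b)) \<ge> 0" unfolding ga using rip_Ti_nonneg[of "c - a"] by simp
  have Wv: "mat_adjoint W *\<^sub>v v = E *\<^sub>v t"
    unfolding v_def vt_def using W by (subst assoc_mult_mat_vec[symmetric, of _ n n _ n]) (auto simp: E_def)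
  have "block_form z Y w v \<le> 0"
  proof -
    have "rip (mat_adjoint Y *\<^sub>v v) (mat_adjoint Y *\<^sub>v v) \<le> (sing_val Y (Suc m))\<^sup>2 * rip v v"
      by (rule up[OF car(3) m(1)]) (use Et[OF t(1)] m Wv in auto)
    also have "\<dots> \<le> z\<^sup>2 * rip v v"
      using sz sing_val_nonneg[OF Y(1), of "Suc m"] m by (intro mult_right_mono power_mono) auto
    finally have "(rip (mat_adjoint Y *\<^sub>v v) (mat_adjoint Y *\<^sub>v v) - z\<^sup>2 * rip v v) / z \<le> 0"
      using z by (simp add: divide_le_0_iff)
    then show ?thesis using block_form_le[OF Y(1) car(5,3) z] by linarith
  qed
  then have id: "block_form z X (w - w0 c (- c)) x + schur_form c (- c) \<le> 0"
    using form_identity[OF car(5,3,1,2)] ge0 unfolding x a_def[symmetric] b_def[symmetric] by linarith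
  have bf: "block_form z X (w - w0 c (- c)) x = (rip (mat_adjoint X *\<^sub>v x) (mat_adjoint X *\<^sub>v x) - z\<^sup>2 * rip x x) / z"
    unfolding ww by (rule block_form_eq[OF X car(4) z])
  have rz: "rip y (0\<^sub>v l) = 0" for y l by (simp add: rip_sum[of _ l])
  have bf_pos: "block_form z X (w - w0 c (- c)) x > 0" if "x \<noteq> 0\<^sub>v n"
    unfolding bf using X_gt[OF car(4) that] z by simp
  have bf_nn: "block_form z X (w - w0 c (- c)) x \<ge> 0"
  proof (cases "x = 0\<^sub>v n")
    case True
    moreover have "mat_adjoint X *\<^sub>v 0\<^sub>v n = 0\<^sub>v n" by (intro eq_vecI) (auto simp: scalar_prod_def)
    ultimately show ?thesis unfolding bf by (simp add: rz)
  qed (use bf_pos in force)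
  \<comment> \<open>Nonnegativity of the form of \<open>X\<close> forces c = 0. Then
    \<open>schur_form\<close> and \<open>v0\<close> vanish, and strict positivity of the form of
    \<open>X\<close> forces v = 0.\<close>
  have "c = 0\<^sub>v r"
  proof (rule ccontr)
    assume "c \<noteq> 0\<^sub>v r"
    then have "schur_form c (- c) > 0"
      by (intro pos[OF car(1)]) (use Pt[OF t(1)] k in \<open>auto simp: c_def\<close>)
    then show False using id bf_nn by simp
  qed
  have UV0: "U *\<^sub>v c = 0\<^sub>v n" "V *\<^sub>v c = 0\<^sub>v n" "U *\<^sub>v (- c) = 0\<^sub>v n" "Ti *\<^sub>v (- c) = 0\<^sub>v r"
    unfolding \<open>c = 0\<^sub>v r\<close> by (auto intro!: eq_vecI simp: scalar_prod_def)
  have v00: "v0 c (- c) = 0\<^sub>v n"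
    unfolding v0_def UV0 by (auto intro!: eq_vecI simp: scalar_prod_def)
  have "schur_form c (- c) = 0"
    unfolding schur_form_def UV0 v00 using rip_comm[of "0\<^sub>v n" n "w0 c (- c)"] by (simp add: rz)
  then have "x = 0\<^sub>v n" using id bf_pos by force
  then have "v = 0\<^sub>v n" using x v00 car(3) by (metis minus_zero_vec)
  then have "E *\<^sub>v t = 0\<^sub>v n" using Wv mult_mat_zero_vec[OF mat_adjoint_carrier[OF W(1)]] by simp
  have "t $ i = 0" if "i < r + 1" for i
  proof (cases "i < k + 1")
    case True
    then have "(E *\<^sub>v t) $ (m + i) = t $ i" using Et[OF t(1), of "m + i"] m by simp
    moreover have "(E *\<^sub>v t) $ (m + i) = 0" using \<open>E *\<^sub>v t = 0\<^sub>v n\<close> True m by simp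
    ultimately show ?thesis by simp
  next
    case False
    then have "(P *\<^sub>v t) $ (i - 1) = t $ i" using Pt[OF t(1), of "i - 1"] that by simp
    moreover have "(P *\<^sub>v t) $ (i - 1) = 0" using \<open>c = 0\<^sub>v r\<close> that False unfolding c_def by simp
    ultimately show ?thesis by simp
  qed
  then have "t = 0\<^sub>v (r + 1)" using t(1) by (intro eq_vecI) auto
  then show False using t(2) by simp
qed

end

text \<open>In the span of the last i + r singular vectors of \<open>X\<close>, the r equations in
  \<open>U\<close> and orthogonality to the last i - 1 singular vectors of \<open>Y\<close> leave a
  nonzero v. Both adjoints agree on it, and its image is compared with both singular values.\<close>

lemma sing_val_rank_perturbation:
  assumes X: "X \<in> carrier_mat n n" and Y: "Y \<in> carrier_mat n n" and U: "U \<in> carrier_mat n r"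
    and eq: "\<And>v. v \<in> carrier_vec n \<Longrightarrow> mat_adjoint U *\<^sub>v v = 0\<^sub>v r \<Longrightarrow> mat_adjoint Y *\<^sub>v v = mat_adjoint X *\<^sub>v v"
    and i: "1 \<le> i" "i + r \<le> n"
  shows "sing_val Y (n + 1 - i) \<le> sing_val X (n + 1 - i - r)"
proof (rule ccontr)
  assume "\<not> ?thesis"
  then have lt: "sing_val X (n + 1 - i - r) < sing_val Y (n + 1 - i)" by simp
  define m where "m = n - i - r"
  have m: "m < n" "m + (i + r) = n" "n + 1 - i - r = Suc m" using i by (auto simp: m_def)
  from singular_vector_bounds[OF X] obtain W where W: "W \<in> carrier_mat n n" "mat_adjoint W * W = 1\<^sub>m n"
    and up: "\<And>v m. v \<in> carrier_vec n \<Longrightarrow> m < n \<Longrightarrow> (\<And>i. i < m \<Longrightarrow> (mat_adjoint W *\<^sub>v v) $ i = 0) \<Longrightarrow>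
       rip (mat_adjoint X *\<^sub>v v) (mat_adjoint X *\<^sub>v v) \<le> (sing_val X (Suc m))\<^sup>2 * rip v v" by metis
  from singular_vector_bounds[OF Y] obtain Z where Z: "Z \<in> carrier_mat n n"
    and low: "\<And>v m. v \<in> carrier_vec n \<Longrightarrow> 1 \<le> m \<Longrightarrow> m \<le> n \<Longrightarrow> (\<And>i. m \<le> i \<Longrightarrow> i < n \<Longrightarrow> (mat_adjoint Z *\<^sub>v v) $ i = 0) \<Longrightarrow>
       (sing_val Y m)\<^sup>2 * rip v v \<le> rip (mat_adjoint Y *\<^sub>v v) (mat_adjoint Y *\<^sub>v v)" by metis
  define E where "E = Matrix.mat n (i + r) (\<lambda>(k, j). if k = m + j then 1 else (0::complex))"
  have E: "E \<in> carrier_mat n (i + r)" by (simp add: E_def)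
  have Et: "(E *\<^sub>v t) $ l = (if m \<le> l then t $ (l - m) else 0)" if t: "t \<in> carrier_vec (i + r)" "l < n" for t l
  proof -
    have "(E *\<^sub>v t) $ l = (\<Sum>j = 0..<i + r. (if l = m + j then 1 else 0) * t $ j)"
      using t by (simp add: E_def scalar_prod_def)
    also have "\<dots> = (\<Sum>j = 0..<i + r. if j = l - m then (if m \<le> l then t $ j else 0) else 0)"
      using t(2) m by (intro sum.cong) auto
    also have "\<dots> = (if m \<le> l then t $ (l - m) else 0)" using t(2) m by (subst sum.delta) auto
    finally show ?thesis .
  qed
  define B where "B = Matrix.mat (i - 1) n (\<lambda>(k, j). mat_adjoint Z $$ (n + 1 - i + k, j))"
  define vt where "vt = (\<lambda>t. W *\<^sub>v (E *\<^sub>v t))"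
  have lin: "linear_vec_map (i + r) n vt"
    unfolding vt_def by (intro linear_vec_map_comp[OF W(1)] linear_vec_map_mat E)
  have "linear_vec_map (i + r) r (\<lambda>t. mat_adjoint U *\<^sub>v vt t)"
    by (intro linear_vec_map_comp[OF mat_adjoint_carrier[OF U]] lin)
  moreover have "linear_vec_map (i + r) (i - 1) (\<lambda>t. B *\<^sub>v vt t)"
    by (intro linear_vec_map_comp[of _ _ n] lin) (simp add: B_def)
  moreover have "r + (i - 1) < i + r" using i by simp
  ultimately obtain t where t: "t \<in> carrier_vec (i + r)" "t \<noteq> 0\<^sub>v (i + r)" "mat_adjoint U *\<^sub>v vt t = 0\<^sub>v r"
    "B *\<^sub>v vt t = 0\<^sub>v (i - 1)"
    by (rule linear_vec_map_common_kernel)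
  define v where "v = vt t"
  have v: "v \<in> carrier_vec n" using W(1) by (auto simp: v_def vt_def)
  have Wv: "mat_adjoint W *\<^sub>v v = E *\<^sub>v t"
    unfolding v_def vt_def using W t(1) E by (subst assoc_mult_mat_vec[symmetric, of _ n n _ n]) (auto simp: E_def)
  have "v \<noteq> 0\<^sub>v n"
  proof
    assume "v = 0\<^sub>v n"
    then have E0: "E *\<^sub>v t = 0\<^sub>v n" using Wv mult_mat_zero_vec[OF mat_adjoint_carrier[OF W(1)]] by simp
    have "t $ j = 0" if "j < i + r" for j
    proof -
      have "(E *\<^sub>v t) $ (m + j) = t $ j" using Et[OF t(1), of "m + j"] that m by simp
      moreover have "(E *\<^sub>v t) $ (m + j) = 0" using E0 that m by simp
      ultimately show ?thesis by simp
    qed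
    then have "t = 0\<^sub>v (i + r)" using t(1) by (intro eq_vecI) auto
    then show False using t(2) by simp
  qed
  then have vp: "rip v v > 0" using rip_self_eq_0[OF v] rip_self_nonneg[of v] by linarith
  have "(sing_val Y (n + 1 - i))\<^sup>2 * rip v v \<le> rip (mat_adjoint Y *\<^sub>v v) (mat_adjoint Y *\<^sub>v v)"
  proof (rule low[OF v])
    fix l assume l: "n + 1 - i \<le> l" "l < n"
    define j where "j = l - (n + 1 - i)"
    have j: "j < i - 1" "l = n + 1 - i + j" using l i by (auto simp: j_def)
    have "Matrix.row B j = Matrix.row (mat_adjoint Z) l"
      using j l carrier_matD[OF Z] by (intro eq_vecI) (auto simp: B_def)
    then have "(B *\<^sub>v v) $ j = (mat_adjoint Z *\<^sub>v v) $ l"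
      using j l carrier_matD[OF Z] by (simp add: B_def)
    then show "(mat_adjoint Z *\<^sub>v v) $ l = 0" using t(4) j by (simp add: v_def)
  qed (use i in auto)
  also have "mat_adjoint Y *\<^sub>v v = mat_adjoint X *\<^sub>v v" using eq[OF v] t(3) by (simp add: v_def)
  also have "rip (mat_adjoint X *\<^sub>v v) (mat_adjoint X *\<^sub>v v) \<le> (sing_val X (Suc m))\<^sup>2 * rip v v"
    by (rule up[OF v m(1)]) (use Et[OF t(1)] m Wv in auto)
  finally have "(sing_val Y (n + 1 - i))\<^sup>2 \<le> (sing_val X (Suc m))\<^sup>2" using vp by simp
  moreover have "(sing_val X (Suc m))\<^sup>2 < (sing_val Y (n + 1 - i))\<^sup>2"
    using lt sing_val_nonneg[OF X, of "Suc m"] m by (intro power_strict_mono) auto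
  ultimately show False by simp
qed

text \<open>Entry (i, j) of A^* E B, expanded so that it can be read as a quadratic form in the
  entries of \<open>A\<close> and \<open>B\<close>.\<close>

definition gram :: "nat \<Rightarrow> complex mat \<Rightarrow> complex mat \<Rightarrow> complex mat \<Rightarrow> nat \<Rightarrow> nat \<Rightarrow> complex" where
  "gram n A E B i j = (\<Sum>k<n. \<Sum>l<n. cnj (A $$ (k, i)) * E $$ (k, l) * B $$ (l, j))"

lemma cscalar_prod_gram:
  assumes "A \<in> carrier_mat n r" "B \<in> carrier_mat n r" "E \<in> carrier_mat n n" "x \<in> carrier_vec r" "y \<in> carrier_vec r"
  shows "(A *\<^sub>v x) \<bullet>c (E *\<^sub>v (B *\<^sub>v y)) = (\<Sum>i<r. \<Sum>j<r. x $ i * cnj (y $ j) * cnj (gram n A E B i j))"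
proof -
  have "(A *\<^sub>v x) \<bullet>c (E *\<^sub>v (B *\<^sub>v y))
    = (\<Sum>k<n. (\<Sum>i<r. A $$ (k, i) * x $ i) * cnj (\<Sum>l<n. E $$ (k, l) * (\<Sum>j<r. B $$ (l, j) * y $ j)))"
    using assms by (simp add: scalar_prod_def atLeast0LessThan)
  also have "\<dots> = (\<Sum>k<n. \<Sum>l<n. \<Sum>j<r. \<Sum>i<r. x $ i * cnj (y $ j) * cnj (cnj (A $$ (k, i)) * E $$ (k, l) * B $$ (l, j)))"
    by (simp add: sum_distrib_left sum_distrib_right mult_ac)
  also have "\<dots> = (\<Sum>k<n. \<Sum>l<n. \<Sum>i<r. \<Sum>j<r. x $ i * cnj (y $ j) * cnj (cnj (A $$ (k, i)) * E $$ (k, l) * B $$ (l, j)))"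
    by (rule sum.cong[OF refl], rule sum.cong[OF refl], rule sum.swap)
  also have "\<dots> = (\<Sum>k<n. \<Sum>i<r. \<Sum>l<n. \<Sum>j<r. x $ i * cnj (y $ j) * cnj (cnj (A $$ (k, i)) * E $$ (k, l) * B $$ (l, j)))"
    by (rule sum.cong[OF refl], rule sum.swap)
  also have "\<dots> = (\<Sum>i<r. \<Sum>k<n. \<Sum>l<n. \<Sum>j<r. x $ i * cnj (y $ j) * cnj (cnj (A $$ (k, i)) * E $$ (k, l) * B $$ (l, j)))"
    by (rule sum.swap)
  also have "\<dots> = (\<Sum>i<r. \<Sum>k<n. \<Sum>j<r. \<Sum>l<n. x $ i * cnj (y $ j) * cnj (cnj (A $$ (k, i)) * E $$ (k, l) * B $$ (l, j)))"
    by (rule sum.cong[OF refl], rule sum.cong[OF refl], rule sum.swap)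
  also have "\<dots> = (\<Sum>i<r. \<Sum>j<r. \<Sum>k<n. \<Sum>l<n. x $ i * cnj (y $ j) * cnj (cnj (A $$ (k, i)) * E $$ (k, l) * B $$ (l, j)))"
    by (rule sum.cong[OF refl], rule sum.swap)
  also have "\<dots> = (\<Sum>i<r. \<Sum>j<r. x $ i * cnj (y $ j) * cnj (gram n A E B i j))"
    by (simp add: gram_def sum_distrib_left)
  finally show ?thesis .
qed

text \<open>Sum |x_i| |y_j| <= (|x_i|^2 + |y_j|^2) / 2 over all pairs; each square occurs r
  times.\<close>

lemma rip_gram_close:
  assumes car: "A \<in> carrier_mat n r" "B \<in> carrier_mat n r" "E \<in> carrier_mat n n" "x \<in> carrier_vec r" "y \<in> carrier_vec r"
    and close: "\<And>i j. i < r \<Longrightarrow> j < r \<Longrightarrow> cmod (gram n A E B i j - (if i = j then complex_of_real s else 0)) \<le> \<eta>"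
  shows "\<bar>rip (A *\<^sub>v x) (E *\<^sub>v (B *\<^sub>v y)) - s * rip x y\<bar> \<le> \<eta> * real r * (rip x x + rip y y) / 2"
proof -
  define D where "D = (\<lambda>i j. gram n A E B i j - (if i = j then complex_of_real s else 0))"
  have "(\<Sum>i<r. \<Sum>j<r. x $ i * cnj (y $ j) * cnj (gram n A E B i j)) =
     (\<Sum>i<r. \<Sum>j<r. x $ i * cnj (y $ j) * cnj (D i j) + (if i = j then complex_of_real s * (x $ i * cnj (y $ i)) else 0))"
    by (intro sum.cong refl) (auto simp: D_def algebra_simps)
  also have "\<dots> = (\<Sum>i<r. \<Sum>j<r. x $ i * cnj (y $ j) * cnj (D i j)) + complex_of_real s * (x \<bullet>c y)"
    using car by (simp add: sum.distrib scalar_prod_def atLeast0LessThan sum_distrib_left)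
  finally have "rip (A *\<^sub>v x) (E *\<^sub>v (B *\<^sub>v y)) - s * rip x y = Re (\<Sum>i<r. \<Sum>j<r. x $ i * cnj (y $ j) * cnj (D i j))"
    unfolding rip_def cscalar_prod_gram[OF car] by simp
  also have "\<bar>\<dots>\<bar> \<le> cmod (\<Sum>i<r. \<Sum>j<r. x $ i * cnj (y $ j) * cnj (D i j))" by (rule abs_Re_le_cmod)
  also have "\<dots> \<le> (\<Sum>i<r. \<Sum>j<r. \<eta> * ((cmod (x $ i))\<^sup>2 + (cmod (y $ j))\<^sup>2) / 2)"
  proof (intro sum_norm_le)
    fix i j assume ij: "i \<in> {..<r}" "j \<in> {..<r}"
    then have D: "cmod (D i j) \<le> \<eta>" using close by (simp add: D_def)
    then have \<eta>: "\<eta> \<ge> 0" using norm_ge_zero order_trans by blast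
    have "2 * (cmod (x $ i) * cmod (y $ j)) \<le> (cmod (x $ i))\<^sup>2 + (cmod (y $ j))\<^sup>2"
      using sum_squares_bound[of "cmod (x $ i)" "cmod (y $ j)"] by simp
    then have "\<eta> * (2 * (cmod (x $ i) * cmod (y $ j))) \<le> \<eta> * ((cmod (x $ i))\<^sup>2 + (cmod (y $ j))\<^sup>2)"
      using \<eta> by (rule mult_left_mono)
    moreover have "cmod (D i j) * (cmod (x $ i) * cmod (y $ j)) \<le> \<eta> * (cmod (x $ i) * cmod (y $ j))"
      using D by (intro mult_right_mono) auto
    ultimately show "cmod (x $ i * cnj (y $ j) * cnj (D i j)) \<le> \<eta> * ((cmod (x $ i))\<^sup>2 + (cmod (y $ j))\<^sup>2) / 2"
      by (simp add: norm_mult mult_ac)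
  qed
  also have "\<dots> = \<eta> * real r * (rip x x + rip y y) / 2"
    unfolding rip_self[OF car(4)] rip_self[OF car(5)]
    by (simp add: sum.distrib sum_distrib_left[symmetric] sum_divide_distrib[symmetric] algebra_simps)
  finally show ?thesis .
qed

section \<open>Comparison of the Schur form with its limit\<close>

context perturbed_matrix
begin

text \<open>For each i a two-by-two block with eigenvalue 1 / th i - z m on c2 = -c1 and -1 / th i -
  z m on c2 = c1.\<close>

definition limit_form :: "real \<Rightarrow> complex Matrix.vec \<Rightarrow> complex Matrix.vec \<Rightarrow> real" where
  "limit_form m c1 c2 = - z * m * (rip c1 c1 + rip c2 c2) - 2 * rip c1 (Ti *\<^sub>v c2)"

text \<open>The value 1 + z^2 m is the limiting normalized trace of
  \<open>mat_adjoint X * R * X\<close>, because X X^* R = 1 + z^2 R. The conditional with two zeros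
  has the shape that \<open>rip_gram_close\<close> takes at s = 0.\<close>

definition forms_close :: "real \<Rightarrow> real \<Rightarrow> bool" where
  "forms_close m \<eta> \<longleftrightarrow> (\<forall>i<r. \<forall>j<r.
     cmod (gram n V (1\<^sub>m n) V i j - (if i = j then complex_of_real 1 else 0)) \<le> \<eta> \<and>
     cmod (gram n V (mat_adjoint X * R * X) V i j - (if i = j then complex_of_real (1 + z\<^sup>2 * m) else 0)) \<le> \<eta> \<and>
     cmod (gram n U (R * X) V i j - (if i = j then complex_of_real 0 else 0)) \<le> \<eta> \<and>
     cmod (gram n U R U i j - (if i = j then complex_of_real m else 0)) \<le> \<eta>)"

text \<open>After inserting \<open>v0\<close> and \<open>w0\<close>, the \<open>c1\<close> part is 1
  / z times V^* V - V^* X^* R X V, with limit (1 - 1 - z^2 m) / z = -z m, the same coefficient as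
  for \<open>c2\<close>. The constant collects the errors: two with factor 1 / z, the mixed one, and
  one with factor z.\<close>

lemma schur_form_close:
  assumes c: "c1 \<in> carrier_vec r" "c2 \<in> carrier_vec r" and cl: "forms_close m \<eta>"
  shows "\<bar>schur_form c1 c2 - limit_form m c1 c2\<bar> \<le> real r * (2 / z + 1 + z) * \<eta> * (rip c1 c1 + rip c2 c2)"
proof (cases "r = 0")
  case True
  have z0: "U *\<^sub>v c2 = 0\<^sub>v n" "V *\<^sub>v c1 = 0\<^sub>v n" using c True by (auto intro!: eq_vecI simp: scalar_prod_def)
  have "rip x y = 0" if "y \<in> carrier_vec r" for x y using that True by (simp add: rip_sum[of _ 0])
  moreover have "rip (0\<^sub>v n) y = 0" if "y \<in> carrier_vec n" for y
    using that by (simp add: rip_sum[of _ n])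
  ultimately show ?thesis unfolding schur_form_def limit_form_def z0 using c by simp
next
  case False
  define f g where "f = V *\<^sub>v c1" and "g = U *\<^sub>v c2"
  have [simp]: "f \<in> carrier_vec n" "g \<in> carrier_vec n" by (auto simp: f_def g_def)
  define Q where "Q = rip c1 c1 + rip c2 c2"
  have "0 \<le> \<eta>" using cl False norm_ge_zero order_trans unfolding forms_close_def by (metis bot_nat_0.not_eq_extremum)
  have v: "v0 c1 c2 = - (R *\<^sub>v (X *\<^sub>v f) + complex_of_real z \<cdot>\<^sub>v (R *\<^sub>v g))"
    unfolding v0_def f_def[symmetric] g_def[symmetric]
    by (simp add: mult_add_distrib_mat_vec[of _ n n] mult_mat_vec[of _ n n])
  have XRg: "rip f (mat_adjoint X *\<^sub>v (R *\<^sub>v g)) = rip g (R *\<^sub>v (X *\<^sub>v f))"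
  proof -
    have "rip f (mat_adjoint X *\<^sub>v (R *\<^sub>v g)) = rip (X *\<^sub>v f) (R *\<^sub>v g)" by (rule rip_adjoint[of _ n n, symmetric]) auto
    also have "\<dots> = rip (R *\<^sub>v (X *\<^sub>v f)) g" using Rherm by (subst rip_adjoint[of R n n]) auto
    also have "\<dots> = rip g (R *\<^sub>v (X *\<^sub>v f))" by (rule rip_comm[of _ n]) auto
    finally show ?thesis .
  qed
  have w: "w0 c1 c2 = complex_of_real (1 / z) \<cdot>\<^sub>v (- (mat_adjoint X *\<^sub>v (R *\<^sub>v (X *\<^sub>v f)) + complex_of_real z \<cdot>\<^sub>v (mat_adjoint X *\<^sub>v (R *\<^sub>v g))) + f)"
    unfolding w0_def v f_def[symmetric]
    by (subst mult_uminus_mat_vec) (auto simp: mult_add_distrib_mat_vec[of _ n n] mult_mat_vec[of _ n n])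
  have "schur_form c1 c2 = (1 / z) * (rip f f - rip f (mat_adjoint X *\<^sub>v (R *\<^sub>v (X *\<^sub>v f))))
      - 2 * rip g (R *\<^sub>v (X *\<^sub>v f)) - z * rip g (R *\<^sub>v g) - 2 * rip c1 (Ti *\<^sub>v c2)"
    unfolding schur_form_def f_def[symmetric] g_def[symmetric] w v using z
    by (simp add: rip_add[of _ n] rip_uminus[of _ n] rip_smult[of _ n] XRg field_simps del: of_real_divide)
  also have "rip f f = rip (V *\<^sub>v c1) (1\<^sub>m n *\<^sub>v (V *\<^sub>v c1))" by (simp add: f_def)
  also have "rip f (mat_adjoint X *\<^sub>v (R *\<^sub>v (X *\<^sub>v f))) = rip (V *\<^sub>v c1) ((mat_adjoint X * R * X) *\<^sub>v (V *\<^sub>v c1))"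
    by (simp add: f_def assoc_mult_mat_vec[of _ n n _ n])
  also have "rip g (R *\<^sub>v (X *\<^sub>v f)) = rip (U *\<^sub>v c2) ((R * X) *\<^sub>v (V *\<^sub>v c1))"
    by (simp add: f_def g_def assoc_mult_mat_vec[of _ n n _ n])
  also have "rip g (R *\<^sub>v g) = rip (U *\<^sub>v c2) (R *\<^sub>v (U *\<^sub>v c2))" by (simp add: g_def)
  finally have S: "schur_form c1 c2 = (1 / z) * (rip (V *\<^sub>v c1) (1\<^sub>m n *\<^sub>v (V *\<^sub>v c1)) - rip (V *\<^sub>v c1) ((mat_adjoint X * R * X) *\<^sub>v (V *\<^sub>v c1)))
     - 2 * rip (U *\<^sub>v c2) ((R * X) *\<^sub>v (V *\<^sub>v c1)) - z * rip (U *\<^sub>v c2) (R *\<^sub>v (U *\<^sub>v c2)) - 2 * rip c1 (Ti *\<^sub>v c2)" .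
  define e1 where "e1 = rip (V *\<^sub>v c1) (1\<^sub>m n *\<^sub>v (V *\<^sub>v c1)) - 1 * rip c1 c1"
  define e2 where "e2 = rip (V *\<^sub>v c1) ((mat_adjoint X * R * X) *\<^sub>v (V *\<^sub>v c1)) - (1 + z\<^sup>2 * m) * rip c1 c1"
  define e3 where "e3 = rip (U *\<^sub>v c2) ((R * X) *\<^sub>v (V *\<^sub>v c1)) - 0 * rip c2 c1"
  define e4 where "e4 = rip (U *\<^sub>v c2) (R *\<^sub>v (U *\<^sub>v c2)) - m * rip c2 c2"
  have XRX: "mat_adjoint X * R * X \<in> carrier_mat n n" and RX: "R * X \<in> carrier_mat n n" by auto
  have cls: "\<And>i j. i < r \<Longrightarrow> j < r \<Longrightarrow> cmod (gram n V (1\<^sub>m n) V i j - (if i = j then complex_of_real 1 else 0)) \<le> \<eta>"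
    "\<And>i j. i < r \<Longrightarrow> j < r \<Longrightarrow> cmod (gram n V (mat_adjoint X * R * X) V i j - (if i = j then complex_of_real (1 + z\<^sup>2 * m) else 0)) \<le> \<eta>"
    "\<And>i j. i < r \<Longrightarrow> j < r \<Longrightarrow> cmod (gram n U (R * X) V i j - (if i = j then complex_of_real 0 else 0)) \<le> \<eta>"
    "\<And>i j. i < r \<Longrightarrow> j < r \<Longrightarrow> cmod (gram n U R U i j - (if i = j then complex_of_real m else 0)) \<le> \<eta>"
    using cl unfolding forms_close_def by blast+
  have b1: "\<bar>e1\<bar> \<le> \<eta> * real r * (rip c1 c1 + rip c1 c1) / 2" unfolding e1_def
    by (rule rip_gram_close[OF V V one_carrier_mat c(1) c(1) cls(1)])
  have b2: "\<bar>e2\<bar> \<le> \<eta> * real r * (rip c1 c1 + rip c1 c1) / 2" unfolding e2_def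
    by (rule rip_gram_close[OF V V XRX c(1) c(1) cls(2)])
  have b3: "\<bar>e3\<bar> \<le> \<eta> * real r * (rip c2 c2 + rip c1 c1) / 2" unfolding e3_def
    by (rule rip_gram_close[OF U V RX c(2) c(1) cls(3)])
  have b4: "\<bar>e4\<bar> \<le> \<eta> * real r * (rip c2 c2 + rip c2 c2) / 2" unfolding e4_def
    by (rule rip_gram_close[OF U U R c(2) c(2) cls(4)])
  define q where "q = \<eta> * real r * Q"
  have le: "\<eta> * real r * rip c1 c1 \<le> q" "\<eta> * real r * rip c2 c2 \<le> q"
    unfolding q_def Q_def using \<open>0 \<le> \<eta>\<close> by (auto intro!: mult_left_mono)
  have bb: "\<bar>e1\<bar> \<le> q" "\<bar>e2\<bar> \<le> q" "2 * \<bar>e3\<bar> \<le> q" "\<bar>e4\<bar> \<le> q"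
    using b1 b2 b3 b4 le by (auto simp: q_def Q_def algebra_simps)
  have "schur_form c1 c2 - limit_form m c1 c2 = (1 / z) * (e1 - e2) - 2 * e3 - z * e4"
    unfolding S limit_form_def e1_def e2_def e3_def e4_def using z by (simp add: field_simps power2_eq_square)
  also have "\<bar>\<dots>\<bar> \<le> (1 / z) * (\<bar>e1\<bar> + \<bar>e2\<bar>) + 2 * \<bar>e3\<bar> + z * \<bar>e4\<bar>"
  proof -
    have "\<bar>(1 / z) * (e1 - e2)\<bar> \<le> (1 / z) * (\<bar>e1\<bar> + \<bar>e2\<bar>)" unfolding abs_mult using z by (intro mult_mono) auto
    moreover have "\<bar>z * e4\<bar> = z * \<bar>e4\<bar>" using z by (simp add: abs_mult)
    ultimately show ?thesis by linarith
  qed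
  also have "\<dots> \<le> (1 / z) * (q + q) + q + z * q"
    using z bb by (intro add_mono mult_left_mono) auto
  also have "\<dots> = real r * (2 / z + 1 + z) * \<eta> * Q" by (simp add: q_def algebra_simps)
  finally show ?thesis by (simp add: Q_def)
qed

lemma rip_Ti: "c1 \<in> carrier_vec r \<Longrightarrow> c2 \<in> carrier_vec r \<Longrightarrow> rip c1 (Ti *\<^sub>v c2) = (\<Sum>i<r. Re (c1 $ i * cnj (c2 $ i)) / th i)"
proof -
  assume c: "c1 \<in> carrier_vec r" "c2 \<in> carrier_vec r"
  have "rip c1 (Ti *\<^sub>v c2) = (\<Sum>i<r. Re (c1 $ i * cnj (1 / complex_of_real (th i) * c2 $ i)))"
    using c by (subst rip_sum[of _ r]) (auto simp: diagonal_mult_vec)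
  also have "\<dots> = (\<Sum>i<r. Re (c1 $ i * cnj (c2 $ i)) / th i)"
  proof (rule sum.cong[OF refl])
    fix i
    have "c1 $ i * cnj (1 / complex_of_real (th i) * c2 $ i) = (c1 $ i * cnj (c2 $ i)) / complex_of_real (th i)" by simp
    then show "Re (c1 $ i * cnj (1 / complex_of_real (th i) * c2 $ i)) = Re (c1 $ i * cnj (c2 $ i)) / th i"
      by (simp only: Re_divide_of_real)
  qed
  finally show ?thesis .
qed

text \<open>For i < k the larger block eigenvalue 1 / th i - z m is at most -\<delta>. For i >= k
  the components agree, so only the eigenvalue -1 / th i - z m is met. The error does not exhaust
  the margin.\<close>

lemma sing_val_le:
  assumes k: "1 \<le> k" "k \<le> r" "k \<le> n" and cl: "forms_close m \<eta>"
    and \<delta>: "\<delta> \<le> z * m" "\<And>i. i < k \<Longrightarrow> \<delta> \<le> z * m - 1 / th i" "real r * (2 / z + 1 + z) * \<eta> < \<delta>"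
  shows "sing_val Y (n + 1 - k) \<le> z"
proof (rule sing_val_le_of_negative[OF k])
  fix c1 c2 :: "complex Matrix.vec" assume c: "c1 \<in> carrier_vec r" "c2 \<in> carrier_vec r" "\<And>i. k \<le> i \<Longrightarrow> i < r \<Longrightarrow> c1 $ i = c2 $ i"
    "\<not> (c1 = 0\<^sub>v r \<and> c2 = 0\<^sub>v r)"
  define Q where "Q = rip c1 c1 + rip c2 c2"
  have Q: "Q > 0"
  proof -
    have "rip c1 c1 \<noteq> 0 \<or> rip c2 c2 \<noteq> 0" using c(4) rip_self_eq_0[OF c(1)] rip_self_eq_0[OF c(2)] by blast
    then show ?thesis using rip_self_nonneg[of c1] rip_self_nonneg[of c2] unfolding Q_def by linarith
  qed
  have "limit_form m c1 c2 = (\<Sum>i<r. - z * m * ((cmod (c1 $ i))\<^sup>2 + (cmod (c2 $ i))\<^sup>2) - 2 * (Re (c1 $ i * cnj (c2 $ i)) / th i))"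
    unfolding limit_form_def rip_Ti[OF c(1,2)] rip_self[OF c(1)] rip_self[OF c(2)]
    by (simp add: sum_subtractf sum.distrib sum_distrib_left algebra_simps sum_negf)
  also have "\<dots> \<le> (\<Sum>i<r. - \<delta> * ((cmod (c1 $ i))\<^sup>2 + (cmod (c2 $ i))\<^sup>2))"
  proof (rule sum_mono)
    fix i assume "i \<in> {..<r}"
    then have i: "i < r" by simp
    define q where "q = (cmod (c1 $ i))\<^sup>2 + (cmod (c2 $ i))\<^sup>2"
    define s where "s = Re (c1 $ i * cnj (c2 $ i))"
    have q0: "q \<ge> 0" by (simp add: q_def)
    show "- z * m * ((cmod (c1 $ i))\<^sup>2 + (cmod (c2 $ i))\<^sup>2) - 2 * (Re (c1 $ i * cnj (c2 $ i)) / th i)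
        \<le> - \<delta> * ((cmod (c1 $ i))\<^sup>2 + (cmod (c2 $ i))\<^sup>2)"
      unfolding q_def[symmetric] s_def[symmetric]
    proof (cases "i < k")
      case True
      have "- 2 * s \<le> q"
      proof -
        have "\<bar>s\<bar> \<le> cmod (c1 $ i) * cmod (c2 $ i)"
          unfolding s_def using abs_Re_le_cmod[of "c1 $ i * cnj (c2 $ i)"] by (simp add: norm_mult)
        moreover have "2 * (cmod (c1 $ i) * cmod (c2 $ i)) \<le> q"
          unfolding q_def using sum_squares_bound[of "cmod (c1 $ i)" "cmod (c2 $ i)"] by simp
        ultimately show ?thesis by linarith
      qed
      then have "- 2 * (s / th i) \<le> q / th i" using th[OF i] by (simp add: field_simps)
      moreover have "\<delta> * q \<le> (z * m - 1 / th i) * q" using \<delta>(2)[OF True] q0 by (intro mult_right_mono)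
      ultimately show "- z * m * q - 2 * (s / th i) \<le> - \<delta> * q" by (simp add: algebra_simps)
    next
      case False
      then have "s \<ge> 0" unfolding s_def c(3)[OF leI[OF False] i] by (simp add: complex_mult_cnj)
      then have "0 \<le> s / th i" using th[OF i] by simp
      moreover have "\<delta> * q \<le> (z * m) * q" using \<delta>(1) q0 by (intro mult_right_mono)
      ultimately show "- z * m * q - 2 * (s / th i) \<le> - \<delta> * q" by (simp only: minus_mult_left[symmetric])
    qed
  qed
  also have "\<dots> = - \<delta> * Q"
    unfolding Q_def rip_self[OF c(1)] rip_self[OF c(2)] by (simp only: sum_distrib_left[symmetric] sum.distrib)
  finally have "limit_form m c1 c2 \<le> - \<delta> * Q" .
  moreover have "real r * (2 / z + 1 + z) * \<eta> * Q < \<delta> * Q" using \<delta>(3) Q by (rule mult_strict_right_mono)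
  ultimately show "schur_form c1 c2 < 0" using schur_form_close[OF c(1,2) cl] unfolding Q_def[symmetric] by simp
qed

text \<open>On pairs (c, -c) supported on i >= k only the eigenvalues 1 / th i - z m are met, all at
  least \<delta>.\<close>

lemma sing_val_gt:
  assumes k: "k \<le> r" "k + 1 \<le> n" and cl: "forms_close m \<eta>"
    and X_gt: "\<And>x. x \<in> carrier_vec n \<Longrightarrow> x \<noteq> 0\<^sub>v n \<Longrightarrow> z\<^sup>2 * rip x x < rip (mat_adjoint X *\<^sub>v x) (mat_adjoint X *\<^sub>v x)"
    and \<delta>: "\<And>i. k \<le> i \<Longrightarrow> i < r \<Longrightarrow> \<delta> \<le> 1 / th i - z * m" "real r * (2 / z + 1 + z) * \<eta> < \<delta>"
  shows "sing_val Y (n - k) > z"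
proof (rule sing_val_gt_of_positive[OF k X_gt])
  fix c :: "complex Matrix.vec" assume c: "c \<in> carrier_vec r" "\<And>i. i < k \<Longrightarrow> c $ i = 0" "c \<noteq> 0\<^sub>v r"
  have mc: "- c \<in> carrier_vec r" using c by simp
  define Q where "Q = rip c c + rip (- c) (- c)"
  have Q2: "Q = 2 * rip c c" using c(1) by (simp add: Q_def rip_uminus[of _ r])
  then have Q: "Q > 0" using rip_self_eq_0[OF c(1)] rip_self_nonneg[of c] c(3) by linarith
  have "\<delta> * Q = (\<Sum>i<r. \<delta> * (2 * (cmod (c $ i))\<^sup>2))"
    unfolding Q2 rip_self[OF c(1)] by (simp add: sum_distrib_left mult_ac)
  also have "\<dots> \<le> (\<Sum>i<r. (1 / th i - z * m) * (2 * (cmod (c $ i))\<^sup>2))"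
  proof (rule sum_mono)
    fix i assume "i \<in> {..<r}"
    then show "\<delta> * (2 * (cmod (c $ i))\<^sup>2) \<le> (1 / th i - z * m) * (2 * (cmod (c $ i))\<^sup>2)"
      using c(2)[of i] \<delta>(1)[of i] by (cases "i < k") (auto intro!: mult_right_mono)
  qed
  also have "\<dots> = limit_form m c (- c)"
  proof -
    have "rip c (Ti *\<^sub>v (- c)) = (\<Sum>i<r. - (cmod (c $ i))\<^sup>2 / th i)"
      unfolding rip_Ti[OF c(1) mc] using c(1) by (intro sum.cong refl) (auto simp: complex_mult_cnj cmod_power2 field_simps)
    then show ?thesis
      unfolding limit_form_def Q_def[symmetric] unfolding Q2 rip_self[OF c(1)]
      by (simp add: sum_subtractf sum_distrib_left algebra_simps sum_negf sum.distrib)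
  qed
  finally have "\<delta> * Q \<le> limit_form m c (- c)" .
  moreover have "real r * (2 / z + 1 + z) * \<eta> * Q < \<delta> * Q" using \<delta>(2) Q by (rule mult_strict_right_mono)
  ultimately show "schur_form c (- c) > 0" using schur_form_close[OF c(1) mc cl] unfolding Q_def[symmetric] by simp
qed

end

subsection \<open>Resolvents\<close>

definition mtrace :: "complex mat \<Rightarrow> complex" where
  "mtrace A = (\<Sum>i<dim_row A. A $$ (i, i))"

text \<open>The square of the Frobenius norm.\<close>

definition frob :: "complex mat \<Rightarrow> real" where
  "frob A = (\<Sum>i<dim_row A. \<Sum>j<dim_col A. (cmod (A $$ (i, j)))\<^sup>2)"

lemma mtrace_mult_comm:
  assumes "A \<in> carrier_mat n m" "B \<in> carrier_mat m n"
  shows "mtrace (A * B) = mtrace (B * A)"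
proof -
  have "mtrace (A * B) = (\<Sum>i<n. \<Sum>j<m. A $$ (i, j) * B $$ (j, i))"
    using assms by (simp add: mtrace_def scalar_prod_def atLeast0LessThan)
  also have "\<dots> = (\<Sum>j<m. \<Sum>i<n. A $$ (i, j) * B $$ (j, i))" by (rule sum.swap)
  also have "\<dots> = mtrace (B * A)"
    using assms by (simp add: mtrace_def scalar_prod_def atLeast0LessThan mult.commute)
  finally show ?thesis .
qed

lemma frob_eq_mtrace:
  assumes "A \<in> carrier_mat n m"
  shows "complex_of_real (frob A) = mtrace (A * mat_adjoint A)"
proof -
  have "mtrace (A * mat_adjoint A) = (\<Sum>i<n. \<Sum>j<m. A $$ (i, j) * cnj (A $$ (i, j)))"
    using assms by (simp add: mtrace_def scalar_prod_def atLeast0LessThan)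
  also have "\<dots> = complex_of_real (frob A)"
    using assms by (simp add: frob_def complex_norm_square[symmetric])
  finally show ?thesis by simp
qed

lemma mtrace_unitary_conj:
  assumes "U \<in> carrier_mat n n" "mat_adjoint U * U = 1\<^sub>m n"
  shows "mtrace (U * diagonal n d * mat_adjoint U) = (\<Sum>i<n. d i)"
proof -
  have "mtrace (U * diagonal n d * mat_adjoint U) = mtrace (mat_adjoint U * (U * diagonal n d))"
    by (rule mtrace_mult_comm[of _ n n]) (use assms in auto)
  also have "mat_adjoint U * (U * diagonal n d) = mat_adjoint U * U * diagonal n d"
    using assms(1) by (intro assoc_mult_mat[symmetric, of _ n n _ n _ n]) auto
  also have "\<dots> = diagonal n d" unfolding assms(2) by (rule left_mult_one_mat[of _ n n]) simp
  finally show ?thesis by (simp add: mtrace_def)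
qed

lemma unitary_conj_mult:
  assumes U: "U \<in> carrier_mat n n" "mat_adjoint U * U = 1\<^sub>m n"
  shows "(U * diagonal n d * mat_adjoint U) * (U * diagonal n e * mat_adjoint U) = U * diagonal n (\<lambda>i. d i * e i) * mat_adjoint U"
proof -
  define D E H where "D = diagonal n d" and "E = diagonal n e" and "H = mat_adjoint U"
  have c: "D \<in> carrier_mat n n" "E \<in> carrier_mat n n" "H \<in> carrier_mat n n" "U * D \<in> carrier_mat n n" "U * E \<in> carrier_mat n n"
     "E * H \<in> carrier_mat n n"
    using U(1) by (auto simp: D_def E_def H_def)
  note am = assoc_mult_mat[of _ n n _ n _ n]
  have "(U * D * H) * (U * E * H) = U * D * (H * (U * E * H))" using c U(1) by (intro am) auto
  also have "H * (U * E * H) = H * (U * (E * H))" using c U(1) by (subst am) auto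
  also have "\<dots> = H * U * (E * H)" using c U(1) by (intro am[symmetric]) auto
  also have "\<dots> = E * H" using U(2) c by (simp add: H_def)
  also have "U * D * (E * H) = U * D * E * H" using c U(1) by (intro am[symmetric]) auto
  also have "U * D * E = U * (D * E)" using c U(1) by (intro am) auto
  also have "D * E = diagonal n (\<lambda>i. d i * e i)"
    unfolding D_def E_def mult_diagonal[OF diagonal_carrier] by (rule eq_matI) auto
  finally show ?thesis by (simp add: D_def E_def H_def)
qed

text \<open>The adjugate formula makes measurability in \<open>X\<close> evident; the value is \<open>0\<close> where the determinant
  vanishes.\<close>

definition resolvent :: "nat \<Rightarrow> real \<Rightarrow> complex mat \<Rightarrow> complex mat" where
  "resolvent n z X = (let A = X * mat_adjoint X - complex_of_real (z\<^sup>2) \<cdot>\<^sub>m 1\<^sub>m n in inverse (det A) \<cdot>\<^sub>m adj_mat A)"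

lemma resolvent_carrier[simp]: "X \<in> carrier_mat n n \<Longrightarrow> resolvent n z X \<in> carrier_mat n n"
  unfolding resolvent_def Let_def by (intro smult_carrier_mat adj_mat(1)) (auto intro!: minus_carrier_mat)

text \<open>In an eigenbasis of \<open>X * mat_adjoint X\<close> the resolvent has eigenvalues g = 1
  / (l - z^2) <= c, and its product with \<open>X * mat_adjoint X\<close> has eigenvalues 1 + z^2 g;
  1 + c + z^2 c bounds both. The matrices \<open>R * X\<close> and
  \<open>mat_adjoint X * R * X\<close> are reached through traces of such products, using
  cyclicity.\<close>

lemma resolvent_facts:
  assumes X: "X \<in> carrier_mat n n" and z: "0 < z" "z < s" "s \<le> sing_val X n" and n: "n \<ge> 1"
  defines "R \<equiv> resolvent n z X" and "c \<equiv> 1 / (s\<^sup>2 - z\<^sup>2)"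
  shows "(X * mat_adjoint X - complex_of_real (z\<^sup>2) \<cdot>\<^sub>m 1\<^sub>m n) * R = 1\<^sub>m n" "mat_adjoint R = R"
    "mtrace R = complex_of_real (\<Sum>i<n. 1 / ((sing_val X (Suc i))\<^sup>2 - z\<^sup>2))"
    "mtrace (mat_adjoint X * R * X) = of_nat n + complex_of_real (z\<^sup>2) * mtrace R"
    "frob R \<le> real n * (1 + c + z\<^sup>2 * c)\<^sup>2" "frob (R * X) \<le> real n * (1 + c + z\<^sup>2 * c)\<^sup>2"
    "frob (mat_adjoint X * R * X) \<le> real n * (1 + c + z\<^sup>2 * c)\<^sup>2"
    "c > 0"
    "\<And>x. x \<in> carrier_vec n \<Longrightarrow> x \<noteq> 0\<^sub>v n \<Longrightarrow> z\<^sup>2 * rip x x < rip (mat_adjoint X *\<^sub>v x) (mat_adjoint X *\<^sub>v x)"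
proof -
  have zs: "z\<^sup>2 < s\<^sup>2" using z by (intro power_strict_mono) auto
  show c: "c > 0" using zs by (simp add: c_def)
  from singular_basis[OF X] obtain U where U: "U \<in> carrier_mat n n" "mat_adjoint U * U = 1\<^sub>m n" "U * mat_adjoint U = 1\<^sub>m n"
     "X * mat_adjoint X * U = U * diagonal n (\<lambda>i. complex_of_real ((sing_val X (Suc i))\<^sup>2))" by blast
  define l where "l = (\<lambda>i. (sing_val X (Suc i))\<^sup>2)"
  have l: "s\<^sup>2 \<le> l i" if "i < n" for i
  proof -
    have "sing_val X n \<le> sing_val X (Suc i)" using that by (intro sing_val_antimono[OF X]) auto
    then show ?thesis unfolding l_def using z by (intro power_mono) auto
  qed
  have lz: "l i - z\<^sup>2 > 0" if "i < n" for i using l[OF that] zs by simp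
  note ex = singular_basis_expansion[OF X U(1,3,4)]
  show "z\<^sup>2 * rip x x < rip (mat_adjoint X *\<^sub>v x) (mat_adjoint X *\<^sub>v x)" if x: "x \<in> carrier_vec n" "x \<noteq> 0\<^sub>v n" for x
  proof -
    have "rip x x > 0" using rip_self_eq_0[OF x(1)] rip_self_nonneg[of x] x(2) by linarith
    then have "z\<^sup>2 * rip x x < s\<^sup>2 * rip x x" using zs by simp
    also have "\<dots> \<le> rip (mat_adjoint X *\<^sub>v x) (mat_adjoint X *\<^sub>v x)"
      unfolding ex(2)[OF x(1)] ex(1)[OF x(1)] sum_distrib_left
      using l by (intro sum_mono mult_right_mono) (auto simp: l_def)
    finally show ?thesis .
  qed
  note am = assoc_mult_mat[of _ n n _ n _ n]
  \<comment> \<open>Functional calculus in the fixed basis: products, differences and adjoints are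
    computed on eigenvalues.\<close>
  define uc where "uc = (\<lambda>d. U * diagonal n d * mat_adjoint U)"
  have ucc: "uc d \<in> carrier_mat n n" for d unfolding uc_def using U(1) by auto
  have XX: "X * mat_adjoint X = uc (\<lambda>i. complex_of_real (l i))"
  proof -
    have "X * mat_adjoint X = X * mat_adjoint X * (U * mat_adjoint U)" using X U(3) by simp
    also have "\<dots> = X * mat_adjoint X * U * mat_adjoint U" using X U(1) by (intro am[symmetric]) auto
    finally show ?thesis unfolding U(4) uc_def l_def .
  qed
  have ucI: "uc (\<lambda>_. a) = a \<cdot>\<^sub>m 1\<^sub>m n" for a
  proof -
    have "diagonal n (\<lambda>_. a) = a \<cdot>\<^sub>m 1\<^sub>m n" by (rule eq_matI) auto
    then have "U * diagonal n (\<lambda>_. a) = a \<cdot>\<^sub>m U" using U(1) by (simp add: mult_smult_distrib[of _ n n _ n])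
    then show ?thesis unfolding uc_def using U by (simp add: mult_smult_assoc_mat[of _ n n _ n])
  qed
  have ucm: "uc d * uc e = uc (\<lambda>i. d i * e i)" for d e
    unfolding uc_def by (rule unitary_conj_mult[OF U(1,2)])
  have ucd: "uc d - uc e = uc (\<lambda>i. d i - e i)" for d e
  proof -
    have "diagonal n (\<lambda>i. d i - e i) = diagonal n d - diagonal n e" by (rule eq_matI) auto
    then show ?thesis unfolding uc_def using U(1)
      by (simp add: mult_minus_distrib_mat[of _ n n _ n] minus_mult_distrib_mat[of _ n n _ _ n])
  qed
  have uccong: "uc d = uc e" if "\<And>i. i < n \<Longrightarrow> d i = e i" for d e
  proof -
    have "diagonal n d = diagonal n e" by (rule eq_matI) (use that in auto)
    then show ?thesis by (simp add: uc_def)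
  qed
  have uca: "mat_adjoint (uc d) = uc (\<lambda>i. cnj (d i))" for d
  proof -
    have "mat_adjoint (uc d) = U * mat_adjoint (U * diagonal n d)"
      unfolding uc_def using U(1) by (subst mat_adjoint_mult[of _ n n _ n]) auto
    also have "mat_adjoint (U * diagonal n d) = diagonal n (\<lambda>i. cnj (d i)) * mat_adjoint U"
      using U(1) by (subst mat_adjoint_mult[of _ n n _ n]) (auto simp: adjoint_diagonal)
    finally show ?thesis unfolding uc_def using U(1) by (simp add: am)
  qed
  define A where "A = X * mat_adjoint X - complex_of_real (z\<^sup>2) \<cdot>\<^sub>m 1\<^sub>m n"
  define g where "g = (\<lambda>i. 1 / (l i - z\<^sup>2))"
  have A: "A = uc (\<lambda>i. complex_of_real (l i - z\<^sup>2))"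
    unfolding A_def XX ucI[symmetric] ucd by simp
  have Ac: "A \<in> carrier_mat n n" unfolding A by (rule ucc)
  have AG: "A * uc (\<lambda>i. complex_of_real (g i)) = 1\<^sub>m n"
  proof -
    have "A * uc (\<lambda>i. complex_of_real (g i)) = uc (\<lambda>_. 1)"
      unfolding A ucm using lz by (intro uccong) (simp add: g_def less_imp_neq[symmetric] flip: of_real_mult of_real_diff)
    also have "\<dots> = 1\<^sub>m n" unfolding ucI by (intro eq_matI) auto
    finally show ?thesis .
  qed
  have detA: "det A \<noteq> 0"
  proof
    assume "det A = 0"
    then have "det (A * uc (\<lambda>i. complex_of_real (g i))) = 0" using det_mult[OF Ac ucc] by simp
    then show False unfolding AG by simp
  qed
  have R': "R = inverse (det A) \<cdot>\<^sub>m adj_mat A" by (simp add: R_def resolvent_def A_def Let_def)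
  have AR: "A * R = 1\<^sub>m n"
  proof -
    have "A * R = inverse (det A) \<cdot>\<^sub>m (A * adj_mat A)"
      unfolding R' using adj_mat(1)[OF Ac] Ac by (simp add: mult_smult_distrib[of _ n n _ n])
    also have "\<dots> = 1\<^sub>m n" unfolding adj_mat(2)[OF Ac] using detA by (intro eq_matI) auto
    finally show ?thesis .
  qed
  then show "(X * mat_adjoint X - complex_of_real (z\<^sup>2) \<cdot>\<^sub>m 1\<^sub>m n) * R = 1\<^sub>m n" by (simp add: A_def)
  have Rc: "R \<in> carrier_mat n n" using X by (simp add: R_def)
  have R: "R = uc (\<lambda>i. complex_of_real (g i))"
  proof -
    have GA: "uc (\<lambda>i. complex_of_real (g i)) * A = 1\<^sub>m n"
      using mat_mult_left_right_inverse[OF Ac ucc AG] .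
    have "R = uc (\<lambda>i. complex_of_real (g i)) * A * R" using GA Rc by simp
    also have "\<dots> = uc (\<lambda>i. complex_of_real (g i)) * (A * R)" using Ac Rc ucc by (intro am) auto
    also have "\<dots> = uc (\<lambda>i. complex_of_real (g i))" unfolding AR using ucc by (intro right_mult_one_mat)
    finally show ?thesis .
  qed
  show Rh: "mat_adjoint R = R" unfolding R uca by simp
  have tr: "mtrace (uc d) = (\<Sum>i<n. d i)" for d unfolding uc_def by (rule mtrace_unitary_conj[OF U(1,2)])
  show trR: "mtrace R = complex_of_real (\<Sum>i<n. 1 / ((sing_val X (Suc i))\<^sup>2 - z\<^sup>2))"
    unfolding R tr by (simp add: g_def l_def)
  have gb: "0 \<le> g i" "g i \<le> c" if "i < n" for i
    using lz[OF that] l[OF that] zs by (auto simp: g_def c_def intro!: divide_left_mono)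
  have lg: "l i * g i = 1 + z\<^sup>2 * g i" if "i < n" for i
    using lz[OF that] by (simp add: g_def field_simps)
  have B: "a * b \<le> (1 + c + z\<^sup>2 * c)\<^sup>2" if "0 \<le> a" "0 \<le> b" "a \<le> 1 + c + z\<^sup>2 * c" "b \<le> 1 + c + z\<^sup>2 * c" for a b
    unfolding power2_eq_square[of "1 + c + z\<^sup>2 * c"] using that order_trans[OF that(1,3)] by (intro mult_mono) auto
  have gB: "0 \<le> g i" "g i \<le> 1 + c + z\<^sup>2 * c" "0 \<le> l i * g i" "l i * g i \<le> 1 + c + z\<^sup>2 * c" if "i < n" for i
  proof -
    have "z\<^sup>2 * g i \<le> z\<^sup>2 * c" using gb[OF that] by (intro mult_left_mono) auto
    moreover have "0 \<le> z\<^sup>2 * g i" "0 \<le> z\<^sup>2 * c" using gb[OF that] c by simp_all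
    ultimately show "0 \<le> g i" "g i \<le> 1 + c + z\<^sup>2 * c" "0 \<le> l i * g i" "l i * g i \<le> 1 + c + z\<^sup>2 * c"
      unfolding lg[OF that] using gb[OF that] c by linarith+
  qed
  have sumB: "(\<Sum>i<n. a i * b i) \<le> real n * (1 + c + z\<^sup>2 * c)\<^sup>2"
    if "\<And>i. i < n \<Longrightarrow> 0 \<le> a i \<and> a i \<le> 1 + c + z\<^sup>2 * c \<and> 0 \<le> b i \<and> b i \<le> 1 + c + z\<^sup>2 * c" for a b
    using sum_bounded_above[of "{..<n}" "\<lambda>i. a i * b i" "(1 + c + z\<^sup>2 * c)\<^sup>2"] B that by auto
  have RXX: "R * (X * mat_adjoint X) = uc (\<lambda>i. complex_of_real (l i * g i))"
    unfolding R XX ucm by (rule uccong) (simp add: mult.commute)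
  have "complex_of_real (frob R) = complex_of_real (\<Sum>i<n. g i * g i)"
    unfolding frob_eq_mtrace[OF Rc] Rh unfolding R ucm tr by simp
  then have "frob R = (\<Sum>i<n. g i * g i)" by (simp only: of_real_eq_iff)
  then show "frob R \<le> real n * (1 + c + z\<^sup>2 * c)\<^sup>2" using sumB[of g g] gB by auto
  have "complex_of_real (frob (R * X)) = mtrace (R * X * (mat_adjoint X * R))"
    using Rc X Rh by (subst frob_eq_mtrace[of _ n n]) (auto simp: mat_adjoint_mult[of _ n n _ n])
  also have "R * X * (mat_adjoint X * R) = R * (X * mat_adjoint X) * R"
    using Rc X by (simp add: am mult_carrier_mat[of _ n n _ n])
  also have "\<dots> = uc (\<lambda>i. complex_of_real (l i * g i * g i))"
    unfolding RXX unfolding R ucm by simp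
  finally have "complex_of_real (frob (R * X)) = complex_of_real (\<Sum>i<n. l i * g i * g i)" unfolding tr by simp
  then have "frob (R * X) = (\<Sum>i<n. l i * g i * g i)" by (simp only: of_real_eq_iff)
  then show "frob (R * X) \<le> real n * (1 + c + z\<^sup>2 * c)\<^sup>2" using sumB[of "\<lambda>i. l i * g i" g] gB by auto
  define N where "N = mat_adjoint X * R * X"
  have Nc: "N \<in> carrier_mat n n" using X Rc by (auto simp: N_def)
  have Nh: "mat_adjoint N = N"
  proof -
    have "mat_adjoint N = mat_adjoint X * mat_adjoint (mat_adjoint X * R)"
      unfolding N_def using X Rc by (subst mat_adjoint_mult[of _ n n _ n]) auto
    also have "mat_adjoint (mat_adjoint X * R) = R * X"
      using X Rc Rh by (subst mat_adjoint_mult[of _ n n _ n]) auto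
    finally show ?thesis unfolding N_def using X Rc by (simp add: am)
  qed
  have "mtrace N = mtrace (mat_adjoint X * (R * X))" unfolding N_def using X Rc by (simp add: am)
  also have "\<dots> = mtrace (R * X * mat_adjoint X)" by (rule mtrace_mult_comm[of _ n n]) (use X Rc in auto)
  also have "R * X * mat_adjoint X = R * (X * mat_adjoint X)" using X Rc by (intro am) auto
  also have "mtrace \<dots> = (\<Sum>i<n. complex_of_real (1 + z\<^sup>2 * g i))" unfolding RXX tr using lg by (intro sum.cong) auto
  also have "\<dots> = of_nat n + complex_of_real (z\<^sup>2) * mtrace R"
    unfolding R tr by (simp add: sum.distrib sum_distrib_left)
  finally show "mtrace (mat_adjoint X * R * X) = of_nat n + complex_of_real (z\<^sup>2) * mtrace R" by (simp add: N_def)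
  have "complex_of_real (frob N) = mtrace (N * N)" using frob_eq_mtrace[OF Nc] Nh by simp
  also have "N * N = mat_adjoint X * (R * X * N)"
  proof -
    have "N * N = mat_adjoint X * (R * X) * N" using X Rc by (simp add: N_def am)
    also have "\<dots> = mat_adjoint X * (R * X * N)" using X Rc Nc by (intro am) auto
    finally show ?thesis .
  qed
  also have "mtrace \<dots> = mtrace (R * X * N * mat_adjoint X)"
    by (rule mtrace_mult_comm[of _ n n]) (use X Rc Nc in auto)
  also have "R * X * N * mat_adjoint X = R * (X * mat_adjoint X) * (R * (X * mat_adjoint X))"
    unfolding N_def using X Rc by (simp add: am mult_carrier_mat[of _ n n _ n])
  also have "mtrace \<dots> = complex_of_real (\<Sum>i<n. (l i * g i) * (l i * g i))"
    unfolding RXX ucm tr by simp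
  finally have "frob N = (\<Sum>i<n. (l i * g i) * (l i * g i))" by (simp only: of_real_eq_iff)
  then show "frob (mat_adjoint X * R * X) \<le> real n * (1 + c + z\<^sup>2 * c)\<^sup>2"
    using sumB[of "\<lambda>i. l i * g i" "\<lambda>i. l i * g i"] gB by (auto simp: N_def)
qed

subsection \<open>Quadratic forms in the random vectors\<close>

definition meas_mat :: "'x measure \<Rightarrow> nat \<Rightarrow> nat \<Rightarrow> ('x \<Rightarrow> complex mat) \<Rightarrow> bool" where
  "meas_mat N n m A \<longleftrightarrow> (\<forall>x. A x \<in> carrier_mat n m) \<and> (\<forall>i<n. \<forall>j<m. (\<lambda>x. A x $$ (i, j)) \<in> borel_measurable N)"

lemma meas_matI:
  "(\<And>x. A x \<in> carrier_mat n m) \<Longrightarrow> (\<And>i j. i < n \<Longrightarrow> j < m \<Longrightarrow> (\<lambda>x. A x $$ (i, j)) \<in> borel_measurable N) \<Longrightarrow> meas_mat N n m A"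
  by (simp add: meas_mat_def)

lemma meas_matD:
  assumes "meas_mat N n m A"
  shows "A x \<in> carrier_mat n m" "dim_row (A x) = n" "dim_col (A x) = m"
    "i < n \<Longrightarrow> j < m \<Longrightarrow> (\<lambda>x. A x $$ (i, j)) \<in> borel_measurable N"
proof -
  show c: "A x \<in> carrier_mat n m" using assms by (simp add: meas_mat_def)
  show "dim_row (A x) = n" "dim_col (A x) = m" using carrier_matD[OF c] by auto
  show "i < n \<Longrightarrow> j < m \<Longrightarrow> (\<lambda>x. A x $$ (i, j)) \<in> borel_measurable N" using assms by (simp add: meas_mat_def)
qed

lemma meas_mat_mult:
  assumes A: "meas_mat N n m A" and B: "meas_mat N m l B"
  shows "meas_mat N n l (\<lambda>x. A x * B x)"
proof (rule meas_matI)
  fix i j assume ij: "i < n" "j < l"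
  have "(\<lambda>x. (A x * B x) $$ (i, j)) = (\<lambda>x. \<Sum>k<m. A x $$ (i, k) * B x $$ (k, j))"
    using ij meas_matD[OF A] meas_matD[OF B] by (auto simp: scalar_prod_def atLeast0LessThan)
  also have "\<dots> \<in> borel_measurable N"
    using ij by (intro borel_measurable_sum borel_measurable_times meas_matD(4)[OF A] meas_matD(4)[OF B]) auto
  finally show "(\<lambda>x. (A x * B x) $$ (i, j)) \<in> borel_measurable N" .
qed (rule mult_carrier_mat[OF meas_matD(1)[OF A] meas_matD(1)[OF B]])

lemma meas_mat_adjoint:
  assumes A: "meas_mat N n m A"
  shows "meas_mat N m n (\<lambda>x. mat_adjoint (A x))"
proof (rule meas_matI)
  fix i j assume ij: "i < m" "j < n"
  have "(\<lambda>x. mat_adjoint (A x) $$ (i, j)) = (\<lambda>x. cnj (A x $$ (j, i)))"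
    using ij meas_matD[OF A] by auto
  also have "\<dots> \<in> borel_measurable N"
    using ij by (intro measurable_compose[OF meas_matD(4)[OF A]] borel_measurable_continuous_onI continuous_intros) auto
  finally show "(\<lambda>x. mat_adjoint (A x) $$ (i, j)) \<in> borel_measurable N" .
qed (rule mat_adjoint_carrier[OF meas_matD(1)[OF A]])

lemma meas_mat_minus:
  assumes A: "meas_mat N n m A" and B: "meas_mat N n m B"
  shows "meas_mat N n m (\<lambda>x. A x - B x)"
proof (rule meas_matI)
  fix i j assume ij: "i < n" "j < m"
  have "(\<lambda>x. (A x - B x) $$ (i, j)) = (\<lambda>x. A x $$ (i, j) - B x $$ (i, j))"
    using ij meas_matD[OF A] meas_matD[OF B] by auto
  also have "\<dots> \<in> borel_measurable N"
    using ij by (intro borel_measurable_diff meas_matD(4)[OF A] meas_matD(4)[OF B]) auto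
  finally show "(\<lambda>x. (A x - B x) $$ (i, j)) \<in> borel_measurable N" .
qed (rule minus_carrier_mat[OF meas_matD(1)[OF B]])

lemma meas_mat_smult:
  assumes A: "meas_mat N n m A" and c: "c \<in> borel_measurable N"
  shows "meas_mat N n m (\<lambda>x. c x \<cdot>\<^sub>m A x)"
proof (rule meas_matI)
  fix i j assume ij: "i < n" "j < m"
  have "(\<lambda>x. (c x \<cdot>\<^sub>m A x) $$ (i, j)) = (\<lambda>x. c x * A x $$ (i, j))"
    using ij meas_matD[OF A] by auto
  also have "\<dots> \<in> borel_measurable N"
    using ij by (intro borel_measurable_times meas_matD(4)[OF A] c) auto
  finally show "(\<lambda>x. (c x \<cdot>\<^sub>m A x) $$ (i, j)) \<in> borel_measurable N" .
qed (rule smult_carrier_mat[OF meas_matD(1)[OF A]])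

lemma meas_mat_const: "B \<in> carrier_mat n m \<Longrightarrow> meas_mat N n m (\<lambda>x. B)"
  by (rule meas_matI) auto

lemma meas_mat_det:
  assumes A: "meas_mat N n n A"
  shows "(\<lambda>x. det (A x)) \<in> borel_measurable N"
proof -
  have "(\<lambda>x. det (A x)) = (\<lambda>x. \<Sum>p\<in>{p. p permutes {0..<n}}. signof p * (\<Prod>i = 0..<n. A x $$ (i, p i)))"
    unfolding det_def using meas_matD(2,3)[OF A] by simp
  also have "\<dots> \<in> borel_measurable N"
    by (intro borel_measurable_sum borel_measurable_times borel_measurable_const borel_measurable_prod meas_matD(4)[OF A])
      (auto simp: permutes_in_image[of _ "{0..<n}"])
  finally show ?thesis .
qed

lemma meas_mat_adj_mat:
  assumes A: "meas_mat N n n A"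
  shows "meas_mat N n n (\<lambda>x. adj_mat (A x))"
proof (rule meas_matI)
  fix i j assume ij: "i < n" "j < n"
  have d: "meas_mat N (n - 1) (n - 1) (\<lambda>x. mat_delete (A x) j i)"
  proof (rule meas_matI)
    fix k l assume kl: "k < n - 1" "l < n - 1"
    have "(\<lambda>x. mat_delete (A x) j i $$ (k, l)) = (\<lambda>x. A x $$ (if k < j then k else Suc k, if l < i then l else Suc l))"
      unfolding mat_delete_def using kl meas_matD(2,3)[OF A] by auto
    also have "\<dots> \<in> borel_measurable N" using kl by (intro meas_matD(4)[OF A]) auto
    finally show "(\<lambda>x. mat_delete (A x) j i $$ (k, l)) \<in> borel_measurable N" .
  qed (use meas_matD(2,3)[OF A] in \<open>simp add: mat_delete_def\<close>)
  have "(\<lambda>x. adj_mat (A x) $$ (i, j)) = (\<lambda>x. (-1) ^ (j + i) * det (mat_delete (A x) j i))"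
    using ij meas_matD(2,3)[OF A] by (auto simp: adj_mat_def cofactor_def)
  also have "\<dots> \<in> borel_measurable N"
    by (intro borel_measurable_times borel_measurable_const meas_mat_det[OF d])
  finally show "(\<lambda>x. adj_mat (A x) $$ (i, j)) \<in> borel_measurable N" .
qed (rule adj_mat(1)[OF meas_matD(1)[OF A]])

lemma meas_mat_resolvent:
  assumes A: "meas_mat N n n A"
  shows "meas_mat N n n (\<lambda>x. resolvent n z (A x))"
proof -
  have B: "meas_mat N n n (\<lambda>x. A x * mat_adjoint (A x) - complex_of_real (z\<^sup>2) \<cdot>\<^sub>m 1\<^sub>m n)"
    by (intro meas_mat_minus meas_mat_mult[OF A] meas_mat_adjoint[OF A] meas_mat_const) simp
  show ?thesis unfolding resolvent_def Let_def
    by (intro meas_mat_smult meas_mat_adj_mat[OF B] borel_measurable_inverse meas_mat_det[OF B])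
qed

text \<open>Collapses a sum over all random entries to one column, where the coefficients in
  \<open>gram_AE\<close> live.\<close>

lemma sum_single_slot:
  fixes g :: "'s \<times> nat \<times> nat \<Rightarrow> 'b :: comm_monoid_add"
  assumes "finite S" "s \<in> S" "j < r" and "\<And>s' i j'. s' \<noteq> s \<or> j' \<noteq> j \<Longrightarrow> g (s', i, j') = 0"
  shows "(\<Sum>p\<in>S \<times> {0..<n} \<times> {0..<r}. g p) = (\<Sum>i<n. g (s, i, j))"
proof -
  have "(\<Sum>p\<in>S \<times> {0..<n} \<times> {0..<r}. g p) = (\<Sum>p\<in>(\<lambda>i. (s, i, j)) ` {..<n}. g p)"
    using assms by (intro sum.mono_neutral_right) (auto simp: image_iff)
  also have "\<dots> = (\<Sum>i<n. g (s, i, j))" by (subst sum.reindex) (auto simp: inj_on_def)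
  finally show ?thesis .
qed

section \<open>Pairings of the random columns through functions of the matrix\<close>

locale random_model = standard_law \<nu> + M: prob_space M for \<nu> :: "complex measure" and M :: "'w measure" +
  fixes X Gu Gv :: "nat \<Rightarrow> 'w \<Rightarrow> complex mat" and r :: nat
  assumes X_dim: "\<And>n \<omega>. \<omega> \<in> space M \<Longrightarrow> X n \<omega> \<in> carrier_mat n n"
    and X_meas: "\<And>n i j. i < n \<Longrightarrow> j < n \<Longrightarrow> (\<lambda>\<omega>. X n \<omega> $$ (i, j)) \<in> borel_measurable M"
    and r: "r \<ge> 1"
    and G_dim: "\<And>n \<omega>. \<omega> \<in> space M \<Longrightarrow> Gu n \<omega> \<in> carrier_mat n r"
               "\<And>n \<omega>. \<omega> \<in> space M \<Longrightarrow> Gv n \<omega> \<in> carrier_mat n r"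
    and G_indep: "\<And>n. prob_space.indep_vars M (\<lambda>_. borel)
        (\<lambda>(s, i, j) \<omega>. (if s then Gu n \<omega> else Gv n \<omega>) $$ (i, j))
        (UNIV \<times> {0..<n} \<times> {0..<r})"
    and G_law: "\<And>n i j. i < n \<Longrightarrow> j < r \<Longrightarrow> distr M borel (\<lambda>\<omega>. Gu n \<omega> $$ (i, j)) = \<nu>"
               "\<And>n i j. i < n \<Longrightarrow> j < r \<Longrightarrow> distr M borel (\<lambda>\<omega>. Gv n \<omega> $$ (i, j)) = \<nu>"
    and GX_indep: "prob_space.indep_set M
        (generated_events M {(s, n, i, j). i < n \<and> j < r}
           (\<lambda>(s :: bool, n, i, j) \<omega>. (if s then Gu n \<omega> else Gv n \<omega>) $$ (i, j)))
        (generated_events M {(n, i, j). i < n \<and> j < n}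
           (\<lambda>(n, i, j) \<omega>. X n \<omega> $$ (i, j)))"
begin

definition "G s n \<omega> = (if s then Gu n \<omega> else Gv n \<omega>)"

definition "slots n = (UNIV :: bool set) \<times> {0..<n :: nat} \<times> {0..<r}"

definition "Yv n \<omega> = (\<lambda>(s, i, j)\<in>slots n. G s n \<omega> $$ (i, j))"

text \<open>The dummy index \<open>False\<close> gives both families the same index type, as the library's
  notion of independence of two random variables requires.\<close>

definition "entries n = {False} \<times> {..<n :: nat} \<times> {..<n :: nat}"

definition "Zv n \<omega> = (\<lambda>(s, i, j)\<in>entries n. X n \<omega> $$ (i, j))"

lemma G_meas: "i < n \<Longrightarrow> j < r \<Longrightarrow> (\<lambda>\<omega>. G s n \<omega> $$ (i, j)) \<in> borel_measurable M"
proof -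
  assume "i < n" "j < r"
  then have "M.random_variable borel ((\<lambda>(s, i, j) \<omega>. (if s then Gu n \<omega> else Gv n \<omega>) $$ (i, j)) (s, i, j))"
    using G_indep[of n] unfolding M.indep_vars_def2 by (auto simp del: prod.case)
  then show ?thesis by (simp add: G_def)
qed

lemma Yv_meas: "Yv n \<in> measurable M (PiM (slots n) (\<lambda>_. borel))"
  unfolding Yv_def by (intro measurable_restrict) (auto simp: slots_def intro: G_meas)

lemma Zv_meas: "Zv n \<in> measurable M (PiM (entries n) (\<lambda>_. borel))"
  unfolding Zv_def by (intro measurable_restrict) (auto simp: entries_def intro: X_meas)

lemma sets_PiM_law: "sets (PiM I (\<lambda>_. \<nu>)) = sets (PiM I (\<lambda>_. borel))"
  by (intro sets_PiM_cong) (auto simp: sets_law)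

lemma Yv_law:
  assumes "n \<ge> 1"
  shows "distr M (PiM (slots n) (\<lambda>_. borel)) (Yv n) = PiM (slots n) (\<lambda>_. \<nu>)"
proof -
  let ?F = "\<lambda>(s, i, j) \<omega>. (if s then Gu n \<omega> else Gv n \<omega>) $$ (i, j)"
  \<comment> \<open>The characterization of independence by a product law requires a nonempty index
    set, hence n >= 1.\<close>
  have ne: "slots n \<noteq> {}" using assms r by (auto simp: slots_def)
  have "distr M (PiM (slots n) (\<lambda>_. borel)) (\<lambda>x. \<lambda>p\<in>slots n. ?F p x) = PiM (slots n) (\<lambda>p. distr M borel (?F p))"
    using G_indep[of n] unfolding slots_def[symmetric]
    by (subst (asm) M.indep_vars_iff_distr_eq_PiM'[OF ne]) (use G_meas in \<open>auto simp: slots_def G_def split: if_splits\<close>)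
  also have "PiM (slots n) (\<lambda>p. distr M borel (?F p)) = PiM (slots n) (\<lambda>_. \<nu>)"
  proof (intro PiM_cong refl)
    fix p assume "p \<in> slots n"
    then obtain s i j where "p = (s, i, j)" "i < n" "j < r" by (auto simp: slots_def)
    then show "distr M borel (?F p) = \<nu>" by (cases s) (auto simp: G_law)
  qed
  also have "(\<lambda>x. \<lambda>p\<in>slots n. ?F p x) = Yv n"
    by (auto simp: Yv_def G_def fun_eq_iff restrict_def)
  finally show ?thesis .
qed

text \<open>The hypothesis concerns the families over all n. The entries for one n are measurable
  images, under \<open>pG\<close> and \<open>pX\<close>, of these families, so they generate smaller
  sigma-algebras and stay independent.\<close>

lemma YZ_indep: "M.indep_var (PiM (slots n) (\<lambda>_. borel)) (Yv n) (PiM (entries n) (\<lambda>_. borel)) (Zv n)"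
proof -
  let ?I = "{(s :: bool, n :: nat, i, j). i < n \<and> j < r}" and ?J = "{(n :: nat, i, j). i < n \<and> j < n}"
  let ?FG = "\<lambda>(s :: bool, n, i, j) \<omega>. (if s then Gu n \<omega> else Gv n \<omega>) $$ (i, j)"
  let ?FX = "\<lambda>(n, i, j) \<omega>. X n \<omega> $$ (i, j)"
  define pG where "pG = (\<lambda>f :: bool \<times> nat \<times> nat \<times> nat \<Rightarrow> complex. \<lambda>(s, i, j)\<in>slots n. f (s, n, i, j))"
  define pX where "pX = (\<lambda>f :: nat \<times> nat \<times> nat \<Rightarrow> complex. \<lambda>(s :: bool, i, j)\<in>entries n. f (n, i, j))"
  have pG: "pG \<in> measurable (PiM ?I (\<lambda>_. borel)) (PiM (slots n) (\<lambda>_. borel))"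
    unfolding pG_def by (intro measurable_restrict) (auto simp: slots_def intro!: measurable_component_singleton)
  have pX: "pX \<in> measurable (PiM ?J (\<lambda>_. borel)) (PiM (entries n) (\<lambda>_. borel))"
    unfolding pX_def by (intro measurable_restrict) (auto simp: entries_def intro!: measurable_component_singleton)
  have FGs: "(\<lambda>\<omega>. \<lambda>i\<in>?I. ?FG i \<omega>) \<in> space M \<rightarrow> space (PiM ?I (\<lambda>_. borel))" by (auto simp: space_PiM)
  have FXs: "(\<lambda>\<omega>. \<lambda>i\<in>?J. ?FX i \<omega>) \<in> space M \<rightarrow> space (PiM ?J (\<lambda>_. borel))" by (auto simp: space_PiM)
  have YG: "Yv n \<omega> = pG (\<lambda>i\<in>?I. ?FG i \<omega>)" for \<omega>
    by (auto simp: Yv_def pG_def G_def slots_def fun_eq_iff restrict_def)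
  have ZX: "Zv n \<omega> = pX (\<lambda>i\<in>?J. ?FX i \<omega>)" for \<omega>
    by (auto simp: Zv_def pX_def entries_def fun_eq_iff restrict_def)
  have sG: "sigma_sets (space M) {Yv n -` A \<inter> space M |A. A \<in> sets (PiM (slots n) (\<lambda>_. borel))} \<subseteq> generated_events M ?I ?FG"
  proof -
    let ?V = "vimage_algebra (space M) (\<lambda>\<omega>. \<lambda>i\<in>?I. ?FG i \<omega>) (PiM ?I (\<lambda>_. borel))"
    have "Yv n -` A \<inter> space M \<in> sets ?V" if "A \<in> sets (PiM (slots n) (\<lambda>_. borel))" for A
    proof -
      have "pG -` A \<inter> space (PiM ?I (\<lambda>_. borel)) \<in> sets (PiM ?I (\<lambda>_. borel))" by (rule measurable_sets[OF pG that])
      from in_vimage_algebra[OF this, of "\<lambda>\<omega>. \<lambda>i\<in>?I. ?FG i \<omega>" "space M"]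
      show ?thesis by (rule back_subst[of "\<lambda>B. B \<in> sets ?V"]) (use FGs in \<open>auto simp: YG\<close>)
    qed
    then show ?thesis unfolding generated_events_def
      using sets.sigma_sets_subset[of "{Yv n -` A \<inter> space M |A. A \<in> sets (PiM (slots n) (\<lambda>_. borel))}" ?V] by (auto simp: space_vimage_algebra)
  qed
  have sX: "sigma_sets (space M) {Zv n -` A \<inter> space M |A. A \<in> sets (PiM (entries n) (\<lambda>_. borel))} \<subseteq> generated_events M ?J ?FX"
  proof -
    let ?V = "vimage_algebra (space M) (\<lambda>\<omega>. \<lambda>i\<in>?J. ?FX i \<omega>) (PiM ?J (\<lambda>_. borel))"
    have "Zv n -` A \<inter> space M \<in> sets ?V" if "A \<in> sets (PiM (entries n) (\<lambda>_. borel))" for A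
    proof -
      have "pX -` A \<inter> space (PiM ?J (\<lambda>_. borel)) \<in> sets (PiM ?J (\<lambda>_. borel))" by (rule measurable_sets[OF pX that])
      from in_vimage_algebra[OF this, of "\<lambda>\<omega>. \<lambda>i\<in>?J. ?FX i \<omega>" "space M"]
      show ?thesis by (rule back_subst[of "\<lambda>B. B \<in> sets ?V"]) (use FXs in \<open>auto simp: ZX\<close>)
    qed
    then show ?thesis unfolding generated_events_def
      using sets.sigma_sets_subset[of "{Zv n -` A \<inter> space M |A. A \<in> sets (PiM (entries n) (\<lambda>_. borel))}" ?V] by (auto simp: space_vimage_algebra)
  qed
  show ?thesis
    unfolding M.indep_var_eq
  proof (intro conjI Yv_meas Zv_meas)
    show "M.indep_set (sigma_sets (space M) {Yv n -` A \<inter> space M |A. A \<in> sets (PiM (slots n) (\<lambda>_. borel))})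
      (sigma_sets (space M) {Zv n -` A \<inter> space M |A. A \<in> sets (PiM (entries n) (\<lambda>_. borel))})"
      using GX_indep sG sX unfolding M.indep_sets2_eq by blast
  qed
qed

lemma sum_slots:
  fixes f :: "bool \<times> nat \<times> nat \<Rightarrow> bool \<times> nat \<times> nat \<Rightarrow> 'b :: comm_monoid_add"
  assumes j: "j < r" "j' < r"
    and that: "\<And>s1 i a q. s1 \<noteq> s \<or> a \<noteq> j \<Longrightarrow> f (s1, i, a) q = 0" "\<And>s2 i b p. s2 \<noteq> s' \<or> b \<noteq> j' \<Longrightarrow> f p (s2, i, b) = 0"
  shows "(\<Sum>p\<in>slots n. \<Sum>q\<in>slots n. f p q) = (\<Sum>i<n. \<Sum>i'<n. f (s, i, j) (s', i', j'))"
proof -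
  have "(\<Sum>p\<in>slots n. \<Sum>q\<in>slots n. f p q) = (\<Sum>i<n. \<Sum>q\<in>slots n. f (s, i, j) q)"
    unfolding slots_def by (rule sum_single_slot) (use j that(1) in auto)
  also have "\<dots> = (\<Sum>i<n. \<Sum>i'<n. f (s, i, j) (s', i', j'))"
    unfolding slots_def by (rule sum.cong[OF refl], rule sum_single_slot) (use j that(2) in auto)
  finally show ?thesis .
qed

text \<open>Both columns sit in one family of independent entries, so their pairing is a quadratic
  form in that family with coefficients on a single block. This block meets the diagonal only when
  the two columns coincide, and its diagonal sum is then the trace.\<close>

theorem gram_AE:
  fixes E :: "nat \<Rightarrow> complex mat \<Rightarrow> complex mat"
  assumes E: "\<And>n (N :: (bool \<times> nat \<times> nat \<Rightarrow> complex) measure) A. meas_mat N n n A \<Longrightarrow> meas_mat N n n (\<lambda>x. E n (A x))"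
    and j: "j < r" "j' < r"
  shows "AE \<omega> in M. \<forall>B::nat. (\<forall>\<^sub>F n in sequentially. frob (E n (X n \<omega>)) \<le> real B * real n) \<longrightarrow>
     (\<lambda>n. (gram n (G s n \<omega>) (E n (X n \<omega>)) (G s' n \<omega>) j j' - (if s = s' \<and> j = j' then mtrace (E n (X n \<omega>)) else 0)) / of_nat n) \<longlonglongrightarrow> 0"
proof -
  \<comment> \<open>Rebuilds the matrix from its entries, so that the coefficients are functions of
    \<open>Zv\<close>.\<close>
  define mt where "mt = (\<lambda>n (x :: bool \<times> nat \<times> nat \<Rightarrow> complex). Matrix.mat n n (\<lambda>(i, j). x (False, i, j)))"
  let ?N = "\<lambda>n. PiM (entries n) (\<lambda>_. borel :: complex measure)"
  define D where "D = (\<lambda>n x (s1, i, a) (s2, i', b). if s1 = s \<and> a = j \<and> s2 = s' \<and> b = j' then E n (mt n x) $$ (i, i') else 0)"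
  have mtm: "meas_mat (?N n) n n (mt n)" for n
    by (rule meas_matI) (auto simp: mt_def entries_def intro!: measurable_component_singleton)
  note E = E[OF mtm]
  have Dm: "(\<lambda>x. D n x p q) \<in> borel_measurable (?N n)" if "p \<in> slots n" "q \<in> slots n" for n p q
    using that meas_matD(4)[OF E] by (cases p; cases q) (auto simp: D_def slots_def)
  have Ym: "Yv n \<in> measurable M (PiM (slots n) (\<lambda>_. \<nu>))" for n
    using Yv_meas by (subst measurable_cong_sets[OF refl sets_PiM_law])
  have joint: "distr M (PiM (slots n) (\<lambda>_. \<nu>) \<Otimes>\<^sub>M ?N n) (\<lambda>\<omega>. (Yv n \<omega>, Zv n \<omega>)) = PiM (slots n) (\<lambda>_. \<nu>) \<Otimes>\<^sub>M distr M (?N n) (Zv n)"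
    if "n \<ge> 1" for n
  proof -
    have "distr M (PiM (slots n) (\<lambda>_. \<nu>) \<Otimes>\<^sub>M ?N n) (\<lambda>\<omega>. (Yv n \<omega>, Zv n \<omega>)) =
        distr M (PiM (slots n) (\<lambda>_. borel) \<Otimes>\<^sub>M ?N n) (\<lambda>\<omega>. (Yv n \<omega>, Zv n \<omega>))"
      by (intro distr_cong refl sets_pair_measure_cong sets_PiM_law)
    also have "\<dots> = distr M (PiM (slots n) (\<lambda>_. borel)) (Yv n) \<Otimes>\<^sub>M distr M (?N n) (Zv n)"
      using YZ_indep[of n] unfolding M.indep_var_distribution_eq by simp
    finally show ?thesis unfolding Yv_law[OF that] .
  qed
  have fin: "finite (slots n)" for n unfolding slots_def by (intro finite_cartesian_product) auto
  have Dz: "D n x (s1, i, a) q = 0" if "s1 \<noteq> s \<or> a \<noteq> j" for n x s1 i a q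
    using that by (cases q) (auto simp: D_def)
  have Dz': "D n x p (s2, i, b) = 0" if "s2 \<noteq> s' \<or> b \<noteq> j'" for n x s2 i b p
    using that by (cases p) (auto simp: D_def)
  have mZ: "mt n (Zv n \<omega>) = X n \<omega>" if "\<omega> \<in> space M" for n \<omega>
    using X_dim[OF that, of n] by (intro eq_matI) (auto simp: Zv_def mt_def entries_def)
  have fr: "frob_on (slots n) (D n (Zv n \<omega>)) = frob (E n (X n \<omega>))" if w: "\<omega> \<in> space M" for n \<omega>
  proof -
    have "frob_on (slots n) (D n (Zv n \<omega>)) = (\<Sum>i<n. \<Sum>i'<n. (cmod (D n (Zv n \<omega>) (s, i, j) (s', i', j')))\<^sup>2)"
      unfolding frob_on_def by (rule sum_slots[OF j]) (auto simp: Dz Dz')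
    then show ?thesis using meas_matD(2,3)[OF E, of n "Zv n \<omega>"] unfolding mZ[OF w]
      by (simp add: D_def frob_def mZ[OF w])
  qed
  have cf: "centered_form (slots n) (D n (Zv n \<omega>)) (Yv n \<omega>) =
    gram n (G s n \<omega>) (E n (X n \<omega>)) (G s' n \<omega>) j j' - (if s = s' \<and> j = j' then mtrace (E n (X n \<omega>)) else 0)"
    if w: "\<omega> \<in> space M" for n \<omega>
  proof -
    have "(\<Sum>p\<in>slots n. \<Sum>q\<in>slots n. D n (Zv n \<omega>) p q * cnj (Yv n \<omega> p) * Yv n \<omega> q)
      = (\<Sum>i<n. \<Sum>i'<n. D n (Zv n \<omega>) (s, i, j) (s', i', j') * cnj (Yv n \<omega> (s, i, j)) * Yv n \<omega> (s', i', j'))"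
      by (rule sum_slots[OF j]) (auto simp: Dz Dz')
    also have "\<dots> = gram n (G s n \<omega>) (E n (X n \<omega>)) (G s' n \<omega>) j j'"
      unfolding gram_def using j
      by (intro sum.cong refl) (auto simp: D_def mZ[OF w] Yv_def slots_def mult_ac)
    finally have 1: "(\<Sum>p\<in>slots n. \<Sum>q\<in>slots n. D n (Zv n \<omega>) p q * cnj (Yv n \<omega> p) * Yv n \<omega> q)
       = gram n (G s n \<omega>) (E n (X n \<omega>)) (G s' n \<omega>) j j'" .
    have "(\<Sum>p\<in>slots n. D n (Zv n \<omega>) p p) = (\<Sum>i<n. D n (Zv n \<omega>) (s, i, j) (s, i, j))"
      unfolding slots_def using j by (intro sum_single_slot) (auto simp: Dz)
    also have "\<dots> = (if s = s' \<and> j = j' then mtrace (E n (X n \<omega>)) else 0)"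
      using meas_matD(2)[OF E, of n "Zv n \<omega>"] unfolding mZ[OF w] by (auto simp: D_def mtrace_def mZ[OF w])
    finally show ?thesis unfolding centered_form_def 1 by simp
  qed
  have "AE \<omega> in M. \<forall>B::nat. (\<forall>\<^sub>F n in sequentially. frob_on (slots n) (D n (Zv n \<omega>)) \<le> real B * real n) \<longrightarrow>
     (\<lambda>n. centered_form (slots n) (D n (Zv n \<omega>)) (Yv n \<omega>) / of_nat n) \<longlonglongrightarrow> 0"
    by (rule centered_form_AE[OF fin Dm M.prob_space_axioms Ym Zv_meas joint])
  then show ?thesis by (rule AE_mp) (intro AE_I2, simp add: fr cf)
qed

end

subsection \<open>Gram-Schmidt coefficients\<close>

lemma adjuster_carrier_vec:
  "set us \<subseteq> carrier_vec n \<Longrightarrow> adjuster n w us \<in> carrier_vec n"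
  by (induction us) auto

lemma adjuster_index:
  fixes w :: "complex Matrix.vec"
  assumes "set us \<subseteq> carrier_vec n" "k < n"
  shows "adjuster n w us $ k = (\<Sum>i<length us. - (w \<bullet>c us ! i) / (us ! i \<bullet>c us ! i) * us ! i $ k)"
  using assms
proof (induction us)
  case (Cons u us)
  have a: "adjuster n w us \<in> carrier_vec n" using Cons.prems by (intro adjuster_carrier_vec) auto
  have d: "k < dim_vec u" "k < dim_vec (adjuster n w us)" using Cons.prems a by auto
  have "adjuster n w (u # us) $ k = - (w \<bullet>c u) / (u \<bullet>c u) * u $ k + adjuster n w us $ k"
    using Cons.prems d by simp
  also have "\<dots> = (\<Sum>i<Suc (length us). - (w \<bullet>c (u # us) ! i) / ((u # us) ! i \<bullet>c (u # us) ! i) * (u # us) ! i $ k)"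
    using Cons by (subst sum.lessThan_Suc_shift) simp
  finally show ?case by simp
qed simp

text \<open>The accumulator \<open>us\<close> is stored in reverse. In \<open>full\<close>, which
  lists the vectors in order of creation, each new vector subtracts its components along all earlier
  ones, a form that survives the recursion.\<close>

lemma gram_schmidt_sub2_index:
  fixes us ws :: "complex Matrix.vec list"
  assumes "set us \<subseteq> carrier_vec n" "set ws \<subseteq> carrier_vec n"
  defines "full \<equiv> rev us @ gram_schmidt_sub2 n us ws"
  shows "length (gram_schmidt_sub2 n us ws) = length ws \<and> set full \<subseteq> carrier_vec n \<and>
    (\<forall>j<length ws. \<forall>k<n. full ! (length us + j) $ k = ws ! j $ k +
       (\<Sum>i<length us + j. - (ws ! j \<bullet>c full ! i) / (full ! i \<bullet>c full ! i) * full ! i $ k))"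
  using assms(1,2) unfolding full_def
proof (induction ws arbitrary: us)
  case (Cons w ws)
  define u where "u = adjuster n w us + w"
  have a: "adjuster n w us \<in> carrier_vec n" using Cons.prems by (intro adjuster_carrier_vec)
  have w: "w \<in> carrier_vec n" using Cons.prems by simp
  have u: "u \<in> carrier_vec n" using a w by (simp add: u_def)
  have uus: "set (u # us) \<subseteq> carrier_vec n" using u Cons.prems by simp
  have e: "gram_schmidt_sub2 n us (w # ws) = u # gram_schmidt_sub2 n (u # us) ws" unfolding u_def gram_schmidt_sub2.simps Let_def ..
  define fl where "fl = rev us @ gram_schmidt_sub2 n us (w # ws)"
  have fl: "fl = rev (u # us) @ gram_schmidt_sub2 n (u # us) ws" unfolding fl_def e by simp
  have IH: "length (gram_schmidt_sub2 n (u # us) ws) = length ws" "set fl \<subseteq> carrier_vec n"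
    "\<And>j k. j < length ws \<Longrightarrow> k < n \<Longrightarrow> fl ! (Suc (length us) + j) $ k = ws ! j $ k +
       (\<Sum>i<Suc (length us) + j. - (ws ! j \<bullet>c fl ! i) / (fl ! i \<bullet>c fl ! i) * fl ! i $ k)"
    using Cons.IH[OF uus] Cons.prems(2) unfolding fl by auto
  have "fl ! (length us + j) $ k = (w # ws) ! j $ k +
       (\<Sum>i<length us + j. - ((w # ws) ! j \<bullet>c fl ! i) / (fl ! i \<bullet>c fl ! i) * fl ! i $ k)"
    if j: "j < length (w # ws)" and k: "k < n" for j k
  proof (cases j)
    case 0
    have "fl ! length us = u" unfolding fl by (simp add: nth_append)
    then have "fl ! length us $ k = adjuster n w us $ k + w $ k" using w k by (simp add: u_def)
    also have "adjuster n w us $ k = (\<Sum>i<length us. - (w \<bullet>c us ! i) / (us ! i \<bullet>c us ! i) * us ! i $ k)"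
      using Cons.prems(1) k by (rule adjuster_index)
    also have "\<dots> = (\<Sum>i<length us. - (w \<bullet>c rev us ! i) / (rev us ! i \<bullet>c rev us ! i) * rev us ! i $ k)"
      by (rule sum.reindex_bij_witness[of _ "\<lambda>i. length us - Suc i" "\<lambda>i. length us - Suc i"]) (auto simp: rev_nth)
    also have "\<dots> = (\<Sum>i<length us. - (w \<bullet>c fl ! i) / (fl ! i \<bullet>c fl ! i) * fl ! i $ k)"
      unfolding fl_def by (intro sum.cong refl) (simp add: nth_append)
    finally show ?thesis using 0 by (simp add: add.commute)
  next
    case (Suc j')
    then show ?thesis using IH(3)[of j' k] j k by simp
  qed
  moreover have "length (gram_schmidt_sub2 n us (w # ws)) = length (w # ws)" unfolding e using IH(1) by simp
  ultimately show ?case using IH(2) unfolding fl_def[symmetric] by blast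
qed (auto)

lemma gram_schmidt_index:
  fixes ws :: "complex Matrix.vec list"
  assumes "set ws \<subseteq> carrier_vec n"
  defines "hs \<equiv> gram_schmidt n ws"
  shows "length hs = length ws" "set hs \<subseteq> carrier_vec n"
    "j < length ws \<Longrightarrow> k < n \<Longrightarrow> hs ! j $ k = ws ! j $ k + (\<Sum>i<j. - (ws ! j \<bullet>c hs ! i) / (hs ! i \<bullet>c hs ! i) * hs ! i $ k)"
proof -
  note s = gram_schmidt_sub2_index[of "[]" n ws, unfolded rev.simps append_Nil list.size add_0 list.set, OF empty_subsetI assms(1), folded gram_schmidt_code]
  show "length hs = length ws" "set hs \<subseteq> carrier_vec n"
    "j < length ws \<Longrightarrow> k < n \<Longrightarrow> hs ! j $ k = ws ! j $ k + (\<Sum>i<j. - (ws ! j \<bullet>c hs ! i) / (hs ! i \<bullet>c hs ! i) * hs ! i $ k)"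
    using s unfolding hs_def by blast+
qed

lemma tendsto_kronecker_sum:
  fixes c :: "'a \<Rightarrow> nat \<Rightarrow> complex"
  assumes "\<And>l. l < r \<Longrightarrow> ((\<lambda>n. c n l) \<longlongrightarrow> (if l = j then 1 else 0)) F" "\<And>l. l < r \<Longrightarrow> ((\<lambda>n. x n l) \<longlongrightarrow> y l) F" "j < r"
  shows "((\<lambda>n. \<Sum>l<r. c n l * x n l) \<longlongrightarrow> y j) F"
proof -
  have "((\<lambda>n. \<Sum>l<r. c n l * x n l) \<longlongrightarrow> (\<Sum>l<r. (if l = j then 1 else 0) * y l)) F"
    using assms by (intro tendsto_sum tendsto_mult) auto
  also have "(\<Sum>l<r. (if l = j then 1 else 0) * y l) = y j"
    using assms(3) by (simp add: if_distrib[where f="\<lambda>a. a * _"] cong: if_cong)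
  finally show ?thesis .
qed

lemma gram_one: "gram n A (1\<^sub>m n) B i j = (\<Sum>k<n. cnj (A $$ (k, i)) * B $$ (k, j))"
  unfolding gram_def
  by (intro sum.cong refl) (simp add: if_distrib[where f="\<lambda>a. a * _"] if_distrib[where f="\<lambda>a. _ * a"] cong: if_cong)

text \<open>The Gram matrix divided by n tends to the identity, so orthogonalization adds only
  vanishing multiples of earlier columns and normalization amounts to division by sqrt n. Thus U = G
  T / sqrt n, with T of fixed size tending to the identity.\<close>

lemma gram_schmidt_coefficients:
  fixes G U :: "nat \<Rightarrow> complex mat"
  assumes G: "\<And>n. G n \<in> carrier_mat n r"
    and lim: "\<And>i j. i < r \<Longrightarrow> j < r \<Longrightarrow> (\<lambda>n. gram n (G n) (1\<^sub>m n) (G n) i j / of_nat n) \<longlonglongrightarrow> (if i = j then 1 else 0)"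
    and gs: "\<And>n. gram_schmidt_columns n (G n) (U n)"
  shows "\<exists>t. (\<forall>l<r. \<forall>j<r. (\<lambda>n. t n l j) \<longlonglongrightarrow> (if l = j then 1 else 0)) \<and>
     (\<forall>\<^sub>F n in sequentially. \<forall>k<n. \<forall>j<r. U n $$ (k, j) = (\<Sum>l<r. t n l j * G n $$ (k, l)) / complex_of_real (sqrt (real n)))"
proof -
  define h where "h = (\<lambda>n j. gram_schmidt n (cols (G n)) ! j)"
  define gm where "gm = (\<lambda>n i j. \<Sum>k<n. cnj (G n $$ (k, i)) * G n $$ (k, j))"
  have gml: "(\<lambda>n. gm n i j / of_nat n) \<longlonglongrightarrow> (if i = j then 1 else 0)" if "i < r" "j < r" for i j
    using lim[OF that] unfolding gram_one gm_def .
  have dimG: "dim_row (G n) = n" "dim_col (G n) = r" for n using G[of n] by auto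
  have cc: "set (cols (G n)) \<subseteq> carrier_vec n" for n using cols_dim[of "G n"] dimG by simp
  have len: "length (cols (G n)) = r" for n by (simp add: dimG)
  have colsn: "cols (G n) ! j = col (G n) j" if "j < r" for n j using that by (simp add: dimG)
  note gi = gram_schmidt_index[OF cc]
  have hc: "h n j \<in> carrier_vec n" if "j < r" for n j
  proof -
    have "gram_schmidt n (cols (G n)) ! j \<in> set (gram_schmidt n (cols (G n)))"
      by (rule nth_mem) (simp only: gi(1) len that)
    then show ?thesis using gi(2)[of n] unfolding h_def by blast
  qed
  have hi: "h n j $ k = G n $$ (k, j) + (\<Sum>i<j. - (col (G n) j \<bullet>c h n i) / (h n i \<bullet>c h n i) * h n i $ k)"
    if "j < r" "k < n" for n j k
    using gi(3)[of j n k] that colsn[OF that(1)] by (simp add: len h_def dimG)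
  \<comment> \<open>\<tau> holds the coefficients of the j-th orthogonalized vector in the columns
    of \<open>G\<close>. The identity is demanded for every n; the recurrence keeps it even at a
    zero denominator, where the quotient is 0.\<close>
  define good where "good = (\<lambda>j \<tau>. (\<forall>l<r. (\<lambda>n. \<tau> n l) \<longlonglongrightarrow> (if l = j then 1 else (0::complex))) \<and> (\<forall>n. \<forall>k<n. h n j $ k = (\<Sum>l<r. \<tau> n l * G n $$ (k, l))))"
  have dot: "(\<lambda>n. (col (G n) j' \<bullet>c h n j) / of_nat n) \<longlonglongrightarrow> (if j = j' then 1 else 0)"
    "(\<lambda>n. (h n j \<bullet>c h n j) / of_nat n) \<longlonglongrightarrow> 1" if g: "good j \<tau>" and j: "j < r" "j' < r" for j j' \<tau>
  proof -
    have t: "\<And>l. l < r \<Longrightarrow> (\<lambda>n. \<tau> n l) \<longlonglongrightarrow> (if l = j then 1 else 0)" and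
      e: "\<And>n k. k < n \<Longrightarrow> h n j $ k = (\<Sum>l<r. \<tau> n l * G n $$ (k, l))" using g by (auto simp: good_def)
    have tc: "(\<lambda>n. cnj (\<tau> n l)) \<longlonglongrightarrow> (if l = j then 1 else 0)" if "l < r" for l
      using tendsto_cnj[OF t[OF that]] by (auto split: if_splits)
    have d1: "(col (G n) i \<bullet>c h n j) / of_nat n = (\<Sum>l<r. cnj (\<tau> n l) * (gm n l i / of_nat n))" if i: "i < r" for n i
    proof -
      have "col (G n) i \<bullet>c h n j = (\<Sum>k<n. G n $$ (k, i) * cnj (\<Sum>l<r. \<tau> n l * G n $$ (k, l)))"
        using carrier_vecD[OF hc[OF j(1)]] i by (simp add: scalar_prod_def atLeast0LessThan e dimG)
      also have "\<dots> = (\<Sum>k<n. \<Sum>l<r. cnj (\<tau> n l) * (cnj (G n $$ (k, l)) * G n $$ (k, i)))"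
        by (simp add: sum_distrib_left mult_ac)
      also have "\<dots> = (\<Sum>l<r. \<Sum>k<n. cnj (\<tau> n l) * (cnj (G n $$ (k, l)) * G n $$ (k, i)))" by (rule sum.swap)
      finally show ?thesis by (simp add: gm_def sum_distrib_left sum_divide_distrib)
    qed
    have D: "(\<lambda>n. (col (G n) i \<bullet>c h n j) / of_nat n) \<longlonglongrightarrow> (if j = i then 1 else 0)" if i: "i < r" for i
      unfolding d1[OF i] by (rule tendsto_kronecker_sum[where y = "\<lambda>l. if l = i then 1 else 0", OF tc gml[OF _ i] j(1)])
    show "(\<lambda>n. (col (G n) j' \<bullet>c h n j) / of_nat n) \<longlonglongrightarrow> (if j = j' then 1 else 0)" by (rule D[OF j(2)])
    have d2: "(h n j \<bullet>c h n j) / of_nat n = (\<Sum>l<r. \<tau> n l * ((col (G n) l \<bullet>c h n j) / of_nat n))" for n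
    proof -
      have "h n j \<bullet>c h n j = (\<Sum>k<n. (\<Sum>l<r. \<tau> n l * G n $$ (k, l)) * cnj (h n j $ k))"
        using carrier_vecD[OF hc[OF j(1), of n]] by (simp add: scalar_prod_def atLeast0LessThan e[symmetric])
      also have "\<dots> = (\<Sum>k<n. \<Sum>l<r. \<tau> n l * (G n $$ (k, l) * cnj (h n j $ k)))"
        by (simp add: sum_distrib_left sum_distrib_right mult_ac)
      also have "\<dots> = (\<Sum>l<r. \<Sum>k<n. \<tau> n l * (G n $$ (k, l) * cnj (h n j $ k)))" by (rule sum.swap)
      also have "\<dots> = (\<Sum>l<r. \<tau> n l * (col (G n) l \<bullet>c h n j))"
        using carrier_vecD[OF hc[OF j(1), of n]] by (simp add: scalar_prod_def atLeast0LessThan sum_distrib_left dimG)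
      finally show ?thesis by (simp add: sum_divide_distrib)
    qed
    show "(\<lambda>n. (h n j \<bullet>c h n j) / of_nat n) \<longlonglongrightarrow> 1"
      unfolding d2 using tendsto_kronecker_sum[where y = "\<lambda>i. if j = i then 1 else 0", OF t D j(1)] by simp
  qed
  have ex: "j < r \<Longrightarrow> \<exists>\<tau>. good j \<tau>" for j
  proof (induction j rule: less_induct)
    case (less j)
    then have "\<forall>i\<in>{..<j}. \<exists>\<tau>. good i \<tau>" by auto
    from bchoice[OF this] obtain T where T: "\<And>i. i < j \<Longrightarrow> good i (T i)" by auto
    \<comment> \<open>Projection coefficients: divided by n, numerator and denominator tend to 0 and
      1.\<close>
    define \<alpha> where "\<alpha> = (\<lambda>n i. - (col (G n) j \<bullet>c h n i) / (h n i \<bullet>c h n i))"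
    have \<alpha>: "(\<lambda>n. \<alpha> n i) \<longlonglongrightarrow> 0" if i: "i < j" for i
    proof -
      have "(\<lambda>n. - ((col (G n) j \<bullet>c h n i) / of_nat n) / ((h n i \<bullet>c h n i) / of_nat n)) \<longlonglongrightarrow> - 0 / 1"
        using dot[OF T[OF i], of j] i less.prems by (intro tendsto_divide tendsto_minus) auto
      moreover have "\<forall>\<^sub>F n in sequentially. - ((col (G n) j \<bullet>c h n i) / of_nat n) / ((h n i \<bullet>c h n i) / of_nat n) = \<alpha> n i"
        using eventually_gt_at_top[of 0] by eventually_elim (auto simp: \<alpha>_def)
      ultimately show ?thesis using Lim_transform_eventually by fastforce
    qed
    define \<tau> where "\<tau> = (\<lambda>n l. (if l = j then 1 else 0) + (\<Sum>i<j. \<alpha> n i * T i n l))"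
    have "good j \<tau>" unfolding good_def
    proof (intro conjI allI impI)
      fix l assume l: "l < r"
      have "(\<lambda>n. \<tau> n l) \<longlonglongrightarrow> (if l = j then 1 else 0) + (\<Sum>i<j. 0 * (if l = i then 1 else 0))"
        unfolding \<tau>_def using T l by (intro tendsto_add tendsto_const tendsto_sum tendsto_mult \<alpha>) (auto simp: good_def)
      then show "(\<lambda>n. \<tau> n l) \<longlonglongrightarrow> (if l = j then 1 else 0)" by simp
    next
      fix n k :: nat assume k: "k < n"
      have "h n j $ k = G n $$ (k, j) + (\<Sum>i<j. \<alpha> n i * h n i $ k)"
        using hi[OF less.prems k] by (simp add: \<alpha>_def)
      also have "\<dots> = G n $$ (k, j) + (\<Sum>i<j. \<alpha> n i * (\<Sum>l<r. T i n l * G n $$ (k, l)))"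
        using T k by (intro arg_cong2[where f="(+)"] refl sum.cong) (auto simp: good_def)
      also have "(\<Sum>i<j. \<alpha> n i * (\<Sum>l<r. T i n l * G n $$ (k, l))) = (\<Sum>i<j. \<Sum>l<r. \<alpha> n i * T i n l * G n $$ (k, l))"
        by (simp add: sum_distrib_left mult_ac)
      also have "\<dots> = (\<Sum>l<r. \<Sum>i<j. \<alpha> n i * T i n l * G n $$ (k, l))" by (rule sum.swap)
      also have "G n $$ (k, j) = (\<Sum>l<r. (if l = j then 1 else 0) * G n $$ (k, l))"
        using less.prems by (simp add: if_distrib[where f="\<lambda>a. a * _"] cong: if_cong)
      also have "(\<Sum>l<r. (if l = j then 1 else 0) * G n $$ (k, l)) + (\<Sum>l<r. \<Sum>i<j. \<alpha> n i * T i n l * G n $$ (k, l)) = (\<Sum>l<r. \<tau> n l * G n $$ (k, l))"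
        by (simp only: \<tau>_def distrib_right sum.distrib sum_distrib_right)
      finally show "h n j $ k = (\<Sum>l<r. \<tau> n l * G n $$ (k, l))" .
    qed
    then show ?case by blast
  qed
  have "\<forall>j\<in>{..<r}. \<exists>\<tau>. good j \<tau>" using ex by simp
  from bchoice[OF this] obtain T where T: "\<And>j. j < r \<Longrightarrow> good j (T j)" by auto
  define c where "c = (\<lambda>n j. complex_of_real (1 / sqrt (Re ((h n j \<bullet>c h n j) / of_nat n))))"
  have c: "(\<lambda>n. c n j) \<longlonglongrightarrow> 1" if j: "j < r" for j
  proof -
    have "(\<lambda>n. c n j) \<longlonglongrightarrow> complex_of_real (1 / sqrt (Re 1))"
      unfolding c_def using dot(2)[OF T[OF j] j j]
      by (intro tendsto_of_real tendsto_divide tendsto_const tendsto_real_sqrt tendsto_Re) auto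
    then show ?thesis by simp
  qed
  define t where "t = (\<lambda>n l j. c n j * T j n l)"
  show ?thesis
  proof (intro exI[of _ t] conjI allI impI)
    fix l j assume lj: "l < r" "j < r"
    have "(\<lambda>n. t n l j) \<longlonglongrightarrow> 1 * (if l = j then 1 else 0)"
      unfolding t_def using T[OF lj(2)] lj by (intro tendsto_mult c) (auto simp: good_def)
    then show "(\<lambda>n. t n l j) \<longlonglongrightarrow> (if l = j then 1 else 0)" by simp
  next
    \<comment> \<open>Eventually no orthogonalized vector is zero, which excludes the case of an
      arbitrary \<open>U\<close>.\<close>
    have "\<forall>\<^sub>F n in sequentially. \<forall>j\<in>{..<r}. h n j \<bullet>c h n j \<noteq> 0"
    proof (intro eventually_ball_finite ballI)
      fix j assume "j \<in> {..<r}"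
      then have j: "j < r" by simp
      have "\<forall>\<^sub>F n in sequentially. (h n j \<bullet>c h n j) / of_nat n \<noteq> 0"
        by (rule tendsto_imp_eventually_ne[OF dot(2)[OF T[OF j] j j]]) simp
      then show "\<forall>\<^sub>F n in sequentially. h n j \<bullet>c h n j \<noteq> 0" by eventually_elim auto
    qed simp
    then show "\<forall>\<^sub>F n in sequentially. \<forall>k<n. \<forall>j<r. U n $$ (k, j) = (\<Sum>l<r. t n l j * G n $$ (k, l)) / complex_of_real (sqrt (real n))"
      using eventually_gt_at_top[of 0]
    proof (eventually_elim, intro allI impI)
      fix n k j assume ne: "\<forall>j\<in>{..<r}. h n j \<bullet>c h n j \<noteq> 0" and n: "0 < n" and k: "k < n" and j: "j < r"
      have lenh: "length (gram_schmidt n (cols (G n))) = r" using gi(1)[of n] len by simp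
      have "0\<^sub>v n \<notin> set (gram_schmidt n (cols (G n)))"
      proof
        assume "0\<^sub>v n \<in> set (gram_schmidt n (cols (G n)))"
        then obtain i where "i < r" "h n i = 0\<^sub>v n" unfolding h_def in_set_conv_nth lenh by auto
        then have "h n i \<bullet>c h n i = 0" by (simp add: scalar_prod_def)
        then show False using ne \<open>i < r\<close> by auto
      qed
      then have U: "U n = mat_of_cols n (map normalize_cvec (gram_schmidt n (cols (G n))))"
        using gs[of n] by (simp add: gram_schmidt_columns_def)
      have "U n $$ (k, j) = normalize_cvec (h n j) $ k"
        unfolding U using k j lenh by (subst mat_of_cols_index) (auto simp: h_def)
      also have "\<dots> = complex_of_real (1 / sqrt (Re (h n j \<bullet>c h n j))) * h n j $ k"
        using carrier_vecD[OF hc[OF j, of n]] k by (simp add: normalize_cvec_def)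
      also have "complex_of_real (1 / sqrt (Re (h n j \<bullet>c h n j))) = c n j / complex_of_real (sqrt (real n))"
      proof -
        have "Re ((h n j \<bullet>c h n j) / of_nat n) = Re (h n j \<bullet>c h n j) / real n"
          using Re_divide_of_real[of "h n j \<bullet>c h n j" "real n"] by simp
        then show ?thesis using n unfolding c_def by (simp add: real_sqrt_divide)
      qed
      also have "h n j $ k = (\<Sum>l<r. T j n l * G n $$ (k, l))" using T[OF j] k by (simp add: good_def)
      also have "c n j / complex_of_real (sqrt (real n)) * (\<Sum>l<r. T j n l * G n $$ (k, l)) = (\<Sum>l<r. t n l j * G n $$ (k, l)) / complex_of_real (sqrt (real n))"
        by (simp add: t_def sum_distrib_left sum_divide_distrib mult_ac)
      finally show "U n $$ (k, j) = (\<Sum>l<r. t n l j * G n $$ (k, l)) / complex_of_real (sqrt (real n))" .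
    qed
  qed
qed

text \<open>By bilinearity, pairings of combinations are combinations of pairings, with coefficients
  tending to those of the identity. The two factors 1 / sqrt n produce the division by n.\<close>

lemma gram_tendsto_of_coefficients:
  fixes A B GA GB E :: "nat \<Rightarrow> complex mat"
  assumes tA: "\<And>l j. l < r \<Longrightarrow> j < r \<Longrightarrow> (\<lambda>n. tA n l j) \<longlonglongrightarrow> (if l = j then 1 else (0::complex))"
    and tB: "\<And>l j. l < r \<Longrightarrow> j < r \<Longrightarrow> (\<lambda>n. tB n l j) \<longlonglongrightarrow> (if l = j then 1 else (0::complex))"
    and A: "\<forall>\<^sub>F n in sequentially. \<forall>k<n. \<forall>j<r. A n $$ (k, j) = (\<Sum>l<r. tA n l j * GA n $$ (k, l)) / complex_of_real (sqrt (real n))"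
    and B: "\<forall>\<^sub>F n in sequentially. \<forall>k<n. \<forall>j<r. B n $$ (k, j) = (\<Sum>l<r. tB n l j * GB n $$ (k, l)) / complex_of_real (sqrt (real n))"
    and lim: "\<And>i j. i < r \<Longrightarrow> j < r \<Longrightarrow> (\<lambda>n. gram n (GA n) (E n) (GB n) i j / of_nat n) \<longlonglongrightarrow> y i j"
    and ij: "i < r" "j < r"
  shows "(\<lambda>n. gram n (A n) (E n) (B n) i j) \<longlonglongrightarrow> y i j"
proof -
  define S where "S = (\<lambda>n. \<Sum>l<r. cnj (tA n l i) * (\<Sum>l'<r. tB n l' j * (gram n (GA n) (E n) (GB n) l l' / of_nat n)))"
  have "S \<longlonglongrightarrow> y i j" unfolding S_def
  proof (rule tendsto_kronecker_sum[where y = "\<lambda>l. y l j", OF _ _ ij(1)])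
    fix l assume l: "l < r"
    show "(\<lambda>n. cnj (tA n l i)) \<longlonglongrightarrow> (if l = i then 1 else 0)"
      using tendsto_cnj[OF tA[OF l ij(1)]] by (auto split: if_splits)
    show "(\<lambda>n. \<Sum>l'<r. tB n l' j * (gram n (GA n) (E n) (GB n) l l' / of_nat n)) \<longlonglongrightarrow> y l j"
      by (rule tendsto_kronecker_sum[where y = "\<lambda>l'. y l l'", OF tB[OF _ ij(2)] lim[OF l] ij(2)])
  qed
  moreover have "\<forall>\<^sub>F n in sequentially. S n = gram n (A n) (E n) (B n) i j"
    using A B eventually_gt_at_top[of 0]
  proof eventually_elim
    case (elim n)
    define q where "q = complex_of_real (sqrt (real n))"
    have q: "q * q = of_nat n" "cnj q = q" using elim(3) by (auto simp: q_def simp flip: of_real_mult)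
    have "gram n (A n) (E n) (B n) i j = (\<Sum>k<n. \<Sum>m<n. cnj ((\<Sum>l<r. tA n l i * GA n $$ (k, l)) / q) * E n $$ (k, m) * ((\<Sum>l<r. tB n l j * GB n $$ (m, l)) / q))"
      unfolding gram_def q_def using elim(1,2) ij by (intro sum.cong refl) auto
    also have "\<dots> = (\<Sum>k<n. \<Sum>m<n. (\<Sum>l<r. cnj (tA n l i) * cnj (GA n $$ (k, l))) * E n $$ (k, m) * (\<Sum>l<r. tB n l j * GB n $$ (m, l)) / of_nat n)"
      by (intro sum.cong refl) (simp add: q flip: q(1))
    also have "\<dots> = (\<Sum>k<n. \<Sum>m<n. \<Sum>l<r. \<Sum>l'<r. cnj (tA n l i) * tB n l' j * (cnj (GA n $$ (k, l)) * E n $$ (k, m) * GB n $$ (m, l')) / of_nat n)"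
    proof (intro sum.cong refl)
      fix k m
      have "(\<Sum>l<r. cnj (tA n l i) * cnj (GA n $$ (k, l))) * E n $$ (k, m) * (\<Sum>l<r. tB n l j * GB n $$ (m, l)) / of_nat n
         = E n $$ (k, m) / of_nat n * ((\<Sum>l<r. cnj (tA n l i) * cnj (GA n $$ (k, l))) * (\<Sum>l<r. tB n l j * GB n $$ (m, l)))" by simp
      also have "\<dots> = (\<Sum>l<r. \<Sum>l'<r. E n $$ (k, m) / of_nat n * (cnj (tA n l i) * cnj (GA n $$ (k, l)) * (tB n l' j * GB n $$ (m, l'))))"
        by (subst sum_product) (simp only: sum_distrib_left)
      finally show "(\<Sum>l<r. cnj (tA n l i) * cnj (GA n $$ (k, l))) * E n $$ (k, m) * (\<Sum>l<r. tB n l j * GB n $$ (m, l)) / of_nat n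
         = (\<Sum>l<r. \<Sum>l'<r. cnj (tA n l i) * tB n l' j * (cnj (GA n $$ (k, l)) * E n $$ (k, m) * GB n $$ (m, l')) / of_nat n)"
        by (simp add: mult_ac)
    qed
    also have "\<dots> = (\<Sum>k<n. \<Sum>l<r. \<Sum>m<n. \<Sum>l'<r. cnj (tA n l i) * tB n l' j * (cnj (GA n $$ (k, l)) * E n $$ (k, m) * GB n $$ (m, l')) / of_nat n)"
      by (rule sum.cong[OF refl], rule sum.swap)
    also have "\<dots> = (\<Sum>l<r. \<Sum>k<n. \<Sum>m<n. \<Sum>l'<r. cnj (tA n l i) * tB n l' j * (cnj (GA n $$ (k, l)) * E n $$ (k, m) * GB n $$ (m, l')) / of_nat n)"
      by (rule sum.swap)
    also have "\<dots> = (\<Sum>l<r. \<Sum>k<n. \<Sum>l'<r. \<Sum>m<n. cnj (tA n l i) * tB n l' j * (cnj (GA n $$ (k, l)) * E n $$ (k, m) * GB n $$ (m, l')) / of_nat n)"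
      by (rule sum.cong[OF refl], rule sum.cong[OF refl], rule sum.swap)
    also have "\<dots> = (\<Sum>l<r. \<Sum>l'<r. \<Sum>k<n. \<Sum>m<n. cnj (tA n l i) * tB n l' j * (cnj (GA n $$ (k, l)) * E n $$ (k, m) * GB n $$ (m, l')) / of_nat n)"
      by (rule sum.cong[OF refl], rule sum.swap)
    also have "\<dots> = S n"
      unfolding S_def gram_def by (simp add: sum_distrib_left sum_divide_distrib mult_ac)
    finally show ?case by simp
  qed
  ultimately show ?thesis by (rule Lim_transform_eventually)
qed

subsection \<open>The limit law and its edge\<close>

text \<open>The complement of the support is a union of open null sets, and Lindelof's theorem makes
  the union countable.\<close>

lemma AE_in_measure_support:
  fixes \<mu> :: "'a::second_countable_topology measure"
  assumes "sets \<mu> = sets borel"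
  shows "AE x in \<mu>. x \<in> measure_support \<mu>"
proof -
  define \<U> where "\<U> = {U :: 'a set. open U \<and> emeasure \<mu> U = 0}"
  have "\<And>U. U \<in> \<U> \<Longrightarrow> open U" by (simp add: \<U>_def)
  then obtain \<V> where V: "\<V> \<subseteq> \<U>" "countable \<V>" "\<Union>\<V> = \<Union>\<U>" using Lindelof by metis
  have "\<Union>\<V> \<in> null_sets \<mu>"
    using V(1,2) assms by (intro null_sets_UN'[of \<V> "\<lambda>x. x" \<mu>, simplified]) (auto simp: \<U>_def null_sets_def)
  then show ?thesis
    by (rule AE_I') (auto simp: measure_support_def V(3) \<U>_def not_gr_zero)
qed

locale edge_law = prob_space \<mu> for \<mu> :: "real measure" +
  fixes a :: real
  assumes sets_mu[measurable_cong]: "sets \<mu> = sets borel"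
    and comp: "compact (measure_support \<mu>)"
    and a_def: "a = Inf (measure_support \<mu>)" and a_pos: "a > 0"
begin

lemma support_nonempty: "measure_support \<mu> \<noteq> {}"
proof
  assume "measure_support \<mu> = {}"
  then have "AE x in \<mu>. False" using AE_in_measure_support[OF sets_mu] by simp
  then show False by simp
qed

lemma AE_ge: "AE x in \<mu>. a \<le> x"
  using AE_in_measure_support[OF sets_mu]
proof eventually_elim
  case (elim x)
  then show ?case unfolding a_def using comp
    by (intro cInf_lower bounded_imp_bdd_below compact_imp_bounded)
qed

lemma edge_in_support: "a \<in> measure_support \<mu>"
  unfolding a_def using comp support_nonempty
  by (intro closed_contains_Inf bounded_imp_bdd_below compact_imp_bounded compact_imp_closed)

definition "m z = (\<integral>t. 1 / (t\<^sup>2 - z\<^sup>2) \<partial>\<mu>)"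

lemma diff_pos: "0 < z \<Longrightarrow> z < a \<Longrightarrow> a \<le> t \<Longrightarrow> 0 < a\<^sup>2 - z\<^sup>2 \<and> a\<^sup>2 - z\<^sup>2 \<le> t\<^sup>2 - z\<^sup>2"
proof -
  assume "0 < z" "z < a" "a \<le> t"
  then have "z\<^sup>2 < a\<^sup>2" "a\<^sup>2 \<le> t\<^sup>2" by (auto intro!: power_strict_mono power_mono)
  then show ?thesis by simp
qed

lemma integrable_bounded_on_edge:
  fixes f :: "real \<Rightarrow> real"
  assumes "f \<in> borel_measurable borel" "\<And>t. a \<le> t \<Longrightarrow> \<bar>f t\<bar> \<le> B"
  shows "integrable \<mu> f"
proof (rule integrable_const_bound[of _ B])
  show "AE x in \<mu>. norm (f x) \<le> B" using AE_ge by eventually_elim (use assms(2) in auto)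
qed (use assms(1) in measurable)

lemma integrable_m:
  assumes "0 < z" "z < a"
  shows "integrable \<mu> (\<lambda>t. 1 / (t\<^sup>2 - z\<^sup>2))"
proof (rule integrable_bounded_on_edge[of _ "1 / (a\<^sup>2 - z\<^sup>2)"])
  fix t assume "a \<le> t"
  then have "0 < a\<^sup>2 - z\<^sup>2" "a\<^sup>2 - z\<^sup>2 \<le> t\<^sup>2 - z\<^sup>2" using diff_pos[OF assms] by blast+
  then show "\<bar>1 / (t\<^sup>2 - z\<^sup>2)\<bar> \<le> 1 / (a\<^sup>2 - z\<^sup>2)" by (simp add: abs_of_pos frac_le)
qed measurable

lemma phi_eq_integral: "phi \<mu> z = - (\<integral>t. z * (1 / (t\<^sup>2 - z\<^sup>2)) \<partial>\<mu>)"
proof -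
  have "z / (z\<^sup>2 - t\<^sup>2) = - (z * (1 / (t\<^sup>2 - z\<^sup>2)))" for t
  proof -
    have e: "z\<^sup>2 - t\<^sup>2 = - (t\<^sup>2 - z\<^sup>2)" by simp
    show ?thesis unfolding e minus_divide_right[symmetric] by simp
  qed
  then show ?thesis unfolding phi_def by (simp only: integral_minus)
qed

lemma phi_eq: "phi \<mu> z = - z * m z"
  unfolding phi_eq_integral integral_mult_right_zero m_def by simp

lemma integrable_phi: "0 < z \<Longrightarrow> z < a \<Longrightarrow> integrable \<mu> (\<lambda>t. z * (1 / (t\<^sup>2 - z\<^sup>2)))"
  using integrable_m by (intro integrable_mult_right)

lemma m_pos: assumes "0 < z" "z < a" shows "m z > 0"
proof -
  have "(\<integral>t. 0 \<partial>\<mu>) < (\<integral>t. 1 / (t\<^sup>2 - z\<^sup>2) \<partial>\<mu>)"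
  proof (rule integral_less_AE_space)
    show "AE t in \<mu>. 0 < 1 / (t\<^sup>2 - z\<^sup>2)" using AE_ge by eventually_elim (use diff_pos[OF assms] in force)
  qed (use integrable_m[OF assms] emeasure_space_1 in auto)
  then show ?thesis by (simp add: m_def)
qed

lemma phi_strict_antimono:
  assumes "0 < z" "z < w" "w < a"
  shows "phi \<mu> w < phi \<mu> z"
proof -
  have "(\<integral>t. z * (1 / (t\<^sup>2 - z\<^sup>2)) \<partial>\<mu>) < (\<integral>t. w * (1 / (t\<^sup>2 - w\<^sup>2)) \<partial>\<mu>)"
  proof (rule integral_less_AE_space)
    show "AE t in \<mu>. z * (1 / (t\<^sup>2 - z\<^sup>2)) < w * (1 / (t\<^sup>2 - w\<^sup>2))"
      using AE_ge
    proof eventually_elim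
      case (elim t)
      have "z\<^sup>2 < w\<^sup>2" using assms by (intro power_strict_mono) auto
      moreover have "0 < t\<^sup>2 - w\<^sup>2" using diff_pos[of w t] assms elim by linarith
      ultimately have "1 / (t\<^sup>2 - z\<^sup>2) < 1 / (t\<^sup>2 - w\<^sup>2)" by (intro divide_strict_left_mono mult_pos_pos) auto
      then have "z * (1 / (t\<^sup>2 - z\<^sup>2)) < z * (1 / (t\<^sup>2 - w\<^sup>2))" using assms(1) by (rule mult_strict_left_mono)
      also have "\<dots> \<le> w * (1 / (t\<^sup>2 - w\<^sup>2))" using assms \<open>0 < t\<^sup>2 - w\<^sup>2\<close> by (intro mult_right_mono) auto
      finally show ?case .
    qed
  qed (use integrable_phi[of z] integrable_phi[of w] assms emeasure_space_1 in auto)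
  then show ?thesis unfolding phi_eq_integral by linarith
qed

text \<open>Dominated convergence: for arguments below some b < a the integrands are at most 1 /
  (a^2 - b^2).\<close>

lemma phi_continuous: "continuous_on {0<..<a} (phi \<mu>)"
proof -
  have "continuous_on {0<..<a} (\<lambda>z. - z * m z)"
  proof (intro continuous_intros)
    show "continuous_on {0<..<a} m"
      unfolding continuous_on_sequentially
    proof (intro allI ballI impI, elim conjE)
      fix x z assume z: "z \<in> {0<..<a}" and x: "\<forall>n. x n \<in> {0<..<a}" and lim: "x \<longlonglongrightarrow> z"
      define b where "b = (z + a) / 2"
      have b: "0 < b" "z < b" "b < a" using z by (auto simp: b_def)
      obtain N where N: "\<And>n. n \<ge> N \<Longrightarrow> x n < b"
        using order_tendstoD(2)[OF lim b(2)] unfolding eventually_sequentially by blast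
      have "(\<lambda>n. \<integral>t. 1 / (t\<^sup>2 - (x (n + N))\<^sup>2) \<partial>\<mu>) \<longlonglongrightarrow> (\<integral>t. 1 / (t\<^sup>2 - z\<^sup>2) \<partial>\<mu>)"
      proof (rule integral_dominated_convergence[where w = "\<lambda>_. 1 / (a\<^sup>2 - b\<^sup>2)"])
        show "AE t in \<mu>. (\<lambda>n. 1 / (t\<^sup>2 - (x (n + N))\<^sup>2)) \<longlonglongrightarrow> 1 / (t\<^sup>2 - z\<^sup>2)"
          using AE_ge
        proof eventually_elim
          case (elim t)
          have "t\<^sup>2 - z\<^sup>2 \<noteq> 0" using diff_pos[of z t] z elim by force
          then show ?case using LIMSEQ_ignore_initial_segment[OF lim, of N] by (intro tendsto_intros)
        qed
        show "AE t in \<mu>. norm (1 / (t\<^sup>2 - (x (n + N))\<^sup>2)) \<le> 1 / (a\<^sup>2 - b\<^sup>2)" for n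
          using AE_ge
        proof eventually_elim
          case (elim t)
          have "0 < x (n + N)" "x (n + N) < b" using x N[of "n + N"] by auto
          then have "(x (n + N))\<^sup>2 \<le> b\<^sup>2" by (intro power_mono) auto
          then have "a\<^sup>2 - b\<^sup>2 \<le> t\<^sup>2 - (x (n + N))\<^sup>2" "0 < a\<^sup>2 - b\<^sup>2" using diff_pos[OF b(1,3) elim] by linarith+
          then show ?case by (auto simp: abs_of_pos intro!: divide_left_mono mult_pos_pos)
        qed
      qed auto
      then show "(m \<circ> x) \<longlonglongrightarrow> m z" unfolding comp_def m_def by (rule LIMSEQ_offset)
    qed
  qed
  then show ?thesis by (simp add: phi_eq[abs_def])
qed

text \<open>On (0, a / 2] the function \<open>m\<close> is at most its value at a / 2, so -phi is at
  most a constant times its argument.\<close>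

lemma phi_near_0:
  assumes "c < 0"
  shows "\<exists>z. 0 < z \<and> z < a \<and> (\<forall>w. 0 < w \<and> w \<le> z \<longrightarrow> c < phi \<mu> w)"
proof -
  define M where "M = m (a / 2)"
  have M: "M > 0" unfolding M_def using a_pos by (intro m_pos) auto
  define z where "z = min (a / 2) (- c / (2 * M))"
  have z: "0 < z" "z \<le> a / 2" using assms M a_pos by (auto simp: z_def divide_neg_pos)
  have c: "c < phi \<mu> w" if w: "0 < w" "w \<le> z" for w
  proof -
    have "m w \<le> M" unfolding m_def M_def
    proof (rule integral_mono_AE)
      show "AE t in \<mu>. 1 / (t\<^sup>2 - w\<^sup>2) \<le> 1 / (t\<^sup>2 - (a / 2)\<^sup>2)"
        using AE_ge
      proof eventually_elim
        case (elim t)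
        have "w\<^sup>2 \<le> (a / 2)\<^sup>2" using w z by (intro power_mono) auto
        moreover have "0 < t\<^sup>2 - (a / 2)\<^sup>2" using diff_pos[of "a / 2" t] a_pos elim by linarith
        ultimately show ?case by (intro divide_left_mono mult_pos_pos) auto
      qed
    qed (use w z a_pos in \<open>auto intro!: integrable_m\<close>)
    then have "w * m w \<le> (- c / (2 * M)) * M" using w z m_pos[of w] a_pos M
      by (intro mult_mono) (auto simp: z_def)
    also have "\<dots> = - c / 2" using M by simp
    finally show ?thesis using assms unfolding phi_eq by simp
  qed
  then show ?thesis using z a_pos by (intro exI[of _ z]) auto
qed

lemma phi_neg: "0 < z \<Longrightarrow> z < a \<Longrightarrow> phi \<mu> z < 0"
  using m_pos[of z] by (simp add: phi_eq)

text \<open>By monotonicity the left limit at a is the infimum over (0, a), possibly minus infinity.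
  Exceeding the threshold therefore means that phi passes below -1 / th before the edge, a criterion
  free of limits and extended reals.\<close>

lemma less_threshold_iff:
  assumes th: "th > 0"
  shows "lower_threshold \<mu> a < ereal th \<longleftrightarrow> (\<exists>z. 0 < z \<and> z < a \<and> phi \<mu> z < - 1 / th)"
proof -
  define L where "L = (INF z\<in>{0<..<a}. ereal (phi \<mu> z))"
  have lt: "((\<lambda>z. ereal (phi \<mu> z)) \<longlongrightarrow> L) (at_left a)"
  proof (rule order_tendstoI)
    fix c assume c: "c < L"
    show "\<forall>\<^sub>F z in at_left a. c < ereal (phi \<mu> z)"
      using eventually_at_left_real[OF a_pos]
    proof eventually_elim
      case (elim z)
      have "L \<le> ereal (phi \<mu> z)" unfolding L_def using elim by (intro INF_lower)
      then show ?case using c by simp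
    qed
  next
    fix c assume "L < c"
    then obtain w where w: "0 < w" "w < a" "ereal (phi \<mu> w) < c" unfolding L_def INF_less_iff by auto
    show "\<forall>\<^sub>F z in at_left a. ereal (phi \<mu> z) < c"
      using eventually_at_left_real[OF w(2)]
    proof eventually_elim
      case (elim z)
      then have "phi \<mu> z < phi \<mu> w" using w by (intro phi_strict_antimono) auto
      then show ?case using w(3) by (meson ereal_less(2) less_ereal.simps(1) order.strict_trans)
    qed
  qed
  have Lim: "Lim (at_left a) (\<lambda>z. ereal (phi \<mu> z)) = L"
    by (rule tendsto_Lim[OF _ lt]) simp
  have L: "L < 0"
  proof -
    have "L \<le> ereal (phi \<mu> (a / 2))" unfolding L_def using a_pos by (intro INF_lower) auto
    also have "\<dots> < 0" using phi_neg[of "a / 2"] a_pos by simp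
    finally show ?thesis .
  qed
  \<comment> \<open>If L is minus infinity the threshold is the inverse of infinity, that is 0, and
    both sides hold.\<close>
  have "lower_threshold \<mu> a < ereal th \<longleftrightarrow> L < ereal (- 1 / th)"
  proof (cases L)
    case (real l)
    then have "l < 0" using L by simp
    then show ?thesis unfolding lower_threshold_def Lim real using th by (simp add: field_simps)
  next
    case MInf
    then show ?thesis unfolding lower_threshold_def Lim using th by simp
  qed (use L in simp)
  also have "\<dots> \<longleftrightarrow> (\<exists>z. 0 < z \<and> z < a \<and> phi \<mu> z < - 1 / th)"
    unfolding L_def INF_less_iff by auto
  finally show ?thesis .
qed

text \<open>phi decreases continuously from values above -1 / th near 0 to one below it, so the
  intermediate value theorem gives a preimage and strict monotonicity its uniqueness.\<close>

lemma phi_inv_props: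
  assumes th: "th > 0" and t: "lower_threshold \<mu> a < ereal th"
  shows "0 < phi_inv \<mu> a (- 1 / th)" "phi_inv \<mu> a (- 1 / th) < a" "phi \<mu> (phi_inv \<mu> a (- 1 / th)) = - 1 / th"
proof -
  obtain w where w: "0 < w" "w < a" "phi \<mu> w < - 1 / th" using less_threshold_iff[OF th] t by blast
  obtain z where z: "0 < z" "z < a" "\<And>x. 0 < x \<Longrightarrow> x \<le> z \<Longrightarrow> - 1 / th < phi \<mu> x"
    using phi_near_0[of "- 1 / th"] th by auto
  have zw: "z < w" using z(3)[of w] w by linarith
  have pz: "- 1 / th \<le> phi \<mu> z" using z(3)[of z] z(1) by linarith
  have "\<exists>x. z \<le> x \<and> x \<le> w \<and> phi \<mu> x = - 1 / th"
  proof (rule IVT2')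
    show "continuous_on {z..w} (phi \<mu>)"
      by (rule continuous_on_subset[OF phi_continuous]) (use z w in auto)
  qed (use pz w(3) zw in linarith)+
  then obtain x where x': "z \<le> x" "x \<le> w" and x2: "phi \<mu> x = - 1 / th" by blast
  have x1: "x \<in> {0<..<a}" using x' z(1) w(2) by simp
  note x = x1 x2
  have inj: "inj_on (phi \<mu>) {0<..<a}"
    by (rule linorder_inj_onI) (use phi_strict_antimono in force)+
  have "phi_inv \<mu> a (- 1 / th) = x"
    unfolding phi_inv_def using x the_inv_into_f_f[OF inj x(1)] by simp
  then show "0 < phi_inv \<mu> a (- 1 / th)" "phi_inv \<mu> a (- 1 / th) < a" "phi \<mu> (phi_inv \<mu> a (- 1 / th)) = - 1 / th"
    using x by auto
qed

section \<open>Empirical singular values under weak convergence\<close>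

lemma integral_sing_val_measure:
  fixes f :: "real \<Rightarrow> real"
  assumes X: "X \<in> carrier_mat n n" "n \<ge> 1" and f: "f \<in> borel_measurable borel"
  shows "(\<integral>t. f t \<partial>sing_val_measure X) = (\<Sum>i<n. f (sing_val X (Suc i))) / real n"
proof -
  have "(\<integral>t. f t \<partial>sing_val_measure X) = (\<integral>i. f (sing_val X i) \<partial>uniform_count_measure {1..n})"
    unfolding sing_val_measure_def using X(1) f by (subst integral_distr) (auto simp: measurable_cong_sets[OF sets_uniform_count_measure_count_space refl])
  also have "\<dots> = (\<Sum>i\<in>{1..n}. f (sing_val X i)) / real n"
    by (simp add: integral_uniform_count_measure)
  also have "(\<Sum>i\<in>{1..n}. f (sing_val X i)) = (\<Sum>i<n. f (sing_val X (Suc i)))"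
    by (rule sum.reindex_bij_witness[of _ Suc "\<lambda>i. i - 1"]) auto
  finally show ?thesis .
qed

lemma sing_val_measure_tendsto:
  fixes f :: "real \<Rightarrow> real"
  assumes X: "\<And>n. X n \<in> carrier_mat n n" and wc: "weak_conv_m (\<lambda>n. sing_val_measure (X n)) \<mu>"
    and f: "continuous_on UNIV f" "\<And>x. \<bar>f x\<bar> \<le> B"
  shows "(\<lambda>n. (\<Sum>i<n. f (sing_val (X n) (Suc i))) / real n) \<longlonglongrightarrow> (\<integral>t. f t \<partial>\<mu>)"
proof (rule LIMSEQ_imp_Suc)
  \<comment> \<open>At n = 0 the empirical measure is not a probability measure, hence the shift by
    one.\<close>
  have rd: "real_distribution (sing_val_measure (X (Suc n)))" for n
  proof -
    interpret U: prob_space "uniform_count_measure {1..Suc n}"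
      by (rule prob_space_uniform_count_measure) auto
    have "prob_space (sing_val_measure (X (Suc n)))"
      unfolding sing_val_measure_def carrier_matD(1)[OF X]
      by (rule U.prob_space_distr) (simp add: measurable_cong_sets[OF sets_uniform_count_measure_count_space refl])
    then show ?thesis unfolding real_distribution_def real_distribution_axioms_def by (simp add: sing_val_measure_def)
  qed
  have rm: "real_distribution \<mu>"
    unfolding real_distribution_def real_distribution_axioms_def using sets_mu prob_space_axioms by auto
  have wc': "weak_conv_m (\<lambda>n. sing_val_measure (X (Suc n))) \<mu>"
    using wc unfolding weak_conv_m_def weak_conv_def by (auto intro: LIMSEQ_Suc)
  have fm: "f \<in> borel_measurable borel" using f(1) by (rule borel_measurable_continuous_onI)
  have "(\<lambda>n. integral\<^sup>L (sing_val_measure (X (Suc n))) f) \<longlonglongrightarrow> integral\<^sup>L \<mu> f"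
    by (rule weak_conv_imp_integral_bdd_continuous_conv[OF rd rm wc', of f B])
      (use f in \<open>auto simp: continuous_on_eq_continuous_at\<close>)
  then show "(\<lambda>n. (\<Sum>i<Suc n. f (sing_val (X (Suc n)) (Suc i))) / real (Suc n)) \<longlonglongrightarrow> (\<integral>t. f t \<partial>\<mu>)"
    by (subst (asm) integral_sing_val_measure[OF X _ fm]) auto
qed

text \<open>The function 1 / (t^2 - z^2) is singular at z, so weak convergence is applied with max t
  s in place of t. This changes nothing almost everywhere for the limit law nor, eventually, at the
  singular values.\<close>

lemma stieltjes_tendsto:
  assumes X: "\<And>n. X n \<in> carrier_mat n n" and wc: "weak_conv_m (\<lambda>n. sing_val_measure (X n)) \<mu>"
    and z: "0 < z" "z < s" "s < a" and ev: "\<forall>\<^sub>F n in sequentially. s \<le> sing_val (X n) n"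
  shows "(\<lambda>n. (\<Sum>i<n. 1 / ((sing_val (X n) (Suc i))\<^sup>2 - z\<^sup>2)) / real n) \<longlonglongrightarrow> m z"
proof -
  define f where "f = (\<lambda>t. 1 / ((max t s)\<^sup>2 - z\<^sup>2))"
  have zs: "z\<^sup>2 < s\<^sup>2" using z by (intro power_strict_mono) auto
  have ms: "s\<^sup>2 \<le> (max t s)\<^sup>2" for t using z by (intro power_mono) auto
  have p: "0 < (max t s)\<^sup>2 - z\<^sup>2" for t using ms[of t] zs by linarith
  have cont: "continuous_on UNIV f" unfolding f_def
    by (intro continuous_intros) (use p in \<open>auto simp: less_imp_neq[symmetric]\<close>)
  have [measurable]: "f \<in> borel_measurable borel" using cont by (rule borel_measurable_continuous_onI)
  have bd: "\<bar>f t\<bar> \<le> 1 / (s\<^sup>2 - z\<^sup>2)" for t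
    using p[of t] ms[of t] zs by (auto simp: f_def abs_of_pos intro!: divide_left_mono mult_pos_pos)
  have "(\<lambda>n. (\<Sum>i<n. f (sing_val (X n) (Suc i))) / real n) \<longlonglongrightarrow> (\<integral>t. f t \<partial>\<mu>)"
    by (rule sing_val_measure_tendsto[OF X wc cont bd])
  moreover have "(\<integral>t. f t \<partial>\<mu>) = m z"
    unfolding m_def
  proof (intro integral_cong_AE)
    show "AE t in \<mu>. f t = 1 / (t\<^sup>2 - z\<^sup>2)" using AE_ge by eventually_elim (use z in \<open>simp add: f_def max_def\<close>)
  qed measurable
  moreover have "\<forall>\<^sub>F n in sequentially. (\<Sum>i<n. f (sing_val (X n) (Suc i))) / real n = (\<Sum>i<n. 1 / ((sing_val (X n) (Suc i))\<^sup>2 - z\<^sup>2)) / real n"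
    using ev
  proof eventually_elim
    case (elim n)
    have "s \<le> sing_val (X n) (Suc i)" if "i < n" for i
      using sing_val_antimono[OF X, of "Suc i" n n] that elim by auto
    then have "max (sing_val (X n) (Suc i)) s = sing_val (X n) (Suc i)" if "i < n" for i
      using that by (simp add: max_absorb1)
    then show ?case by (intro arg_cong2[where f="(/)"] sum.cong refl) (auto simp: f_def)
  qed
  ultimately show ?thesis using Lim_transform_eventually by fastforce
qed

text \<open>The edge belongs to the support, so a positive fraction of the singular values is
  eventually below a + e, which is more than k of them.\<close>

lemma sing_val_near_edge:
  assumes X: "\<And>n. X n \<in> carrier_mat n n" and wc: "weak_conv_m (\<lambda>n. sing_val_measure (X n)) \<mu>"
    and e: "e > 0"
  shows "\<forall>\<^sub>F n in sequentially. sing_val (X n) (n - k) < a + e"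
proof -
  define f where "f = (\<lambda>t. max 0 (min 1 (a + e - t)))"
  have cont: "continuous_on UNIV f" unfolding f_def by (intro continuous_intros)
  have fm[measurable]: "f \<in> borel_measurable borel" using cont by (rule borel_measurable_continuous_onI)
  have lim: "(\<lambda>n. (\<Sum>i<n. f (sing_val (X n) (Suc i))) / real n) \<longlonglongrightarrow> (\<integral>t. f t \<partial>\<mu>)"
    by (rule sing_val_measure_tendsto[OF X wc cont, of 1]) (auto simp: f_def)
  have "integrable \<mu> f" by (rule integrable_bounded_on_edge[OF fm, of 1]) (auto simp: f_def)
  then have "(\<integral>t. f t \<partial>\<mu>) \<noteq> 0"
  proof (subst integral_nonneg_eq_0_iff_AE)
    show "\<not> (AE x in \<mu>. f x = 0)"
    proof
      assume "AE x in \<mu>. f x = 0"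
      then have "AE x in \<mu>. x \<notin> {..<a + e}" by eventually_elim (auto simp: f_def)
      then have "emeasure \<mu> {..<a + e} = 0" by (subst (asm) AE_iff_measurable[of "{..<a + e}"]) (auto simp: sets_eq_imp_space_eq[OF sets_mu] sets_mu)
      moreover have "emeasure \<mu> {..<a + e} > 0"
        using edge_in_support e unfolding measure_support_def by (auto dest!: spec[of _ "{..<a + e}"])
      ultimately show False by simp
    qed
  qed (auto simp: f_def)
  moreover have "(\<integral>t. f t \<partial>\<mu>) \<ge> 0" by (intro integral_nonneg_AE) (auto simp: f_def)
  ultimately have pos: "(\<integral>t. f t \<partial>\<mu>) > 0" by simp
  \<comment> \<open>k singular values contribute at most k / n to the mean.\<close>
  have "(\<lambda>n. (\<Sum>i<n. f (sing_val (X n) (Suc i))) / real n - real k / real n) \<longlonglongrightarrow> (\<integral>t. f t \<partial>\<mu>) - 0"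
    by (intro tendsto_diff lim) real_asymp
  then have "\<forall>\<^sub>F n in sequentially. 0 < (\<Sum>i<n. f (sing_val (X n) (Suc i))) / real n - real k / real n"
    using pos by (intro order_tendstoD(1)) auto
  then show ?thesis using eventually_gt_at_top[of k]
  proof eventually_elim
    case (elim n)
    show ?case
    proof (rule ccontr)
      assume "\<not> sing_val (X n) (n - k) < a + e"
      then have big: "a + e \<le> sing_val (X n) (n - k)" by simp
      have "(\<Sum>i<n. f (sing_val (X n) (Suc i))) \<le> (\<Sum>i<n. if n - k \<le> i then 1 else 0)"
      proof (rule sum_mono)
        fix i assume "i \<in> {..<n}"
        then have i: "i < n" by simp
        show "f (sing_val (X n) (Suc i)) \<le> (if n - k \<le> i then 1 else 0)"
        proof (cases "n - k \<le> i")
          case False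
          then have "sing_val (X n) (n - k) \<le> sing_val (X n) (Suc i)" using i elim by (intro sing_val_antimono[OF X]) auto
          then show ?thesis using False big by (simp add: f_def)
        qed (simp add: f_def)
      qed
      also have "\<dots> = real (card ({..<n} \<inter> {i. n - k \<le> i}))" by (simp add: sum.If_cases)
      also have "{..<n} \<inter> {i. n - k \<le> i} = {n - k..<n}" by auto
      also have "real (card {n - k..<n}) = real k" using elim by simp
      finally have "(\<Sum>i<n. f (sing_val (X n) (Suc i))) / real n \<le> real k / real n" by (intro divide_right_mono) auto
      then show False using elim by simp
    qed
  qed
qed

end

subsection \<open>The perturbed random matrices\<close>

lemma low_rank_eq:
  assumes U: "U \<in> carrier_mat n r" and V: "V \<in> carrier_mat n r"
  shows "low_rank n r \<theta> U V = U * diagonal r (\<lambda>i. complex_of_real (\<theta> (Suc i))) * mat_adjoint V"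
proof (rule eq_matI)
  fix k l assume "k < dim_row (U * diagonal r (\<lambda>i. complex_of_real (\<theta> (Suc i))) * mat_adjoint V)"
    "l < dim_col (U * diagonal r (\<lambda>i. complex_of_real (\<theta> (Suc i))) * mat_adjoint V)"
  then have kl: "k < n" "l < n" using U V by auto
  have "(U * diagonal r (\<lambda>i. complex_of_real (\<theta> (Suc i))) * mat_adjoint V) $$ (k, l)
     = (\<Sum>i<r. U $$ (k, i) * complex_of_real (\<theta> (Suc i)) * cnj (V $$ (l, i)))"
    unfolding mult_diagonal[OF U] using kl carrier_matD[OF U] carrier_matD[OF V]
    by (simp add: scalar_prod_def atLeast0LessThan)
  also have "\<dots> = (\<Sum>i\<in>{1..r}. complex_of_real (\<theta> i) * U $$ (k, i - 1) * cnj (V $$ (l, i - 1)))"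
    by (rule sum.reindex_bij_witness[of _ "\<lambda>i. i - 1" Suc]) auto
  finally show "low_rank n r \<theta> U V $$ (k, l) = (U * diagonal r (\<lambda>i. complex_of_real (\<theta> (Suc i))) * mat_adjoint V) $$ (k, l)"
    using kl by (simp add: low_rank_def)
qed (use U V in \<open>auto simp: low_rank_def\<close>)

lemma frob_one: "frob (1\<^sub>m n) = real n"
proof -
  have "frob (1\<^sub>m n) = (\<Sum>i<n. \<Sum>j<n. if j = i then 1 else 0)"
    unfolding frob_def by (intro sum.cong) auto
  then show ?thesis by simp
qed

lemma mtrace_one: "mtrace (1\<^sub>m n) = of_nat n"
  by (simp add: mtrace_def)

locale spiked_model = random_model \<nu> M X Gu Gv r + E: edge_law \<mu> a
  for \<nu> :: "complex measure" and M :: "'w measure" and X Gu Gv :: "nat \<Rightarrow> 'w \<Rightarrow> complex mat" and r :: nat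
    and \<mu> :: "real measure" and a :: real +
  fixes \<theta> :: "nat \<Rightarrow> real" and U V :: "nat \<Rightarrow> 'w \<Rightarrow> complex mat"
  assumes X_weak: "AE \<omega> in M. weak_conv_m (\<lambda>n. sing_val_measure (X n \<omega>)) \<mu>"
    and X_smallest: "AE \<omega> in M. (\<lambda>n. sing_val (X n \<omega>) n) \<longlonglongrightarrow> a"
    and \<theta>_decr: "\<And>i j. 1 \<le> i \<Longrightarrow> i \<le> j \<Longrightarrow> j \<le> r \<Longrightarrow> \<theta> j \<le> \<theta> i"
    and \<theta>_pos: "\<And>i. 1 \<le> i \<Longrightarrow> i \<le> r \<Longrightarrow> \<theta> i > 0"
    and model:
      "(\<forall>n. \<forall>\<omega>\<in>space M. iid_columns n (Gu n \<omega>) (U n \<omega>) \<and> iid_columns n (Gv n \<omega>) (V n \<omega>)) \<or>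
       (\<forall>n. \<forall>\<omega>\<in>space M. gram_schmidt_columns n (Gu n \<omega>) (U n \<omega>) \<and>
                           gram_schmidt_columns n (Gv n \<omega>) (V n \<omega>))"
begin

abbreviation "Rs z n \<omega> \<equiv> resolvent n z (X n \<omega>)"

text \<open>The four pairings of \<open>forms_close\<close> for the raw columns, together with that
  of \<open>Gu\<close> with itself, which Gram-Schmidt requires.\<close>

definition "raw_limits z \<omega> \<longleftrightarrow> (\<forall>i j. i < r \<and> j < r \<longrightarrow>
   (\<lambda>n. gram n (Gu n \<omega>) (1\<^sub>m n) (Gu n \<omega>) i j / of_nat n) \<longlonglongrightarrow> (if i = j then 1 else 0) \<and>
   (\<lambda>n. gram n (Gv n \<omega>) (1\<^sub>m n) (Gv n \<omega>) i j / of_nat n) \<longlonglongrightarrow> (if i = j then 1 else 0) \<and>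
   (\<lambda>n. gram n (Gv n \<omega>) (mat_adjoint (X n \<omega>) * Rs z n \<omega> * X n \<omega>) (Gv n \<omega>) i j / of_nat n)
      \<longlonglongrightarrow> (if i = j then complex_of_real (1 + z\<^sup>2 * E.m z) else 0) \<and>
   (\<lambda>n. gram n (Gu n \<omega>) (Rs z n \<omega> * X n \<omega>) (Gv n \<omega>) i j / of_nat n) \<longlonglongrightarrow> 0 \<and>
   (\<lambda>n. gram n (Gu n \<omega>) (Rs z n \<omega>) (Gu n \<omega>) i j / of_nat n) \<longlonglongrightarrow> (if i = j then complex_of_real (E.m z) else 0))"

definition "centered_limit E s s' i j \<omega> \<longleftrightarrow> (\<forall>B::nat. (\<forall>\<^sub>F n in sequentially. frob (E n (X n \<omega>)) \<le> real B * real n) \<longrightarrow>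
     (\<lambda>n. (gram n (G s n \<omega>) (E n (X n \<omega>)) (G s' n \<omega>) i j - (if s = s' \<and> i = j then mtrace (E n (X n \<omega>)) else 0)) / of_nat n) \<longlonglongrightarrow> 0)"

lemma centered_limitD:
  assumes "centered_limit E s s' i j \<omega>" "\<forall>\<^sub>F n in sequentially. frob (E n (X n \<omega>)) \<le> real B * real n"
    "(\<lambda>n. mtrace (E n (X n \<omega>)) / of_nat n) \<longlonglongrightarrow> e"
  shows "(\<lambda>n. gram n (G s n \<omega>) (E n (X n \<omega>)) (G s' n \<omega>) i j / of_nat n) \<longlonglongrightarrow> (if s = s' \<and> i = j then e else 0)"
proof -
  have "(\<lambda>n. (gram n (G s n \<omega>) (E n (X n \<omega>)) (G s' n \<omega>) i j - (if s = s' \<and> i = j then mtrace (E n (X n \<omega>)) else 0)) / of_nat n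
      + (if s = s' \<and> i = j then mtrace (E n (X n \<omega>)) / of_nat n else 0)) \<longlonglongrightarrow> 0 + (if s = s' \<and> i = j then e else 0)"
    using assms unfolding centered_limit_def by (intro tendsto_add) auto
  then show ?thesis by (cases "s = s' \<and> i = j") (auto simp: diff_divide_distrib)
qed

text \<open>The centered forms vanish in the limit, so what remains are normalized traces. Below the
  edge the resolvent is eventually bounded, which gives the Frobenius bounds, and its normalized
  trace is an empirical mean of 1 / (t^2 - z^2).\<close>

lemma raw_limits_AE:
  assumes z: "0 < z" "z < a"
  shows "AE \<omega> in M. raw_limits z \<omega>"
proof -
  \<comment> \<open>Numbering by naturals lets countable intersection treat all matrix functions and
    index pairs at once.\<close>
  define Es where "Es = (\<lambda>e::nat. if e = 0 then (\<lambda>n Y. 1\<^sub>m n) else if e = 1 then (\<lambda>n Y. mat_adjoint Y * resolvent n z Y * Y)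
     else if e = 2 then (\<lambda>n Y. resolvent n z Y * Y) else (\<lambda>n Y. resolvent n z Y))"
  have Em: "meas_mat N n n (\<lambda>x. Es e n (A x))" if A: "meas_mat N n n A" for e n A and N :: "(bool \<times> nat \<times> nat \<Rightarrow> complex) measure"
    unfolding Es_def using A
    by (auto intro!: meas_mat_const meas_mat_mult meas_mat_adjoint meas_mat_resolvent)
  have "AE \<omega> in M. i < r \<longrightarrow> j < r \<longrightarrow> centered_limit (Es e) s s' i j \<omega>" for i j e s s'
  proof (cases "i < r \<and> j < r")
    case True
    then show ?thesis using gram_AE[of "Es e" i j s s', OF Em] unfolding centered_limit_def by simp
  qed auto
  then have "AE \<omega> in M. \<forall>i j e s s'. i < r \<longrightarrow> j < r \<longrightarrow> centered_limit (Es e) s s' i j \<omega>"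
    unfolding AE_all_countable by blast
  then show ?thesis using X_weak X_smallest AE_space
  proof eventually_elim
    case (elim \<omega>)
    have Xd: "X n \<omega> \<in> carrier_mat n n" for n using X_dim elim(4) by blast
    \<comment> \<open>The smallest singular value eventually exceeds this level, which keeps the
      spectrum away from z^2.\<close>
    define s where "s = (z + a) / 2"
    have s: "z < s" "s < a" using z by (auto simp: s_def)
    have ev: "\<forall>\<^sub>F n in sequentially. s \<le> sing_val (X n \<omega>) n"
      using order_tendstoD(1)[OF elim(3) s(2)] by eventually_elim simp
    define c where "c = 1 / (s\<^sup>2 - z\<^sup>2)"
    obtain B0 :: nat where B0: "(1 + c + z\<^sup>2 * c)\<^sup>2 \<le> real B0" using real_arch_simple by blast
    \<comment> \<open>The added 1 covers the identity matrix, whose squared norm is n.\<close>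
    define B where "B = B0 + 1"
    have fb: "\<forall>\<^sub>F n in sequentially. frob (Es e n (X n \<omega>)) \<le> real B * real n" for e
      using ev eventually_gt_at_top[of 0]
    proof eventually_elim
      case (elim n)
      have "(1 + c + z\<^sup>2 * c)\<^sup>2 \<le> real B" using B0 by (simp add: B_def)
      then have le: "real n * (1 + c + z\<^sup>2 * c)\<^sup>2 \<le> real B * real n" by (subst mult.commute) (intro mult_right_mono, auto)
      have n: "n \<ge> 1" using elim(2) by simp
      note rf = resolvent_facts(5,6,7)[OF Xd z(1) s(1) elim(1) n, folded c_def]
      have "real n \<le> real B * real n" by (simp add: B_def mult_le_cancel_right1)
      then show ?case
        using order_trans[OF rf(1) le] order_trans[OF rf(2) le] order_trans[OF rf(3) le] unfolding Es_def
        by (simp only: frob_one split: if_split) blast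
    qed
    have trR: "(\<lambda>n. mtrace (Rs z n \<omega>) / of_nat n) \<longlonglongrightarrow> complex_of_real (E.m z)"
    proof (rule Lim_transform_eventually)
      show "(\<lambda>n. complex_of_real ((\<Sum>i<n. 1 / ((sing_val (X n \<omega>) (Suc i))\<^sup>2 - z\<^sup>2)) / real n)) \<longlonglongrightarrow> complex_of_real (E.m z)"
        by (intro tendsto_of_real E.stieltjes_tendsto[OF Xd elim(2) z(1) s ev])
      show "\<forall>\<^sub>F n in sequentially. complex_of_real ((\<Sum>i<n. 1 / ((sing_val (X n \<omega>) (Suc i))\<^sup>2 - z\<^sup>2)) / real n) = mtrace (Rs z n \<omega>) / of_nat n"
        using ev eventually_gt_at_top[of 0]
      proof eventually_elim
        case (elim n)
        show ?case using resolvent_facts(3)[OF Xd z(1) s(1) elim(1)] elim(2) by simp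
      qed
    qed
    have trN: "(\<lambda>n. mtrace (mat_adjoint (X n \<omega>) * Rs z n \<omega> * X n \<omega>) / of_nat n) \<longlonglongrightarrow> complex_of_real (1 + z\<^sup>2 * E.m z)"
    proof (rule Lim_transform_eventually)
      have "(\<lambda>n. 1 + complex_of_real (z\<^sup>2) * (mtrace (Rs z n \<omega>) / of_nat n)) \<longlonglongrightarrow> 1 + complex_of_real (z\<^sup>2) * complex_of_real (E.m z)"
        by (intro tendsto_intros trR)
      then show "(\<lambda>n. 1 + complex_of_real (z\<^sup>2) * (mtrace (Rs z n \<omega>) / of_nat n)) \<longlonglongrightarrow> complex_of_real (1 + z\<^sup>2 * E.m z)" by simp
      show "\<forall>\<^sub>F n in sequentially. 1 + complex_of_real (z\<^sup>2) * (mtrace (Rs z n \<omega>) / of_nat n) = mtrace (mat_adjoint (X n \<omega>) * Rs z n \<omega> * X n \<omega>) / of_nat n"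
        using ev eventually_gt_at_top[of 0]
      proof eventually_elim
        case (elim n)
        show ?case using resolvent_facts(4)[OF Xd z(1) s(1) elim(1)] elim(2) by (simp add: add_divide_distrib)
      qed
    qed
    have tr1: "(\<lambda>n. mtrace (1\<^sub>m n) / of_nat n) \<longlonglongrightarrow> 1"
      by (rule Lim_transform_eventually[OF tendsto_const], use eventually_gt_at_top[of 0] in eventually_elim) (simp add: mtrace_one)
    have cl: "centered_limit (Es e) s s' i j \<omega>" if "i < r" "j < r" for i j e s s' using elim(1) that by blast
    have RX0: "(\<lambda>n. gram n (Gu n \<omega>) (Rs z n \<omega> * X n \<omega>) (Gv n \<omega>) i j / of_nat n) \<longlonglongrightarrow> 0" if "i < r" "j < r" for i j
      using cl[OF that, of 2 True False, unfolded centered_limit_def] fb[of 2] by (auto simp: G_def Es_def)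
    show ?case unfolding raw_limits_def
    proof (intro allI impI, elim conjE, intro conjI)
      fix i j assume ij: "i < r" "j < r"
      show "(\<lambda>n. gram n (Gu n \<omega>) (1\<^sub>m n) (Gu n \<omega>) i j / of_nat n) \<longlonglongrightarrow> (if i = j then 1 else 0)"
        using centered_limitD[OF cl[OF ij, of 0 True True] fb, of 1] tr1 by (simp add: G_def Es_def)
      show "(\<lambda>n. gram n (Gv n \<omega>) (1\<^sub>m n) (Gv n \<omega>) i j / of_nat n) \<longlonglongrightarrow> (if i = j then 1 else 0)"
        using centered_limitD[OF cl[OF ij, of 0 False False] fb, of 1] tr1 by (simp add: G_def Es_def)
      show "(\<lambda>n. gram n (Gv n \<omega>) (mat_adjoint (X n \<omega>) * Rs z n \<omega> * X n \<omega>) (Gv n \<omega>) i j / of_nat n)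
          \<longlonglongrightarrow> (if i = j then complex_of_real (1 + z\<^sup>2 * E.m z) else 0)"
        using centered_limitD[OF cl[OF ij, of 1 False False] fb, of "complex_of_real (1 + z\<^sup>2 * E.m z)"] trN by (simp add: G_def Es_def)
      show "(\<lambda>n. gram n (Gu n \<omega>) (Rs z n \<omega> * X n \<omega>) (Gv n \<omega>) i j / of_nat n) \<longlonglongrightarrow> 0" by (rule RX0[OF ij])
      show "(\<lambda>n. gram n (Gu n \<omega>) (Rs z n \<omega>) (Gu n \<omega>) i j / of_nat n) \<longlonglongrightarrow> (if i = j then complex_of_real (E.m z) else 0)"
        using centered_limitD[OF cl[OF ij, of 3 True True] fb, of "complex_of_real (E.m z)"] trR by (simp add: G_def Es_def)
    qed
  qed
qed

lemma UV_carrier: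
  assumes "\<omega> \<in> space M"
  shows "U n \<omega> \<in> carrier_mat n r" "V n \<omega> \<in> carrier_mat n r"
  using model G_dim[OF assms, of n] assms
  by (auto simp: iid_columns_def gram_schmidt_columns_def)

text \<open>Both models have the form G T / sqrt n with T tending to the identity, and T is the
  identity in the i.i.d. model. From here on they are treated alike.\<close>

lemma model_coefficients:
  assumes w: "\<omega> \<in> space M" and lim: "raw_limits z \<omega>"
  obtains tu tv where "\<And>l j. l < r \<Longrightarrow> j < r \<Longrightarrow> (\<lambda>n. tu n l j) \<longlonglongrightarrow> (if l = j then 1 else (0::complex))"
    "\<And>l j. l < r \<Longrightarrow> j < r \<Longrightarrow> (\<lambda>n. tv n l j) \<longlonglongrightarrow> (if l = j then 1 else (0::complex))"
    "\<forall>\<^sub>F n in sequentially. \<forall>k<n. \<forall>j<r. U n \<omega> $$ (k, j) = (\<Sum>l<r. tu n l j * Gu n \<omega> $$ (k, l)) / complex_of_real (sqrt (real n))"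
    "\<forall>\<^sub>F n in sequentially. \<forall>k<n. \<forall>j<r. V n \<omega> $$ (k, j) = (\<Sum>l<r. tv n l j * Gv n \<omega> $$ (k, l)) / complex_of_real (sqrt (real n))"
  using model
proof
  assume iid: "\<forall>n. \<forall>\<omega>\<in>space M. iid_columns n (Gu n \<omega>) (U n \<omega>) \<and> iid_columns n (Gv n \<omega>) (V n \<omega>)"
  show ?thesis
  proof (rule that[of "\<lambda>n l j. if l = j then 1 else 0" "\<lambda>n l j. if l = j then 1 else 0"])
    have sm: "(\<Sum>l<r. (if l = j then 1 else 0) * x l) = x j" if "j < r" for x :: "nat \<Rightarrow> complex" and j
      using that by (simp add: if_distrib[where f="\<lambda>a. a * _"] cong: if_cong)
    show "\<forall>\<^sub>F n in sequentially. \<forall>k<n. \<forall>j<r. U n \<omega> $$ (k, j) = (\<Sum>l<r. (if l = j then 1 else 0) * Gu n \<omega> $$ (k, l)) / complex_of_real (sqrt (real n))"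
      using iid w carrier_matD[OF G_dim(1)[OF w]] by (intro always_eventually allI impI) (simp add: sm iid_columns_def)
    show "\<forall>\<^sub>F n in sequentially. \<forall>k<n. \<forall>j<r. V n \<omega> $$ (k, j) = (\<Sum>l<r. (if l = j then 1 else 0) * Gv n \<omega> $$ (k, l)) / complex_of_real (sqrt (real n))"
      using iid w carrier_matD[OF G_dim(2)[OF w]] by (intro always_eventually allI impI) (simp add: sm iid_columns_def)
  qed auto
next
  assume gs: "\<forall>n. \<forall>\<omega>\<in>space M. gram_schmidt_columns n (Gu n \<omega>) (U n \<omega>) \<and> gram_schmidt_columns n (Gv n \<omega>) (V n \<omega>)"
  obtain tu where tu: "\<forall>l<r. \<forall>j<r. (\<lambda>n. tu n l j) \<longlonglongrightarrow> (if l = j then 1 else (0::complex))"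
    "\<forall>\<^sub>F n in sequentially. \<forall>k<n. \<forall>j<r. U n \<omega> $$ (k, j) = (\<Sum>l<r. tu n l j * Gu n \<omega> $$ (k, l)) / complex_of_real (sqrt (real n))"
    using gram_schmidt_coefficients[of "\<lambda>n. Gu n \<omega>" r "\<lambda>n. U n \<omega>"] G_dim(1)[OF w] gs w lim unfolding raw_limits_def by auto
  obtain tv where tv: "\<forall>l<r. \<forall>j<r. (\<lambda>n. tv n l j) \<longlonglongrightarrow> (if l = j then 1 else (0::complex))"
    "\<forall>\<^sub>F n in sequentially. \<forall>k<n. \<forall>j<r. V n \<omega> $$ (k, j) = (\<Sum>l<r. tv n l j * Gv n \<omega> $$ (k, l)) / complex_of_real (sqrt (real n))"
    using gram_schmidt_coefficients[of "\<lambda>n. Gv n \<omega>" r "\<lambda>n. V n \<omega>"] G_dim(2)[OF w] gs w lim unfolding raw_limits_def by auto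
  show ?thesis by (rule that[of tu tv]) (use tu tv in auto)
qed

abbreviation "Y n \<omega> \<equiv> X n \<omega> + low_rank n r \<theta> (U n \<omega>) (V n \<omega>)"

lemma Y_carrier: "\<omega> \<in> space M \<Longrightarrow> Y n \<omega> \<in> carrier_mat n n"
  using X_dim[of \<omega> n] by (simp add: low_rank_def)

lemma perturbed_matrix_eventually:
  assumes w: "\<omega> \<in> space M" and z: "0 < z" "z < a" and sm: "(\<lambda>n. sing_val (X n \<omega>) n) \<longlonglongrightarrow> a"
  shows "\<forall>\<^sub>F n in sequentially. perturbed_matrix n r (X n \<omega>) (U n \<omega>) (V n \<omega>) (Rs z n \<omega>) (Y n \<omega>) (\<lambda>i. \<theta> (Suc i)) z \<and>
     (\<forall>x. x \<in> carrier_vec n \<longrightarrow> x \<noteq> 0\<^sub>v n \<longrightarrow> z\<^sup>2 * rip x x < rip (mat_adjoint (X n \<omega>) *\<^sub>v x) (mat_adjoint (X n \<omega>) *\<^sub>v x))"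
proof -
  define s where "s = (z + a) / 2"
  have s: "z < s" "s < a" using z by (auto simp: s_def)
  have "\<forall>\<^sub>F n in sequentially. s < sing_val (X n \<omega>) n" by (rule order_tendstoD(1)[OF sm s(2)])
  then show ?thesis using eventually_gt_at_top[of 0]
  proof eventually_elim
    case (elim n)
    have Xd: "X n \<omega> \<in> carrier_mat n n" using X_dim w by blast
    note rf = resolvent_facts[OF Xd z(1) s(1) less_imp_le[OF elim(1)]]
    show ?case
    proof (intro conjI allI impI)
      show "perturbed_matrix n r (X n \<omega>) (U n \<omega>) (V n \<omega>) (Rs z n \<omega>) (Y n \<omega>) (\<lambda>i. \<theta> (Suc i)) z"
        by unfold_locales (use Xd UV_carrier[OF w] \<theta>_pos z rf(1,2) elim(2) low_rank_eq[OF UV_carrier[OF w]] in auto)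
    qed (use rf(9) elim(2) in auto)
  qed
qed

lemma forms_close_eventually:
  assumes w: "\<omega> \<in> space M" and z: "0 < z" "z < a" and sm: "(\<lambda>n. sing_val (X n \<omega>) n) \<longlonglongrightarrow> a"
    and lim: "raw_limits z \<omega>" and e: "\<eta> > 0"
  shows "\<forall>\<^sub>F n in sequentially. perturbed_matrix.forms_close n r (X n \<omega>) (U n \<omega>) (V n \<omega>) (Rs z n \<omega>) z (E.m z) \<eta>"
proof -
  obtain tu tv where t: "\<And>l j. l < r \<Longrightarrow> j < r \<Longrightarrow> (\<lambda>n. tu n l j) \<longlonglongrightarrow> (if l = j then 1 else (0::complex))"
    "\<And>l j. l < r \<Longrightarrow> j < r \<Longrightarrow> (\<lambda>n. tv n l j) \<longlonglongrightarrow> (if l = j then 1 else (0::complex))"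
    "\<forall>\<^sub>F n in sequentially. \<forall>k<n. \<forall>j<r. U n \<omega> $$ (k, j) = (\<Sum>l<r. tu n l j * Gu n \<omega> $$ (k, l)) / complex_of_real (sqrt (real n))"
    "\<forall>\<^sub>F n in sequentially. \<forall>k<n. \<forall>j<r. V n \<omega> $$ (k, j) = (\<Sum>l<r. tv n l j * Gv n \<omega> $$ (k, l)) / complex_of_real (sqrt (real n))"
    by (rule model_coefficients[OF w lim]) blast
  note lim' = lim[unfolded raw_limits_def, rule_format]
  have lim1: "(\<lambda>n. gram n (Gv n \<omega>) (1\<^sub>m n) (Gv n \<omega>) i j / of_nat n) \<longlonglongrightarrow> (if i = j then complex_of_real 1 else 0)"
    if "i < r" "j < r" for i j
    unfolding of_real_1 using lim' that by blast
  have close: "\<forall>\<^sub>F n in sequentially. \<forall>i\<in>{..<r}. \<forall>j\<in>{..<r}. cmod (f n i j - y i j) \<le> \<eta>"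
    if "\<And>i j. i < r \<Longrightarrow> j < r \<Longrightarrow> (\<lambda>n. f n i j) \<longlonglongrightarrow> y i j" for f :: "nat \<Rightarrow> nat \<Rightarrow> nat \<Rightarrow> complex" and y
  proof (intro eventually_ball_finite ballI)
    fix i j assume "i \<in> {..<r}" "j \<in> {..<r}"
    then have "\<forall>\<^sub>F n in sequentially. dist (f n i j) (y i j) < \<eta>" using tendstoD[OF that e] by simp
    then show "\<forall>\<^sub>F n in sequentially. cmod (f n i j - y i j) \<le> \<eta>" by eventually_elim (simp add: dist_norm)
  qed auto
  have c1: "\<forall>\<^sub>F n in sequentially. \<forall>i\<in>{..<r}. \<forall>j\<in>{..<r}. cmod (gram n (V n \<omega>) (1\<^sub>m n) (V n \<omega>) i j - (if i = j then complex_of_real 1 else 0)) \<le> \<eta>"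
    by (rule close, rule gram_tendsto_of_coefficients[OF t(2,2,4,4)]) (use lim1 in blast)+
  have c2: "\<forall>\<^sub>F n in sequentially. \<forall>i\<in>{..<r}. \<forall>j\<in>{..<r}. cmod (gram n (V n \<omega>) (mat_adjoint (X n \<omega>) * Rs z n \<omega> * X n \<omega>) (V n \<omega>) i j
     - (if i = j then complex_of_real (1 + z\<^sup>2 * E.m z) else 0)) \<le> \<eta>"
    by (rule close, rule gram_tendsto_of_coefficients[OF t(2,2,4,4)]) (use lim' in blast)+
  have c3: "\<forall>\<^sub>F n in sequentially. \<forall>i\<in>{..<r}. \<forall>j\<in>{..<r}. cmod (gram n (U n \<omega>) (Rs z n \<omega> * X n \<omega>) (V n \<omega>) i j
     - (if i = j then complex_of_real 0 else 0)) \<le> \<eta>"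
    by (rule close, rule gram_tendsto_of_coefficients[OF t(1,2,3,4)]) (use lim' in auto)
  have c4: "\<forall>\<^sub>F n in sequentially. \<forall>i\<in>{..<r}. \<forall>j\<in>{..<r}. cmod (gram n (U n \<omega>) (Rs z n \<omega>) (U n \<omega>) i j
     - (if i = j then complex_of_real (E.m z) else 0)) \<le> \<eta>"
    by (rule close, rule gram_tendsto_of_coefficients[OF t(1,1,3,3)]) (use lim' in blast)+
  show ?thesis
    using c1 c2 c3 c4 perturbed_matrix_eventually[OF w z sm]
  proof eventually_elim
    case (elim n)
    then interpret P: perturbed_matrix n r "X n \<omega>" "U n \<omega>" "V n \<omega>" "Rs z n \<omega>" "Y n \<omega>" "\<lambda>i. \<theta> (Suc i)" z by blast
    show ?case unfolding P.forms_close_def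
    proof (intro allI impI)
      fix i j assume "i < r" "j < r"
      then have "i \<in> {..<r}" "j \<in> {..<r}" by auto
      then show "cmod (gram n (V n \<omega>) (1\<^sub>m n) (V n \<omega>) i j - (if i = j then complex_of_real 1 else 0)) \<le> \<eta> \<and>
        cmod (gram n (V n \<omega>) (mat_adjoint (X n \<omega>) * Rs z n \<omega> * X n \<omega>) (V n \<omega>) i j - (if i = j then complex_of_real (1 + z\<^sup>2 * E.m z) else 0)) \<le> \<eta> \<and>
        cmod (gram n (U n \<omega>) (Rs z n \<omega> * X n \<omega>) (V n \<omega>) i j - (if i = j then complex_of_real 0 else 0)) \<le> \<eta> \<and>
        cmod (gram n (U n \<omega>) (Rs z n \<omega>) (U n \<omega>) i j - (if i = j then complex_of_real (E.m z) else 0)) \<le> \<eta>"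
        using elim(1-4) by blast
    qed
  qed
qed

section \<open>Eventual bounds at a fixed level z\<close>

context
  fixes \<omega> z
  assumes w: "\<omega> \<in> space M" and z: "0 < z" "z < a" and sm: "(\<lambda>n. sing_val (X n \<omega>) n) \<longlonglongrightarrow> a"
    and lim: "raw_limits z \<omega>"
begin

lemma exists_tolerance:
  assumes "\<delta> > 0"
  obtains \<eta> where "\<eta> > 0" "real r * (2 / z + 1 + z) * \<eta> < \<delta>"
proof
  define K where "K = real r * (2 / z + 1 + z) + 1"
  have K: "K > 0" unfolding K_def using z by (intro add_nonneg_pos mult_nonneg_nonneg) auto
  show "\<delta> / K > 0" using assms K by simp
  have "real r * (2 / z + 1 + z) * (\<delta> / K) < K * (\<delta> / K)"
    using assms K by (intro mult_strict_right_mono) (auto simp: K_def)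
  then show "real r * (2 / z + 1 + z) * (\<delta> / K) < \<delta>" using K by simp
qed

text \<open>Since the \<theta> decrease, the margin is smallest at index k, and one \<delta> serves
  the first k blocks.\<close>

lemma eventually_sing_val_le:
  assumes k: "1 \<le> k" "k \<le> r" and ph: "phi \<mu> z < - 1 / \<theta> k"
  shows "\<forall>\<^sub>F n in sequentially. sing_val (Y n \<omega>) (n + 1 - k) \<le> z"
proof -
  define \<delta> where "\<delta> = z * E.m z - 1 / \<theta> k"
  have d: "\<delta> > 0" using ph unfolding E.phi_eq \<delta>_def by simp
  obtain \<eta> where e: "\<eta> > 0" "real r * (2 / z + 1 + z) * \<eta> < \<delta>" by (rule exists_tolerance[OF d])
  show ?thesis
    using forms_close_eventually[OF w z sm lim e(1)] perturbed_matrix_eventually[OF w z sm] eventually_ge_at_top[of k]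
  proof eventually_elim
    case (elim n)
    then interpret P: perturbed_matrix n r "X n \<omega>" "U n \<omega>" "V n \<omega>" "Rs z n \<omega>" "Y n \<omega>" "\<lambda>i. \<theta> (Suc i)" z by blast
    show ?case
    proof (rule P.sing_val_le[OF k elim(3) elim(1) _ _ e(2)])
      show "\<delta> \<le> z * E.m z" using \<theta>_pos[OF k] by (simp add: \<delta>_def)
      fix i assume i: "i < k"
      then have "\<theta> k \<le> \<theta> (Suc i)" using k by (intro \<theta>_decr) auto
      then have "1 / \<theta> (Suc i) \<le> 1 / \<theta> k" using \<theta>_pos[OF k] by (simp add: frac_le)
      then show "\<delta> \<le> z * E.m z - 1 / \<theta> (Suc i)" by (simp add: \<delta>_def)
    qed
  qed
qed

lemma eventually_sing_val_gt:
  assumes k: "k \<le> r" and ph: "k < r \<Longrightarrow> - 1 / \<theta> (Suc k) < phi \<mu> z"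
  shows "\<forall>\<^sub>F n in sequentially. z < sing_val (Y n \<omega>) (n - k)"
proof -
  \<comment> \<open>For k = r no block has to be positive, so any positive margin will do.\<close>
  define \<delta> where "\<delta> = (if k < r then 1 / \<theta> (Suc k) - z * E.m z else 1)"
  have d: "\<delta> > 0" using ph unfolding E.phi_eq \<delta>_def by simp
  obtain \<eta> where e: "\<eta> > 0" "real r * (2 / z + 1 + z) * \<eta> < \<delta>" by (rule exists_tolerance[OF d])
  show ?thesis
    using forms_close_eventually[OF w z sm lim e(1)] perturbed_matrix_eventually[OF w z sm] eventually_ge_at_top[of "k + 1"]
  proof eventually_elim
    case (elim n)
    then interpret P: perturbed_matrix n r "X n \<omega>" "U n \<omega>" "V n \<omega>" "Rs z n \<omega>" "Y n \<omega>" "\<lambda>i. \<theta> (Suc i)" z by blast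
    show ?case
    proof (rule P.sing_val_gt[OF k elim(3) elim(1) _ _ e(2)])
      fix i assume i: "k \<le> i" "i < r"
      then have "\<theta> (Suc i) \<le> \<theta> (Suc k)" by (intro \<theta>_decr) auto
      then have "1 / \<theta> (Suc k) \<le> 1 / \<theta> (Suc i)" using \<theta>_pos[of "Suc i"] i by (simp add: frac_le)
      then show "\<delta> \<le> 1 / \<theta> (Suc i) - z * E.m z" using i by (simp add: \<delta>_def)
    qed (use elim(2) in blast)
  qed
qed

end

text \<open>The rank bound moves the index by r, and n + 1 - i - r = n - (i + r - 1) keeps a fixed
  distance from n.\<close>

lemma eventually_sing_val_lt_edge:
  assumes w: "\<omega> \<in> space M" and wc: "weak_conv_m (\<lambda>n. sing_val_measure (X n \<omega>)) \<mu>" and e: "e > 0" and i: "1 \<le> i"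
  shows "\<forall>\<^sub>F n in sequentially. sing_val (Y n \<omega>) (n + 1 - i) < a + e"
  using E.sing_val_near_edge[OF X_dim[OF w] wc e, of "i + r - 1"] eventually_ge_at_top[of "i + r"]
proof eventually_elim
  case (elim n)
  note Xd = X_dim[OF w, of n] and UV = UV_carrier[OF w, of n]
  have "sing_val (Y n \<omega>) (n + 1 - i) \<le> sing_val (X n \<omega>) (n + 1 - i - r)"
  proof (rule sing_val_rank_perturbation[OF Xd Y_carrier[OF w] UV(1) _ i elim(2)])
    fix v assume v: "v \<in> carrier_vec n" "mat_adjoint (U n \<omega>) *\<^sub>v v = 0\<^sub>v r"
    have "V n \<omega> *\<^sub>v (diagonal r (\<lambda>i. complex_of_real (\<theta> (Suc i))) *\<^sub>v 0\<^sub>v r) = 0\<^sub>v n"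
      by (simp add: mult_mat_zero_vec[OF diagonal_carrier] mult_mat_zero_vec[OF UV(2)])
    then show "mat_adjoint (Y n \<omega>) *\<^sub>v v = mat_adjoint (X n \<omega>) *\<^sub>v v"
      unfolding low_rank_eq[OF UV] adjoint_perturbation_mult[OF Xd UV v(1)] v(2) using Xd
      by (simp add: right_zero_vec[of _ n])
  qed
  also have "n + 1 - i - r = n - (i + r - 1)" using i by simp
  also have "sing_val (X n \<omega>) \<dots> < a + e" by (rule elim(1))
  finally show ?case .
qed

lemma AE_all_rationals:
  "AE \<omega> in M. \<forall>q::rat. 0 < real_of_rat q \<longrightarrow> real_of_rat q < a \<longrightarrow> raw_limits (real_of_rat q) \<omega>"
  unfolding AE_all_countable
proof
  fix q :: rat
  show "AE \<omega> in M. 0 < real_of_rat q \<longrightarrow> real_of_rat q < a \<longrightarrow> raw_limits (real_of_rat q) \<omega>"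
    by (cases "0 < real_of_rat q \<and> real_of_rat q < a") (use raw_limits_AE[of "real_of_rat q"] in auto)
qed

text \<open>Below the limit l the function phi stays above -1 / \<theta> i, which gives the lower
  bound in both cases. The upper bound comes from the crossing just after l when l < a, and from the
  rank bound when l = a.\<close>

theorem sing_val_limit:
  assumes i: "1 \<le> i" "i \<le> r"
  shows "AE \<omega> in M. (\<lambda>n. sing_val (Y n \<omega>) (n + 1 - i))
     \<longlonglongrightarrow> (if ereal (\<theta> i) > lower_threshold \<mu> a then phi_inv \<mu> a (- 1 / \<theta> i) else a)"
  using AE_all_rationals X_weak X_smallest AE_space
proof eventually_elim
  case (elim \<omega>)
  note th = \<theta>_pos[OF i]
  define l where "l = (if ereal (\<theta> i) > lower_threshold \<mu> a then phi_inv \<mu> a (- 1 / \<theta> i) else a)"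
  have l: "0 < l" "l \<le> a" using E.phi_inv_props[OF th] E.a_pos by (auto simp: l_def less_imp_le)
  have below: "- 1 / \<theta> i < phi \<mu> z" if z: "0 < z" "z < l" for z
  proof (cases "lower_threshold \<mu> a < ereal (\<theta> i)")
    case True
    then show ?thesis using E.phi_strict_antimono[of z l] E.phi_inv_props[OF th True] z by (simp add: l_def)
  next
    case False
    then have "z < a" using z l by simp
    \<comment> \<open>Absence of a crossing yields only a weak inequality; passing to the midpoint
      of z and a makes it strict.\<close>
    then have "phi \<mu> ((z + a) / 2) < phi \<mu> z" using z by (intro E.phi_strict_antimono) auto
    moreover have "- 1 / \<theta> i \<le> phi \<mu> ((z + a) / 2)"
    proof (rule ccontr)
      assume "\<not> ?thesis"
      then have "0 < (z + a) / 2" "(z + a) / 2 < a" "phi \<mu> ((z + a) / 2) < - 1 / \<theta> i"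
        using z \<open>z < a\<close> by (simp_all add: not_le)
      with False E.less_threshold_iff[OF th] show False by blast
    qed
    ultimately show ?thesis by simp
  qed
  have "(\<lambda>n. sing_val (Y n \<omega>) (n + 1 - i)) \<longlonglongrightarrow> l"
  proof (rule order_tendstoI)
    fix c assume "c < l"
    \<comment> \<open>The maximum with 0 keeps q positive when c is negative.\<close>
    then obtain q where q: "max c 0 < real_of_rat q" "real_of_rat q < l" using l of_rat_dense[of "max c 0" l] by auto
    \<comment> \<open>Here k = i - 1, so that the index n - k becomes n + 1 - i.\<close>
    have "\<forall>\<^sub>F n in sequentially. real_of_rat q < sing_val (Y n \<omega>) (n - (i - 1))"
      by (rule eventually_sing_val_gt[OF elim(4)]) (use q l elim i below[of "real_of_rat q"] in auto)
    then show "\<forall>\<^sub>F n in sequentially. c < sing_val (Y n \<omega>) (n + 1 - i)"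
      using i q by (auto elim!: eventually_mono)
  next
    fix c assume c: "l < c"
    show "\<forall>\<^sub>F n in sequentially. sing_val (Y n \<omega>) (n + 1 - i) < c"
    proof (cases "lower_threshold \<mu> a < ereal (\<theta> i)")
      case True
      note pr = E.phi_inv_props[OF th True]
      have la: "l < a" using pr True by (simp add: l_def)
      then obtain q where q: "l < real_of_rat q" "real_of_rat q < min a c" using c of_rat_dense[of l "min a c"] by auto
      have "phi \<mu> (real_of_rat q) < phi \<mu> l" using q l by (intro E.phi_strict_antimono) auto
      also have "phi \<mu> l = - 1 / \<theta> i" using pr True by (simp add: l_def)
      finally have ph: "phi \<mu> (real_of_rat q) < - 1 / \<theta> i" .
      have qa: "0 < real_of_rat q" "real_of_rat q < a" using q l by linarith+
      then have "raw_limits (real_of_rat q) \<omega>" using elim(1) by blast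
      from eventually_sing_val_le[OF elim(4) qa elim(3) this i ph]
      have "\<forall>\<^sub>F n in sequentially. sing_val (Y n \<omega>) (n + 1 - i) \<le> real_of_rat q" .
      then show ?thesis using q by (auto elim!: eventually_mono)
    next
      case False
      then have "c - a > 0" using c by (simp add: l_def)
      from eventually_sing_val_lt_edge[OF elim(4,2) this i(1)] show ?thesis by simp
    qed
  qed
  then show ?case by (simp only: l_def)
qed

text \<open>At k = r the singular value of index n - r eventually exceeds every level below a, and
  the smaller index n + 1 - i carries one at least as large.\<close>

theorem sing_val_limit_edge:
  assumes i: "i > r"
  shows "AE \<omega> in M. (\<lambda>n. sing_val (Y n \<omega>) (n + 1 - i)) \<longlonglongrightarrow> a"
  using AE_all_rationals X_weak X_smallest AE_space
proof eventually_elim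
  case (elim \<omega>)
  show ?case
  proof (rule order_tendstoI)
    fix c assume "c < a"
    then obtain q where q: "max c 0 < real_of_rat q" "real_of_rat q < a" using E.a_pos of_rat_dense[of "max c 0" a] by auto
    have "\<forall>\<^sub>F n in sequentially. real_of_rat q < sing_val (Y n \<omega>) (n - r)"
      by (rule eventually_sing_val_gt[OF elim(4)]) (use q elim in auto)
    then show "\<forall>\<^sub>F n in sequentially. c < sing_val (Y n \<omega>) (n + 1 - i)"
      using eventually_ge_at_top[of i]
    proof eventually_elim
      case (elim n)
      have "sing_val (Y n \<omega>) (n - r) \<le> sing_val (Y n \<omega>) (n + 1 - i)"
        using i elim(2) by (intro sing_val_antimono[OF Y_carrier[OF \<open>\<omega> \<in> space M\<close>]]) auto
      then show ?case using elim(1) q by simp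
    qed
  next
    fix c assume "a < c"
    then have "c - a > 0" by simp
    from eventually_sing_val_lt_edge[OF elim(4,2) this, of i] i
    show "\<forall>\<^sub>F n in sequentially. sing_val (Y n \<omega>) (n + 1 - i) < c" by simp
  qed
qed

end

theorem theorem2p13:
  fixes K :: "complex set"
    and M :: "'w measure"
    and X Gu Gv U V :: "nat \<Rightarrow> 'w \<Rightarrow> complex mat"
    and r :: nat and \<theta> :: "nat \<Rightarrow> real"
    and \<nu> :: "complex measure" and \<mu>X :: "real measure" and a :: real
  assumes K: "K = \<real> \<or> K = UNIV"
    and M: "prob_space M"
    (* the random matrices X n *)
    and X_dim: "\<And>n \<omega>. \<omega> \<in> space M \<Longrightarrow> X n \<omega> \<in> carrier_mat n n"
    and X_K: "\<And>n \<omega> i j. \<omega> \<in> space M \<Longrightarrow> i < n \<Longrightarrow> j < n \<Longrightarrow> X n \<omega> $$ (i, j) \<in> K"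
    and X_meas: "\<And>n i j. i < n \<Longrightarrow> j < n \<Longrightarrow> (\<lambda>\<omega>. X n \<omega> $$ (i, j)) \<in> borel_measurable M"
    (* the limit law *)
    and \<mu>X: "prob_space \<mu>X" "sets \<mu>X = sets borel" "compact (measure_support \<mu>X)"
    and X_weak: "AE \<omega> in M. weak_conv_m (\<lambda>n. sing_val_measure (X n \<omega>)) \<mu>X"
    and a_def: "a = Inf (measure_support \<mu>X)"
    and X_smallest: "AE \<omega> in M. (\<lambda>n. sing_val (X n \<omega>) n) \<longlonglongrightarrow> a"
    and a_pos: "a > 0"
    (* the law nu *)
    and \<nu>: "prob_space \<nu>" "sets \<nu> = sets borel" "AE z in \<nu>. z \<in> K"
    and \<nu>_mean: "integrable \<nu> (\<lambda>z. z)" "(\<integral>z. z \<partial>\<nu>) = 0"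
    and \<nu>_var: "integrable \<nu> (\<lambda>z. (cmod z)\<^sup>2)" "(\<integral>z. (cmod z)\<^sup>2 \<partial>\<nu>) = 1"
    and \<nu>_lsi: "log_sobolev_over K \<nu>"
    (* the parameters of the perturbation *)
    and r: "r \<ge> 1"
    and \<theta>_decr: "\<And>i j. 1 \<le> i \<Longrightarrow> i \<le> j \<Longrightarrow> j \<le> r \<Longrightarrow> \<theta> j \<le> \<theta> i"
    and \<theta>_pos: "\<And>i. 1 \<le> i \<Longrightarrow> i \<le> r \<Longrightarrow> \<theta> i > 0"
    (* for every n, the 2nr entries of Gu n and Gv n are i.i.d. of law nu *)
    and G_dim: "\<And>n \<omega>. \<omega> \<in> space M \<Longrightarrow> Gu n \<omega> \<in> carrier_mat n r"
               "\<And>n \<omega>. \<omega> \<in> space M \<Longrightarrow> Gv n \<omega> \<in> carrier_mat n r"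
    and G_indep: "\<And>n. prob_space.indep_vars M (\<lambda>_. borel)
        (\<lambda>(s, i, j) \<omega>. (if s then Gu n \<omega> else Gv n \<omega>) $$ (i, j))
        (UNIV \<times> {0..<n} \<times> {0..<r})"
    and G_law: "\<And>n i j. i < n \<Longrightarrow> j < r \<Longrightarrow> distr M borel (\<lambda>\<omega>. Gu n \<omega> $$ (i, j)) = \<nu>"
               "\<And>n i j. i < n \<Longrightarrow> j < r \<Longrightarrow> distr M borel (\<lambda>\<omega>. Gv n \<omega> $$ (i, j)) = \<nu>"
    (* the family (Gu n, Gv n) over all n is independent of the family (X n) over all n *)
    and GX_indep: "prob_space.indep_set M
        (generated_events M {(s, n, i, j). i < n \<and> j < r}
           (\<lambda>(s :: bool, n, i, j) \<omega>. (if s then Gu n \<omega> else Gv n \<omega>) $$ (i, j)))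
        (generated_events M {(n, i, j). i < n \<and> j < n}
           (\<lambda>(n, i, j) \<omega>. X n \<omega> $$ (i, j)))"
    (* either the i.i.d. model or the orthonormalized model *)
    and model:
      "(\<forall>n. \<forall>\<omega>\<in>space M. iid_columns n (Gu n \<omega>) (U n \<omega>) \<and> iid_columns n (Gv n \<omega>) (V n \<omega>)) \<or>
       (\<forall>n. \<forall>\<omega>\<in>space M. gram_schmidt_columns n (Gu n \<omega>) (U n \<omega>) \<and>
                           gram_schmidt_columns n (Gv n \<omega>) (V n \<omega>))"
  shows
    "(\<forall>i. 1 \<le> i \<and> i \<le> r \<longrightarrow>
        (AE \<omega> in M.
          (\<lambda>n. sing_val (X n \<omega> + low_rank n r \<theta> (U n \<omega>) (V n \<omega>)) (n + 1 - i))
            \<longlonglongrightarrow> (if ereal (\<theta> i) > lower_threshold \<mu>X a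
                then phi_inv \<mu>X a (- 1 / \<theta> i) else a))) \<and>
     (\<forall>i>r. AE \<omega> in M.
        (\<lambda>n. sing_val (X n \<omega> + low_rank n r \<theta> (U n \<omega>) (V n \<omega>)) (n + 1 - i)) \<longlonglongrightarrow> a)"
proof -
  \<comment> \<open>The fourth power of 1 + |z|^2 is the moment asked for by
    \<open>standard_law\<close>.\<close>
  have law: "standard_law \<nu>"
    using \<nu> \<nu>_mean \<nu>_var log_sobolev_over_moments[OF K \<nu> \<nu>_lsi \<nu>_var(1), of 4]
    by (intro standard_law.intro standard_law_axioms.intro) auto
  have edge: "edge_law \<mu>X a"
    using \<mu>X a_def a_pos by (intro edge_law.intro edge_law_axioms.intro) auto
  have random: "random_model \<nu> M X Gu Gv r"
    by (intro random_model.intro random_model_axioms.intro law M X_dim X_meas r G_dim G_indep G_law GX_indep)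
  interpret spiked_model \<nu> M X Gu Gv r \<mu>X a \<theta> U V
    by (intro spiked_model.intro spiked_model_axioms.intro random edge X_weak X_smallest \<theta>_decr \<theta>_pos model)
  show ?thesis
    using sing_val_limit sing_val_limit_edge by blast
qed

end
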